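(* Let $\lambda$ be a partition of $n$ with distinct parts. Then $$\operatorname{ch}(L_\lambda)=\sum_{\mu\vdash n}|\operatorname{SYT}_\lambda(\mu)|\,s_\mu.$$
   Context: Let $V=\mathbb{C}^N$, let $\operatorname{Lie}(V)$ be the free Lie algebra on $V$ inside the tensor algebra $T(V)$ (generated by $V$ under the commutator bracket), and $\mathcal L_m(V)=\operatorname{Lie}(V)\cap V^{\otimes m}$. For a partition $\lambda$ with $m_i(\lambda)$ parts equal to $i$, the higher Lie module is the $\operatorname{GL}(V)$-module $L_\lambda=\bigotimes_{i\ge1}\operatorname{Sym}^{m_i(\lambda)}(\mathcal L_i(V))$, and $L_n:=L_{(n)}$. $\operatorname{ch}(L_\lambda)$ denotes its character as a symmetric function of the eigenvalues $x_1,\dots,x_N$ of $g\in \operatorname{GL}(V)$, in the limit $N\to\infty$ (a symmetric function in infinitely many variables). Equivalently $\operatorname{ch}(L_\lambda)=\prod_{i\ge1}h_{m_i(\lambda)}[\operatorname{ch}(L_i)]$ (plethysm). $s_\mu$ is the Schur function. $\operatorname{SYT}(\mu)$ is the set of standard Young tableaux of shape $\mu$ (English notation). $\operatorname{Des}(T)=\{i: i+1$ lies in a lower row of $T$ than $i\}$. $[a,b]$ is the set of integers from $a$ to $b$. For $\lambda=(\lambda_1,\dots,\lambda_r)\vdash n$ let $B_{\lambda,i}=[\lambda_1+\cdots+\lambda_{i-1}+1,\lambda_1+\cdots+\lambda_i]$, let $\operatorname{Des}_{\lambda,i}(T)=\{d-(\lambda_1+\cdots+\lambda_{i-1}): d\in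 \operatorname{Des}(T),\ d,d+1\in B_{\lambda,i}\}$, and let $\operatorname{maj}_{\lambda,i}(T)$ be the sum of the elements of $\operatorname{Des}_{\lambda,i}(T)$. Set $\operatorname{SYT}_\lambda(\mu)=\{T\in\operatorname{SYT}(\mu):\operatorname{maj}_{\lambda,i}(T)\equiv1\pmod{\lambda_i}\text{ for all }i\}$. *)

theory Defs
  imports
    "HOL-Library.Poly_Mapping"
    "HOL-Library.Multiset"
    "HOL-Number_Theory.Cong"
    "Jordan_Normal_Form.Char_Poly"
begin

section \<open>Vector spaces with a basis, tensor and symmetric algebras\<close>

text \<open>
  \<open>'a \<Rightarrow>\<^sub>0 complex\<close> is the complex vector space with basis \<open>'a\<close>. The convolution product that
  \<^theory>\<open>HOL-Library.Poly_Mapping\<close> puts on such a type for a monoid of keys turns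
  \<open>'a list \<Rightarrow>\<^sub>0 complex\<close> into the tensor algebra of \<open>'a \<Rightarrow>\<^sub>0 complex\<close> (words under concatenation), and
  \<open>'a multiset \<Rightarrow>\<^sub>0 complex\<close> into its symmetric algebra (commutative monomials).
\<close>

instantiation list :: (type) monoid_add
begin

definition zero_list :: "'a list" where "zero_list = []"

definition plus_list :: "'a list \<Rightarrow> 'a list \<Rightarrow> 'a list" where "plus_list u v = u @ v"

instance by standard (simp_all add: zero_list_def plus_list_def)

end

definition scale :: "complex \<Rightarrow> ('a \<Rightarrow>\<^sub>0 complex) \<Rightarrow> ('a \<Rightarrow>\<^sub>0 complex)" where
  "scale c p = Poly_Mapping.map (\<lambda>x. c * x) p"

lemma lookup_scale: "Poly_Mapping.lookup (scale c p) k = c * Poly_Mapping.lookup p k"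
  by (simp add: scale_def Poly_Mapping.map.rep_eq when_def)

global_interpretation pm: vector_space "scale :: complex \<Rightarrow> ('a \<Rightarrow>\<^sub>0 complex) \<Rightarrow> ('a \<Rightarrow>\<^sub>0 complex)"
  by standard (auto intro!: poly_mapping_eqI simp: lookup_scale Poly_Mapping.lookup_add algebra_simps)

definition linear_ext :: "('a \<Rightarrow> ('b \<Rightarrow>\<^sub>0 complex)) \<Rightarrow> ('a \<Rightarrow>\<^sub>0 complex) \<Rightarrow> ('b \<Rightarrow>\<^sub>0 complex)" where
  "linear_ext f p = (\<Sum>a\<in>Poly_Mapping.keys p. scale (Poly_Mapping.lookup p a) (f a))"

definition tens_of :: "('a \<Rightarrow>\<^sub>0 complex) \<Rightarrow> ('a list \<Rightarrow>\<^sub>0 complex)" where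
  "tens_of = linear_ext (\<lambda>a. Poly_Mapping.single [a] 1)"

definition sym_of :: "('a \<Rightarrow>\<^sub>0 complex) \<Rightarrow> ('a multiset \<Rightarrow>\<^sub>0 complex)" where
  "sym_of = linear_ext (\<lambda>a. Poly_Mapping.single {#a#} 1)"

text \<open>
  For subspaces \<open>U\<^sub>1, \<dots>, U\<^sub>k\<close> of \<open>'a \<Rightarrow>\<^sub>0 complex\<close>, the tensor product \<open>U\<^sub>1 \<otimes> \<dots> \<otimes> U\<^sub>k\<close> is
  realised inside the degree-\<open>k\<close> part of the tensor algebra, and \<open>Sym\<^sup>k(U)\<close> inside the degree-\<open>k\<close>
  part of the symmetric algebra; over a field both functors preserve inclusions of subspaces.
\<close>

definition tensor_product :: "('a \<Rightarrow>\<^sub>0 complex) set list \<Rightarrow> ('a list \<Rightarrow>\<^sub>0 complex) set" where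
  "tensor_product Us = pm.span {prod_list (map tens_of us) |us. list_all2 (\<in>) us Us}"

definition sym_power :: "nat \<Rightarrow> ('a \<Rightarrow>\<^sub>0 complex) set \<Rightarrow> ('a multiset \<Rightarrow>\<^sub>0 complex) set" where
  "sym_power k U = pm.span {prod_list (map sym_of us) |us. length us = k \<and> set us \<subseteq> U}"

text \<open>The algebra endomorphisms induced by a linear endomorphism.\<close>

definition tensor_map ::
    "(('a \<Rightarrow>\<^sub>0 complex) \<Rightarrow> ('a \<Rightarrow>\<^sub>0 complex)) \<Rightarrow> ('a list \<Rightarrow>\<^sub>0 complex) \<Rightarrow> ('a list \<Rightarrow>\<^sub>0 complex)" where
  "tensor_map \<phi> = linear_ext (\<lambda>w. prod_list (map (\<lambda>a. tens_of (\<phi> (Poly_Mapping.single a 1))) w))"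

definition sym_map ::
    "(('a \<Rightarrow>\<^sub>0 complex) \<Rightarrow> ('a \<Rightarrow>\<^sub>0 complex)) \<Rightarrow> ('a multiset \<Rightarrow>\<^sub>0 complex) \<Rightarrow> ('a multiset \<Rightarrow>\<^sub>0 complex)" where
  "sym_map \<phi> = linear_ext (\<lambda>M. \<Prod>a\<in>#M. sym_of (\<phi> (Poly_Mapping.single a 1)))"

text \<open>
  The trace of \<open>\<phi>\<close> on a finite-dimensional \<open>\<phi>\<close>-invariant subspace \<open>W\<close>; it does not depend on the
  chosen basis.
\<close>

definition trace_on :: "('a \<Rightarrow>\<^sub>0 complex) set \<Rightarrow> (('a \<Rightarrow>\<^sub>0 complex) \<Rightarrow> ('a \<Rightarrow>\<^sub>0 complex)) \<Rightarrow> complex" where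
  "trace_on W \<phi> =
     (let B = (SOME B. pm.independent B \<and> pm.span B = W)
      in \<Sum>b\<in>B. pm.representation B (\<phi> b) b)"


section \<open>Higher Lie modules\<close>

text \<open>\<open>V = \<complex>\<^sup>N\<close> is spanned by the first \<open>N\<close> basis vectors of \<open>nat \<Rightarrow>\<^sub>0 complex\<close>.\<close>

definition std_space :: "nat \<Rightarrow> (nat \<Rightarrow>\<^sub>0 complex) set" where
  "std_space N = pm.span ((\<lambda>i. Poly_Mapping.single i 1) ` {..<N})"

definition mat_action :: "complex mat \<Rightarrow> (nat \<Rightarrow>\<^sub>0 complex) \<Rightarrow> (nat \<Rightarrow>\<^sub>0 complex)" where
  "mat_action g = linear_ext (\<lambda>j. \<Sum>i<dim_row g. Poly_Mapping.single i (g $$ (i, j)))"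

inductive_set free_lie :: "nat \<Rightarrow> (nat list \<Rightarrow>\<^sub>0 complex) set" for N where
  generator: "v \<in> std_space N \<Longrightarrow> tens_of v \<in> free_lie N"
| zero: "0 \<in> free_lie N"
| add: "p \<in> free_lie N \<Longrightarrow> q \<in> free_lie N \<Longrightarrow> p + q \<in> free_lie N"
| scale: "p \<in> free_lie N \<Longrightarrow> scale c p \<in> free_lie N"
| bracket: "p \<in> free_lie N \<Longrightarrow> q \<in> free_lie N \<Longrightarrow> p * q - q * p \<in> free_lie N"

definition lie_part :: "nat \<Rightarrow> nat \<Rightarrow> (nat list \<Rightarrow>\<^sub>0 complex) set" where
  "lie_part N m = free_lie N \<inter> tensor_product (replicate m (std_space N))"

text \<open>
  The tensor product runs over \<open>1 \<le> i \<le> sum_list lam\<close>; all further factors are \<open>Sym\<^sup>0 = \<complex>\<close>.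
\<close>

definition higher_lie :: "nat list \<Rightarrow> nat \<Rightarrow> (nat list multiset list \<Rightarrow>\<^sub>0 complex) set" where
  "higher_lie lam N =
     tensor_product (map (\<lambda>i. sym_power (count_list lam i) (lie_part N i)) [1..<Suc (sum_list lam)])"

definition higher_lie_action ::
    "complex mat \<Rightarrow> (nat list multiset list \<Rightarrow>\<^sub>0 complex) \<Rightarrow> (nat list multiset list \<Rightarrow>\<^sub>0 complex)" where
  "higher_lie_action g = tensor_map (sym_map (tensor_map (mat_action g)))"


section \<open>Symmetric functions and characters\<close>

text \<open>
  A formal power series in \<open>x\<^sub>0, x\<^sub>1, \<dots>\<close> is given by its coefficients; the monomial
  \<open>\<Prod>i\<in>#M. x\<^sub>i\<close> is encoded by the multiset \<open>M\<close>.
\<close>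

type_synonym power_series = "nat multiset \<Rightarrow> complex"

definition symmetric_function :: "power_series \<Rightarrow> bool" where
  "symmetric_function f \<longleftrightarrow>
     (\<exists>d. \<forall>M. f M \<noteq> 0 \<longrightarrow> size M \<le> d) \<and>
     (\<forall>\<pi> M. bij \<pi> \<longrightarrow> f (image_mset \<pi> M) = f M)"

text \<open>The value of \<open>f\<close> at \<open>(x\<^sub>0, \<dots>, x\<^bsub>N-1\<^esub>, 0, 0, \<dots>)\<close>.\<close>

definition eval_sym :: "power_series \<Rightarrow> complex list \<Rightarrow> complex" where
  "eval_sym f xs = (\<Sum>M | set_mset M \<subseteq> {..<length xs} \<and> f M \<noteq> 0. f M * (\<Prod>i\<in>#M. xs ! i))"

text \<open>
  The character of a family of \<open>GL\<^sub>N\<close>-modules \<open>W N\<close> in the limit \<open>N \<rightarrow> \<infinity>\<close>: the symmetric function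
  in infinitely many variables which for every \<open>N\<close>, restricted to \<open>N\<close> variables, gives the trace of
  \<open>g \<in> GL\<^sub>N\<close> in terms of the eigenvalues of \<open>g\<close>. It is unique, since diagonal matrices already
  determine all coefficients.
\<close>

definition is_character ::
    "(nat \<Rightarrow> ('a \<Rightarrow>\<^sub>0 complex) set) \<Rightarrow> (complex mat \<Rightarrow> ('a \<Rightarrow>\<^sub>0 complex) \<Rightarrow> ('a \<Rightarrow>\<^sub>0 complex)) \<Rightarrow>
      power_series \<Rightarrow> bool" where
  "is_character W \<rho> f \<longleftrightarrow>
     symmetric_function f \<and>
     (\<forall>N g xs. g \<in> carrier_mat N N \<and> invertible_mat g \<and> char_poly g = (\<Prod>x\<leftarrow>xs. [:- x, 1:]) \<longrightarrow>
        trace_on (W N) (\<rho> g) = eval_sym f xs)"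

definition ch_higher_lie :: "nat list \<Rightarrow> power_series" where
  "ch_higher_lie lam = (THE f. is_character (higher_lie lam) higher_lie_action f)"


section \<open>Tableaux\<close>

definition partitions :: "nat \<Rightarrow> nat list set" where
  "partitions n = {\<mu>. sorted_wrt (\<ge>) \<mu> \<and> (\<forall>p\<in>set \<mu>. p > 0) \<and> sum_list \<mu> = n}"

text \<open>A tableau is the list of its rows, from top to bottom (English notation).\<close>

definition columns_strict :: "nat list list \<Rightarrow> bool" where
  "columns_strict T \<longleftrightarrow>
     (\<forall>r c. Suc r < length T \<and> c < length (T ! r) \<and> c < length (T ! Suc r) \<longrightarrow> T ! r ! c < T ! Suc r ! c)"

definition SSYT :: "nat list \<Rightarrow> nat list list set" where
  "SSYT \<mu> = {T. map length T = \<mu> \<and> (\<forall>R\<in>set T. sorted_wrt (\<le>) R) \<and> columns_strict T}"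

definition SYT :: "nat list \<Rightarrow> nat list list set" where
  "SYT \<mu> = {T. map length T = \<mu> \<and> (\<forall>R\<in>set T. sorted_wrt (<) R) \<and> columns_strict T \<and>
     distinct (concat T) \<and> set (concat T) = {1..sum_list \<mu>}}"

definition schur :: "nat list \<Rightarrow> power_series" where
  "schur \<mu> M = of_nat (card {T \<in> SSYT \<mu>. mset (concat T) = M})"

definition Des :: "nat list list \<Rightarrow> nat set" where
  "Des T = {i. \<exists>r r'. r < r' \<and> r' < length T \<and> i \<in> set (T ! r) \<and> Suc i \<in> set (T ! r')}"

text \<open>
  Blocks are indexed from \<open>0\<close>: \<open>block lam i\<close> is the block of the part \<open>lam ! i\<close>, that is
  \<open>B\<^bsub>lam,i+1\<^esub>\<close> in the usual numbering.
\<close>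

definition offset :: "nat list \<Rightarrow> nat \<Rightarrow> nat" where
  "offset lam i = sum_list (take i lam)"

definition block :: "nat list \<Rightarrow> nat \<Rightarrow> nat set" where
  "block lam i = {offset lam i + 1 .. offset lam i + lam ! i}"

definition block_Des :: "nat list \<Rightarrow> nat \<Rightarrow> nat list list \<Rightarrow> nat set" where
  "block_Des lam i T = {d - offset lam i |d. d \<in> Des T \<and> d \<in> block lam i \<and> d + 1 \<in> block lam i}"

definition block_maj :: "nat list \<Rightarrow> nat \<Rightarrow> nat list list \<Rightarrow> nat" where
  "block_maj lam i T = \<Sum> (block_Des lam i T)"

definition SYT_maj :: "nat list \<Rightarrow> nat list \<Rightarrow> nat list list set" where
  "SYT_maj lam \<mu> = {T \<in> SYT \<mu>. \<forall>i<length lam. [block_maj lam i T = 1] (mod lam ! i)}"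

end

theory Submission
  imports Defs "Jordan_Normal_Form.Schur_Decomposition"
begin

text \<open>
  Let \<open>q\<close> be a primitive \<open>m\<close>-th root of unity. The Klyachko idempotent
  \<open>1/m * (\<Sum>\<sigma>. q ^ maj \<sigma> * \<sigma>)\<close>, the sum running over the permutations of \<open>m\<close> positions, maps the
  words of length \<open>m\<close> to primitive elements of the tensor algebra and fixes every primitive element.
  As a primitive element of degree \<open>m\<close> is, up to the factor \<open>m\<close>, its own Dynkin bracket, the
  idempotent is a projection onto the Lie part. So the trace of \<open>g\<close> on the Lie part is a weighted
  sum over permutations; conjugation by the long cycle, which shifts the major index modulo \<open>m\<close>, leaves
  only the powers of that cycle, and the same sum over rotations counts the words of length \<open>m\<close> in the
  eigenvalues of \<open>g\<close> whose major index is \<open>1\<close> modulo \<open>m\<close>.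

  When the parts of \<open>\<lambda>\<close> are distinct, only symmetric powers of exponent at most one occur, and the
  character is the product of these word sums: it counts the words of length \<open>n\<close> each of whose
  segments, cut according to \<open>\<lambda>\<close>, has major index \<open>1\<close> modulo its length. This is a condition
  on descent sets. For words with descents in a given set, iterating Pieri's rule gives the sum of the
  Schur functions of the standard tableaux with descents in that set, hence any sum over words with a
  condition on the descent set is the corresponding sum over standard tableaux.
\<close>

section \<open>Major indices and shuffles\<close>

text \<open>The trace is defined through an arbitrary basis of the module, and bases of the free Lie
  algebra are awkward to write down. A projection onto the Lie part avoids them: the trace becomes a
  sum over words, and permuting the places of words commutes with matrices.

  The Klyachko weights work because \<open>q ^ maj\<close>, summed over the shuffles of two words on
  disjoint letters of lengths \<open>k\<close> and \<open>m - k\<close>, has a Gaussian binomial as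
  a factor, which vanishes at a primitive \<open>m\<close>-th root of unity for
  \<open>0 < k < m\<close>. That primitive elements are fixed is a dual statement, where the
  constant \<open>m\<close> arises as the product of the \<open>1 - q ^ j\<close>.

  The major index depends on the order of the letters, but a character must be symmetric. Symmetry
  is therefore taken from the equivalent weighted count of words fixed by rotations, into which the
  order does not enter. The comparison with Schur functions uses no insertion algorithm: Pieri's
  rule handles descent sets contained in \<open>D\<close>, and inversion over subsets handles a
  prescribed descent set.\<close>

fun rmaj :: "'a::linorder list \<Rightarrow> nat" where
  "rmaj [] = 0"
| "rmaj [a] = 0"
| "rmaj (a # b # x) = rmaj (b # x) + (if a < b then Suc (length x) else 0)"

text \<open>A letter smaller than its successor counts the letters behind it, so \<open>rmaj\<close>
  is the major index of the reversed word. Recursion at the head suits shuffles, which are built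
  from the front.\<close>

lemma rmaj_Cons: "rmaj (a # x) = rmaj x + (if x \<noteq> [] \<and> a < hd x then length x else 0)"
  by (cases x) auto

text \<open>The Gaussian binomial, by one of the two q-Pascal rules. The recursion stays meaningful
  at roots of unity, where the quotient of q-factorials may become 0/0.\<close>

fun qbin :: "complex \<Rightarrow> nat \<Rightarrow> nat \<Rightarrow> complex" where
  "qbin q n 0 = 1"
| "qbin q 0 (Suc k) = 0"
| "qbin q (Suc n) (Suc k) = qbin q n k + q ^ Suc k * qbin q n (Suc k)"

lemma qbin_eq_0: "n < k \<Longrightarrow> qbin q n k = 0"
  by (induction q n k rule: qbin.induct) auto

lemma qbin_self [simp]: "qbin q n n = 1"
  by (induction n) (auto simp: qbin_eq_0)

text \<open>The other q-Pascal rule. Both are needed for shuffles: which one applies depends on the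
  relative order of the first letters.\<close>

lemma qbin_Suc_Suc':
  "k \<le> n \<Longrightarrow> qbin q (Suc n) (Suc k) = q ^ (n - k) * qbin q n k + qbin q n (Suc k)"
proof (induction n arbitrary: k)
  case (Suc n)
  show ?case
  proof (cases k)
    case 0
    with Suc.IH[of 0] show ?thesis by (simp add: algebra_simps)
  next
    case (Suc k')
    show ?thesis
    proof (cases "k = Suc n")
      case True
      then show ?thesis by (simp add: qbin_eq_0)
    next
      case False
      with Suc.prems have kn: "k \<le> n" by simp
      have e: "n - k' = Suc (n - k)" using kn Suc by simp
      have p: "q ^ Suc k * q ^ (n - k) = q * q ^ n" and p2: "q ^ k * q ^ (n - k) = q ^ n"
        using kn by (simp_all flip: power_add)
      have 1: "qbin q (Suc n) k = q * q ^ (n - k) * qbin q n k' + qbin q n k"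
        using Suc.IH[of k'] kn Suc e by simp
      have 2: "qbin q (Suc n) (Suc k) = q ^ (n - k) * qbin q n k + qbin q n (Suc k)"
        using Suc.IH[of k] kn by simp
      have 3: "qbin q (Suc n) k = qbin q n k' + q ^ k * qbin q n k" using Suc by simp
      have "qbin q (Suc (Suc n)) (Suc k) = qbin q (Suc n) k + q ^ Suc k * qbin q (Suc n) (Suc k)"
        by simp
      also have "\<dots> = q * q ^ (n - k) * qbin q n k' + qbin q n k
          + (q ^ Suc k * q ^ (n - k)) * qbin q n k + q ^ Suc k * qbin q n (Suc k)"
        unfolding 1 2 by (simp add: algebra_simps)
      also have "\<dots> = q * q ^ (n - k) * qbin q n k' + q * (q ^ k * q ^ (n - k)) * qbin q n k
          + qbin q (Suc n) (Suc k)"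
        unfolding p p2 by simp
      also have "\<dots> = q ^ (Suc n - k) * qbin q (Suc n) k + qbin q (Suc n) (Suc k)"
        unfolding 3 using kn by (simp add: algebra_simps Suc_diff_le)
      finally show ?thesis .
    qed
  qed
qed simp

text \<open>One side is expanded by the defining q-Pascal rule, the other by its mirror image, and
  the terms match by induction on \<open>k + l\<close>.\<close>

lemma qbin_sym: "qbin q (k + l) k = qbin q (k + l) l"
proof (induction "k + l" arbitrary: k l)
  case (Suc n)
  show ?case
  proof (cases "k = 0 \<or> l = 0")
    case False
    then obtain k' l' where kl: "k = Suc k'" "l = Suc l'" by (metis not0_implies_Suc)
    have 1: "qbin q (k' + Suc l') k' = qbin q (k' + Suc l') (Suc l')"
      and 2: "qbin q (Suc k' + l') (Suc k') = qbin q (Suc k' + l') l'"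
      using Suc.hyps(1)[of k' "Suc l'"] Suc.hyps(1)[of "Suc k'" l'] Suc.hyps(2) kl by auto
    have "qbin q (Suc (Suc (k' + l'))) (Suc l') =
        q ^ Suc k' * qbin q (Suc (k' + l')) l' + qbin q (Suc (k' + l')) (Suc l')"
      by (subst qbin_Suc_Suc') (auto simp: Suc_diff_le)
    then show ?thesis using 1 2 kl by simp
  qed auto
qed auto

text \<open>The product formula with its denominators cleared, hence valid for every
  \<open>q\<close>.\<close>

lemma qbin_mult_prod:
  "qbin q n k * (\<Prod>j=1..k. 1 - q ^ j) = (if k \<le> n then \<Prod>j<k. 1 - q ^ (n - j) else 0)"
proof (induction q n k rule: qbin.induct)
  case (3 q n k)
  show ?case
  proof (cases "k \<le> n")
    case True
    define A where "A = (\<Prod>j<k. 1 - q ^ (n - j))"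
    have A: "qbin q n k * (\<Prod>j=1..k. 1 - q ^ j) = A"
      using 3(1) True by (simp add: A_def)
    have B: "qbin q n (Suc k) * (\<Prod>j=1..Suc k. 1 - q ^ j) = A * (1 - q ^ (n - k))"
    proof (cases "k = n")
      case True then show ?thesis by (simp add: qbin_eq_0)
    next
      case False with True show ?thesis using 3(2) by (simp add: A_def)
    qed
    have "qbin q (Suc n) (Suc k) * (\<Prod>j=1..Suc k. 1 - q ^ j) =
        (qbin q n k * (\<Prod>j=1..k. 1 - q ^ j)) * (1 - q ^ Suc k)
        + q ^ Suc k * (qbin q n (Suc k) * (\<Prod>j=1..Suc k. 1 - q ^ j))"
      by (simp add: algebra_simps)
    also have "\<dots> = A * (1 - q ^ Suc k * q ^ (n - k))"
      unfolding A B by (simp add: algebra_simps)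
    also have "q ^ Suc k * q ^ (n - k) = q ^ Suc n"
      using True by (simp flip: power_add)
    also have "A * (1 - q ^ Suc n) = (\<Prod>j<Suc k. 1 - q ^ (Suc n - j))"
      by (simp only: prod.lessThan_Suc_shift A_def) simp
    finally show ?thesis using True by simp
  next
    case False
    then show ?thesis by (simp add: qbin_eq_0)
  qed
qed auto

definition primitive_root :: "nat \<Rightarrow> complex \<Rightarrow> bool" where
  "primitive_root m q \<longleftrightarrow> m > 0 \<and> q ^ m = 1 \<and> (\<forall>k. 0 < k \<and> k < m \<longrightarrow> q ^ k \<noteq> 1)"

text \<open>The numerator of the product formula contains \<open>1 - q ^ m\<close>, while the
  factors \<open>1 - q ^ j\<close> of the denominator have \<open>j < m\<close> and do not
  vanish.\<close>

lemma qbin_primitive_root: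
  assumes "primitive_root m q" "0 < k" "k < m"
  shows "qbin q m k = 0"
proof -
  have "(\<Prod>j<k. 1 - q ^ (m - j)) = 0"
    using assms by (auto simp: primitive_root_def intro!: bexI[of _ 0])
  then have "qbin q m k * (\<Prod>j=1..k. 1 - q ^ j) = 0"
    using qbin_mult_prod[of q m k] assms by simp
  moreover have "(\<Prod>j=1..k. 1 - q ^ j) \<noteq> 0"
    using assms by (auto simp: primitive_root_def)
  ultimately show ?thesis by simp
qed

lemma sum_shuffles_Cons_Cons:
  assumes "a \<noteq> b"
  shows "sum f (shuffles (a # u) (b # v)) =
    (\<Sum>y\<in>shuffles u (b # v). f (a # y)) + (\<Sum>y\<in>shuffles (a # u) v. f (b # y))"
proof -
  have "sum f (shuffles (a # u) (b # v)) =
      sum f ((#) a ` shuffles u (b # v)) + sum f ((#) b ` shuffles (a # u) v)"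
    using assms by (simp, intro sum.union_disjoint) auto
  also have "\<dots> = (\<Sum>y\<in>shuffles u (b # v). f (a # y)) + (\<Sum>y\<in>shuffles (a # u) v. f (b # y))"
    by (subst (1 2) sum.reindex) auto
  finally show ?thesis .
qed

text \<open>The strengthening that makes an induction possible: removing the first letter of a
  shuffle changes \<open>rmaj\<close> by an amount that depends on the letter after it, so a letter
  \<open>a\<close> in front is carried along. The formula treats \<open>u\<close> and
  \<open>v\<close> differently, and the induction applies it with their roles exchanged when the
  first letter comes from \<open>v\<close>.\<close>

lemma sum_shuffles_fixed_hd:
  assumes "a \<notin> set v" "set u \<inter> set v = {}"
  shows "(\<Sum>y\<in>shuffles u v. q ^ rmaj (a # y)) =
    q ^ (rmaj (a # u) + rmaj v) * (if v \<noteq> [] \<and> a < hd v then q ^ length v else 1)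
      * qbin q (length u + length v) (length u)"
  using assms
proof (induction "length u + length v" arbitrary: a u v)
  case 0
  then show ?case by simp
next
  case (Suc n)
  consider "v = []" | "u = []" "v \<noteq> []" | a' u' b v' where "u = a' # u'" "v = b # v'"
    by (metis neq_Nil_conv)
  then show ?case
  proof cases
    case 1 then show ?thesis by simp
  next
    case 2 then show ?thesis by (simp add: rmaj_Cons power_add)
  next
    case 3
    define k l where "k = length u'" and "l = length v'"
    define Q where "Q = q ^ (rmaj u + rmaj v)"
    have ab: "a' \<noteq> b" "a \<noteq> b" using Suc.prems 3 by auto
    have n: "n = Suc (k + l)" using Suc.hyps(2) 3 by (simp add: k_def l_def)
    have 1: "(\<Sum>y\<in>shuffles u' v. q ^ rmaj (a' # y)) =
        Q * (if a' < b then q ^ Suc l else 1) * qbin q (Suc (k + l)) k"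
      using Suc.hyps(1)[of u' v a'] Suc.prems Suc.hyps(2) 3 by (auto simp: k_def l_def Q_def)
    have "(\<Sum>y\<in>shuffles v' u. q ^ rmaj (b # y)) =
        Q * (if b < a' then q ^ Suc k else 1) * qbin q (l + Suc k) l"
      using Suc.hyps(1)[of v' u b] Suc.prems Suc.hyps(2) 3
      by (auto simp: k_def l_def Q_def Int_commute algebra_simps)
    then have 2: "(\<Sum>y\<in>shuffles u v'. q ^ rmaj (b # y)) =
        Q * (if b < a' then q ^ Suc k else 1) * qbin q (Suc (k + l)) (Suc k)"
      using qbin_sym[of q l "Suc k"] by (simp add: shuffles_commutes[of u v'] add.commute)
    have "(\<Sum>y\<in>shuffles u v. q ^ rmaj (a # y)) =
      (\<Sum>y\<in>shuffles u' v. q ^ rmaj (a # a' # y)) + (\<Sum>y\<in>shuffles u v'. q ^ rmaj (a # b # y))"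
      unfolding 3 by (rule sum_shuffles_Cons_Cons[OF ab(1)])
    also have "(\<Sum>y\<in>shuffles u' v. q ^ rmaj (a # a' # y)) =
        (if a < a' then q ^ Suc (Suc (k + l)) else 1) * (\<Sum>y\<in>shuffles u' v. q ^ rmaj (a' # y))"
      unfolding sum_distrib_left
      by (rule sum.cong) (auto dest!: length_shuffles simp: 3 k_def l_def power_add)
    also have "(\<Sum>y\<in>shuffles u v'. q ^ rmaj (a # b # y)) =
        (if a < b then q ^ Suc (Suc (k + l)) else 1) * (\<Sum>y\<in>shuffles u v'. q ^ rmaj (b # y))"
      unfolding sum_distrib_left
      by (rule sum.cong) (auto dest!: length_shuffles simp: 3 k_def l_def power_add)
    finally have L: "(\<Sum>y\<in>shuffles u v. q ^ rmaj (a # y)) =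
        Q * ((if a < a' then q ^ Suc (Suc (k + l)) else 1) * (if a' < b then q ^ Suc l else 1)
              * qbin q (Suc (k + l)) k
          + (if a < b then q ^ Suc (Suc (k + l)) else 1) * (if b < a' then q ^ Suc k else 1)
              * qbin q (Suc (k + l)) (Suc k))"
      unfolding 1 2 by (simp only: algebra_simps)
    have R: "q ^ (rmaj (a # u) + rmaj v) * (if v \<noteq> [] \<and> a < hd v then q ^ length v else 1)
          * qbin q (length u + length v) (length u) =
        Q * ((if a < a' then q ^ Suc k else 1) * (if a < b then q ^ Suc l else 1)
          * qbin q (Suc (Suc (k + l))) (Suc k))"
      by (auto simp: 3 Q_def k_def l_def power_add)
    have P1: "qbin q (Suc (Suc (k + l))) (Suc k) =
        qbin q (Suc (k + l)) k + q ^ Suc k * qbin q (Suc (k + l)) (Suc k)" by simp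
    have P2: "qbin q (Suc (Suc (k + l))) (Suc k) =
        q ^ Suc l * qbin q (Suc (k + l)) k + qbin q (Suc (k + l)) (Suc k)"
      by (subst qbin_Suc_Suc') (auto simp: Suc_diff_le)
    define K M X Y Z where "K = q ^ Suc k" and "M = q ^ Suc l" and "X = qbin q (Suc (k + l)) k"
      and "Y = qbin q (Suc (k + l)) (Suc k)" and "Z = qbin q (Suc (Suc (k + l))) (Suc k)"
    have pw: "q ^ Suc (Suc (k + l)) = K * M"
      unfolding K_def M_def by (simp flip: power_add)
    have Z1: "Z = X + K * Y" and Z2: "Z = M * X + Y"
      using P1 P2 unfolding K_def M_def X_def Y_def Z_def by auto
    \<comment> \<open>In each case transitivity excludes one of the four patterns, and every
      remaining one is \<open>Z1\<close> or \<open>Z2\<close> up to a power of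
      \<open>q\<close>.\<close>
    have "(if a < a' then K * M else 1) * (if a' < b then M else 1) * X
          + (if a < b then K * M else 1) * (if b < a' then K else 1) * Y =
        (if a < a' then K else 1) * (if a < b then M else 1) * Z"
    proof (cases "a' < b")
      case True
      then have "\<not> b < a'" "a < a' \<Longrightarrow> a < b" by auto
      then show ?thesis using True
        by (cases "a < a'"; cases "a < b")
           (simp add: Z2 algebra_simps, simp, simp add: Z1 algebra_simps, simp add: Z2)
    next
      case False
      then have "b < a'" "a < b \<Longrightarrow> a < a'" using ab by auto
      then show ?thesis using False
        by (cases "a < a'"; cases "a < b")
           (simp add: Z1 algebra_simps, simp add: Z2 algebra_simps, simp, simp add: Z1)
    qed
    then show ?thesis
      unfolding L R pw unfolding K_def M_def X_def Y_def Z_def by (simp only:)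
  qed
qed

text \<open>The classical count of shuffles by major index. The first letter comes from
  \<open>u\<close> or from \<open>v\<close>; each half has a fixed head, and one q-Pascal rule joins
  them.\<close>

lemma sum_shuffles_rmaj:
  assumes "set u \<inter> set v = {}"
  shows "(\<Sum>y\<in>shuffles u v. q ^ rmaj y) =
    q ^ (rmaj u + rmaj v) * qbin q (length u + length v) (length u)"
proof (cases "u = [] \<or> v = []")
  case True
  then show ?thesis by auto
next
  case False
  then obtain a u' b v' where uv: "u = a # u'" "v = b # v'" by (metis neq_Nil_conv)
  define k l where "k = length u'" and "l = length v'"
  define Q where "Q = q ^ (rmaj u + rmaj v)"
  have ab: "a \<noteq> b" using assms uv by auto
  have 1: "(\<Sum>y\<in>shuffles u' v. q ^ rmaj (a # y)) =
      Q * (if a < b then q ^ Suc l else 1) * qbin q (Suc (k + l)) k"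
    using sum_shuffles_fixed_hd[of a v u' q] assms uv by (auto simp: Q_def k_def l_def)
  have "(\<Sum>y\<in>shuffles v' u. q ^ rmaj (b # y)) =
      Q * (if b < a then q ^ Suc k else 1) * qbin q (l + Suc k) l"
    using sum_shuffles_fixed_hd[of b u v' q] assms uv
    by (auto simp: k_def l_def Q_def Int_commute algebra_simps)
  then have 2: "(\<Sum>y\<in>shuffles u v'. q ^ rmaj (b # y)) =
      Q * (if b < a then q ^ Suc k else 1) * qbin q (Suc (k + l)) (Suc k)"
    using qbin_sym[of q l "Suc k"] by (simp add: shuffles_commutes[of u v'] add.commute)
  have P2: "qbin q (Suc (Suc (k + l))) (Suc k) =
      q ^ Suc l * qbin q (Suc (k + l)) k + qbin q (Suc (k + l)) (Suc k)"
    by (subst qbin_Suc_Suc') (auto simp: Suc_diff_le)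
  have P1: "qbin q (Suc (Suc (k + l))) (Suc k) =
      qbin q (Suc (k + l)) k + q ^ Suc k * qbin q (Suc (k + l)) (Suc k)" by simp
  have E: "(\<Sum>y\<in>shuffles u v. q ^ rmaj y) =
      Q * (if a < b then q ^ Suc l else 1) * qbin q (Suc (k + l)) k +
      Q * (if b < a then q ^ Suc k else 1) * qbin q (Suc (k + l)) (Suc k)"
    unfolding uv(1) uv(2) sum_shuffles_Cons_Cons[OF ab] unfolding uv[symmetric] 1 2 ..
  have "(\<Sum>y\<in>shuffles u v. q ^ rmaj y) = Q * qbin q (Suc (Suc (k + l))) (Suc k)"
  proof (cases "a < b")
    case True
    then have "\<not> b < a" by simp
    with True show ?thesis unfolding E P2 by (simp add: algebra_simps del: qbin.simps(3))
  next
    case False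
    then have "b < a" using ab by simp
    with False show ?thesis unfolding E P1 by (simp add: algebra_simps del: qbin.simps(3))
  qed
  then show ?thesis by (simp add: uv Q_def k_def l_def)
qed

text \<open>Appending \<open>y\<close> raises every contribution from inside \<open>x\<close> by
  \<open>length y\<close>, and the junction contributes 0 or exactly \<open>length y\<close>; both
  changes are invisible to \<open>q\<close>.\<close>

lemma root_rmaj_append:
  assumes "q ^ length y = (1::complex)"
  shows "q ^ rmaj (x @ y) = q ^ rmaj x * q ^ rmaj y"
proof (induction x)
  case (Cons a x)
  have "q ^ (length x + length y) = q ^ length x" using assms by (simp add: power_add)
  then show ?case using Cons assms by (cases x) (auto simp: rmaj_Cons power_add)
qed simp

section \<open>Words whose major index is one modulo their length\<close>

definition words :: "'a set \<Rightarrow> nat \<Rightarrow> 'a list set" where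
  "words A d = {w. set w \<subseteq> A \<and> length w = d}"

abbreviation wt :: "('a \<Rightarrow> complex) \<Rightarrow> 'a list \<Rightarrow> complex" where
  "wt x w \<equiv> prod_list (map x w)"

lemma finite_words [simp]: "finite A \<Longrightarrow> finite (words A d)"
  by (simp add: words_def finite_lists_length_eq)

lemma words_0 [simp]: "words A 0 = {[]}"
  by (auto simp: words_def)

lemma words_empty: "0 < d \<Longrightarrow> words {} d = {}"
  by (auto simp: words_def)

lemma wt_power: "wt x w ^ d = wt (\<lambda>a. x a ^ d) w"
  by (induction w) (auto simp: power_mult_distrib)

lemma sum_words_append:
  "(\<Sum>w\<in>words A (m + n). f w) = (\<Sum>u\<in>words A m. \<Sum>v\<in>words A n. f (u @ v))"
proof -
  have "bij_betw (\<lambda>(u, v). u @ v) (words A m \<times> words A n) (words A (m + n))"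
    by (rule bij_betw_byWitness[where f' = "\<lambda>w. (take m w, drop m w)"])
       (auto simp: words_def dest: in_set_takeD in_set_dropD)
  from sum.reindex_bij_betw[OF this, of f, symmetric] show ?thesis
    by (simp add: sum.cartesian_product case_prod_unfold)
qed

lemma sum_words_1: "(\<Sum>w\<in>words A (Suc 0). f w) = (\<Sum>a\<in>A. f [a])"
proof -
  have "words A (Suc 0) = (\<lambda>a. [a]) ` A"
    by (auto simp: words_def length_Suc_conv)
  then show ?thesis by (simp add: sum.reindex inj_on_def)
qed

lemma sum_words_power:
  assumes "\<And>u v. length u = d \<Longrightarrow> F (u @ v) = F u * (F v :: complex)" "F [] = 1"
  shows "(\<Sum>w\<in>words A (e * d). F w) = (\<Sum>w\<in>words A d. F w) ^ e"
proof (induction e)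
  case (Suc e)
  have "(\<Sum>w\<in>words A (Suc e * d). F w) = (\<Sum>u\<in>words A d. \<Sum>v\<in>words A (e * d). F u * F v)"
    unfolding mult_Suc sum_words_append
    by (intro sum.cong refl) (simp add: assms(1) words_def)
  then show ?case by (simp add: Suc.IH flip: sum_product)
qed (simp add: assms(2))

lemma sum_wt_words: "(\<Sum>w\<in>words A e. wt x w) = (\<Sum>a\<in>A. x a) ^ e"
  using sum_words_power[where F = "wt x" and d = 1 and e = e and A = A]
  by (simp add: sum_words_1)

text \<open>Deleting the letter \<open>a\<close> leaves a word over \<open>A\<close>, and the
  original is a shuffle of it with a block of copies of \<open>a\<close>; as \<open>a\<close> is not
  in \<open>A\<close>, both parts can be recovered.\<close>

lemma sum_words_insert:
  assumes "finite A" "a \<notin> A"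
  shows "(\<Sum>w\<in>words (insert a A) d. f w) =
    (\<Sum>k\<le>d. \<Sum>v\<in>words A (d - k). \<Sum>y\<in>shuffles (replicate k a) v. f y)"
proof -
  let ?S = "Sigma {..d} (\<lambda>k. Sigma (words A (d - k)) (\<lambda>v. shuffles (replicate k a) v))"
  have part: "y \<in> shuffles (replicate k a) v \<longleftrightarrow> filter (\<lambda>b. b = a) y = replicate k a \<and> filter (\<lambda>b. b \<noteq> a) y = v"
    if "set v \<subseteq> A" for y k v
    by (subst inv_image_partition[of "replicate k a" "\<lambda>b. b = a" v, symmetric])
       (use assms that in \<open>auto simp: o_def split: if_splits\<close>)
  have rep: "filter (\<lambda>b. b = a) w = replicate (length (filter (\<lambda>b. b = a) w)) a" for w
    by (induction w) auto
  have "bij_betw (\<lambda>(k, v, y). y) ?S (words (insert a A) d)"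
  proof (rule bij_betw_byWitness[where f' =
        "\<lambda>w. (length (filter (\<lambda>b. b = a) w), filter (\<lambda>b. b \<noteq> a) w, w)"])
    show "\<forall>p\<in>?S. (\<lambda>w. (length (filter (\<lambda>b. b = a) w), filter (\<lambda>b. b \<noteq> a) w, w))
            ((\<lambda>(k, v, y). y) p) = p"
      using part by (auto simp: words_def)
    show "(\<lambda>(k, v, y). y) ` ?S \<subseteq> words (insert a A) d"
      by (fastforce simp: words_def dest: length_shuffles set_shuffles split: if_splits)
    show "(\<lambda>w. (length (filter (\<lambda>b. b = a) w), filter (\<lambda>b. b \<noteq> a) w, w)) ` words (insert a A) d \<subseteq> ?S"
    proof safe
      fix w assume w: "w \<in> words (insert a A) d"
      have l: "length (filter (\<lambda>b. b = a) w) + length (filter (\<lambda>b. b \<noteq> a) w) = d"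
        using w sum_length_filter_compl[of "\<lambda>b. b = a" w] by (simp add: words_def)
      have s: "set (filter (\<lambda>b. b \<noteq> a) w) \<subseteq> A" using w by (auto simp: words_def)
      show "length (filter (\<lambda>b. b = a) w) \<le> d" using l by simp
      show "filter (\<lambda>b. b \<noteq> a) w \<in> words A (d - length (filter (\<lambda>b. b = a) w))"
        using l s by (auto simp: words_def)
      show "w \<in> shuffles (replicate (length (filter (\<lambda>b. b = a) w)) a) (filter (\<lambda>b. b \<noteq> a) w)"
        using part[OF s, of w] rep[of w] by (metis (no_types, lifting))
    qed
  qed simp
  from sum.reindex_bij_betw[OF this, of f, symmetric] assms show ?thesis
    by (simp add: sum.Sigma case_prod_unfold)
qed

lemma rmaj_replicate: "rmaj (replicate k a) = 0"
proof (induction k)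
  case (Suc k) then show ?case by (cases k) auto
qed simp

lemma wt_shuffles: "y \<in> shuffles u v \<Longrightarrow> wt x y = wt x u * wt x v"
  using mset_shuffles[of y u v] by (simp flip: prod_mset_prod_list)

text \<open>Letters are added one at a time. Shuffling in \<open>k\<close> copies of
  \<open>a\<close> contributes the factor \<open>qbin q d k\<close>, so only \<open>k = 0\<close>
  and \<open>k = d\<close> survive.\<close>

lemma sum_words_rmaj_primitive:
  fixes A :: "'a::linorder set"
  assumes "primitive_root d q" "finite A"
  shows "(\<Sum>w\<in>words A d. wt x w * q ^ rmaj w) = (\<Sum>a\<in>A. x a ^ d)"
  using assms(2)
proof induction
  case empty
  have "d > 0" using assms by (simp add: primitive_root_def)
  then show ?case by (simp add: words_empty)
next
  case (insert a A)
  have d: "d > 0" using assms by (simp add: primitive_root_def)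
  have *: "(\<Sum>v\<in>words A (d - k). \<Sum>y\<in>shuffles (replicate k a) v. wt x y * q ^ rmaj y) =
      (\<Sum>v\<in>words A (d - k). x a ^ k * wt x v * (q ^ rmaj v * qbin q d k))" if "k \<le> d" for k
  proof (rule sum.cong)
    fix v assume v: "v \<in> words A (d - k)"
    have "(\<Sum>y\<in>shuffles (replicate k a) v. wt x y * q ^ rmaj y) =
        (\<Sum>y\<in>shuffles (replicate k a) v. (x a ^ k * wt x v) * q ^ rmaj y)"
      by (rule sum.cong) (auto simp: wt_shuffles)
    also have "\<dots> = x a ^ k * wt x v * (q ^ rmaj v * qbin q d k)"
    proof -
      have "set (replicate k a) \<inter> set v = {}" using v insert.hyps by (auto simp: words_def)
      then show ?thesis
        using sum_shuffles_rmaj[of "replicate k a" v q] v that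
        by (simp add: rmaj_replicate words_def flip: sum_distrib_left)
    qed
    finally show "(\<Sum>y\<in>shuffles (replicate k a) v. wt x y * q ^ rmaj y) =
        x a ^ k * wt x v * (q ^ rmaj v * qbin q d k)" .
  qed simp
  have "(\<Sum>w\<in>words (insert a A) d. wt x w * q ^ rmaj w) =
      (\<Sum>k\<le>d. \<Sum>v\<in>words A (d - k). x a ^ k * wt x v * (q ^ rmaj v * qbin q d k))"
    unfolding sum_words_insert[OF insert.hyps] by (intro sum.cong refl *) auto
  also have "\<dots> = (\<Sum>k\<in>{0, d}. \<Sum>v\<in>words A (d - k). x a ^ k * wt x v * (q ^ rmaj v * qbin q d k))"
    using assms qbin_primitive_root by (intro sum.mono_neutral_right) auto
  also have "\<dots> = (\<Sum>a\<in>A. x a ^ d) + x a ^ d"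
    using d insert.IH by simp
  finally show ?case using insert.hyps by simp
qed

lemma sum_words_rmaj_root:
  fixes A :: "'a::linorder set"
  assumes "primitive_root d q" "finite A"
  shows "(\<Sum>w\<in>words A (e * d). wt x w * q ^ rmaj w) = (\<Sum>a\<in>A. x a ^ d) ^ e"
proof -
  \<comment> \<open>\<open>sum_words_power\<close> cuts blocks off the front, while
    \<open>root_rmaj_append\<close> asks for a suffix of suitable length; reversal reconciles
    them.\<close>
  have "(\<Sum>w\<in>words A (e * d). (\<lambda>w. wt x (rev w) * q ^ rmaj (rev w)) w) =
      (\<Sum>w\<in>words A d. (\<lambda>w. wt x (rev w) * q ^ rmaj (rev w)) w) ^ e"
    using assms by (intro sum_words_power) (auto simp: primitive_root_def root_rmaj_append)
  moreover have "(\<Sum>w\<in>words A n. (\<lambda>w. wt x (rev w) * q ^ rmaj (rev w)) w) =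
      (\<Sum>w\<in>words A n. wt x w * q ^ rmaj w)" for n
    by (rule sum.reindex_bij_witness[of _ rev rev]) (auto simp: words_def)
  ultimately show ?thesis using sum_words_rmaj_primitive[OF assms] by simp
qed

section \<open>Words fixed by a rotation, and the cyclic sieving identity\<close>

lemma rotate_mult: "rotate j w = w \<Longrightarrow> rotate (k * j) w = w"
  by (induction k) (auto simp flip: rotate_rotate)

text \<open>Bezout: modulo \<open>length w\<close>, which is all that rotations see, the gcd is a
  multiple of \<open>j\<close>; conversely \<open>j\<close> is a multiple of the gcd.\<close>

lemma rotate_gcd_iff: "rotate j w = w \<longleftrightarrow> rotate (gcd j (length w)) w = w"
proof
  assume j: "rotate j w = w"
  show "rotate (gcd j (length w)) w = w"
  proof (cases "j = 0")
    case True then show ?thesis by simp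
  next
    case False
    then obtain k where "[j * k = gcd j (length w)] (mod length w)"
      using cong_solve_nat by blast
    then show ?thesis using rotate_mult[OF j, of k]
      by (metis cong_def mult.commute rotate_conv_mod)
  qed
next
  assume "rotate (gcd j (length w)) w = w"
  moreover obtain k where "j = k * gcd j (length w)" by (metis dvd_def gcd_dvd1 mult.commute)
  ultimately show "rotate j w = w" by (metis rotate_mult)
qed

lemma comm_append_replicate:
  "u @ w = w @ u \<Longrightarrow> length w = d * length u \<Longrightarrow> w = concat (replicate d u)"
proof (induction d arbitrary: w)
  case (Suc d)
  have "take (length u) (w @ u) = u" by (metis append_eq_conv_conj Suc.prems(1))
  then have "u = take (length u) w" using Suc.prems(2) by simp
  then obtain w' where w: "w = u @ w'" by (metis append_take_drop_id)
  show ?case using Suc.IH[of w'] Suc.prems w by simp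
qed simp

lemma replicate_append_comm: "u @ concat (replicate d u) = concat (replicate d u) @ u"
  by (induction d) auto

lemma wt_concat_replicate: "wt x (concat (replicate d u)) = wt x u ^ d"
  by (induction d) auto

text \<open>Writing \<open>w = u @ v\<close> with \<open>length u = e\<close>, the rotation swaps
  the two factors, so it fixes \<open>w\<close> exactly when they commute; commuting with
  \<open>u\<close> forces \<open>v\<close> to be a power of \<open>u\<close>.\<close>

lemma fixed_words_eq:
  assumes "0 < d"
  shows "{w \<in> words A (e * d). rotate e w = w} = (\<lambda>u. concat (replicate d u)) ` words A e"
proof -
  obtain d' where d': "d = Suc d'" using assms by (cases d) auto
  show ?thesis
  proof (intro equalityI subsetI)
    fix w assume w: "w \<in> {w \<in> words A (e * d). rotate e w = w}"
    define u v where "u = take e w" and "v = drop e w"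
    have w': "w = u @ v" "length u = e" "length v = d' * e" "set u \<subseteq> A"
      using w d' by (auto simp: u_def v_def words_def dest: in_set_takeD)
    have "u @ v = v @ u" using w w' rotate_append[of u v] by simp
    then have "v = concat (replicate d' u)" using comm_append_replicate[of u v d'] w' by simp
    then show "w \<in> (\<lambda>u. concat (replicate d u)) ` words A e"
      using w' d' by (auto simp: words_def)
  next
    fix w assume "w \<in> (\<lambda>u. concat (replicate d u)) ` words A e"
    then obtain u where u: "u \<in> words A e" "w = concat (replicate d u)" by auto
    have "rotate e w = w"
      using u d' rotate_append[of u "concat (replicate d' u)"] replicate_append_comm[of u d']
      by (simp add: words_def)
    moreover have "length (concat (replicate d u)) = d * length u" for d by (induction d) auto
    ultimately show "w \<in> {w \<in> words A (e * d). rotate e w = w}"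
      using u by (auto simp: words_def)
  qed
qed

lemma sum_fixed_words:
  assumes "0 < d"
  shows "(\<Sum>w | w \<in> words A (e * d) \<and> rotate e w = w. wt x w) = (\<Sum>a\<in>A. x a ^ d) ^ e"
proof -
  obtain d' where d': "d = Suc d'" using assms by (cases d) auto
  have "inj_on (\<lambda>u. concat (replicate d u)) (words A e)"
    by (rule inj_onI) (auto simp: d' words_def)
  then show ?thesis
    using fixed_words_eq[OF assms, of A e]
    by (simp add: sum.reindex wt_concat_replicate wt_power sum_wt_words)
qed

lemma primitive_root_power_eq_1:
  assumes "primitive_root m q"
  shows "q ^ n = 1 \<longleftrightarrow> m dvd n"
proof -
  have "q ^ n = q ^ (m * (n div m) + n mod m)" by simp
  also have "\<dots> = q ^ (n mod m)"
    using assms unfolding power_add power_mult by (simp add: primitive_root_def)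
  finally have "q ^ n = 1 \<longleftrightarrow> q ^ (n mod m) = 1" by simp
  also have "\<dots> \<longleftrightarrow> n mod m = 0"
    using assms by (auto simp: primitive_root_def)
  finally show ?thesis by auto
qed

lemma primitive_root_power:
  assumes "primitive_root m q"
  shows "primitive_root (m div gcd j m) (q ^ j)"
proof -
  have m: "m > 0" using assms by (simp add: primitive_root_def)
  define e d j' where "e = gcd j m" and "d = m div e" and "j' = j div e"
  have e: "e > 0" "m = d * e" "j = j' * e" using m by (auto simp: e_def d_def j'_def)
  have cop: "coprime d j'"
    using div_gcd_coprime[of j m] m by (simp add: d_def j'_def e_def coprime_commute)
  have "(q ^ j) ^ k = 1 \<longleftrightarrow> d dvd k" for k
  proof -
    have "(q ^ j) ^ k = 1 \<longleftrightarrow> m dvd j * k"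
      using primitive_root_power_eq_1[OF assms, of "j * k"] by (simp add: power_mult)
    also have "\<dots> \<longleftrightarrow> d dvd j' * k" using e by (simp add: mult.assoc mult.commute)
    also have "\<dots> \<longleftrightarrow> d dvd k" using cop by (simp add: coprime_dvd_mult_right_iff)
    finally show ?thesis .
  qed
  moreover have "d > 0" using e m by (cases d) auto
  ultimately show ?thesis by (auto simp: primitive_root_def d_def e_def dest: dvd_imp_le)
qed

text \<open>Cyclic sieving for words under rotation: with \<open>e = gcd j m\<close> and
  \<open>d = m div e\<close>, both sides are the \<open>e\<close>-th power of the power sum of
  degree \<open>d\<close>, since \<open>q ^ j\<close> is a primitive \<open>d\<close>-th root of
  unity.\<close>

lemma sum_words_rmaj_eq_fixed:
  fixes A :: "'a::linorder set"
  assumes "primitive_root m q" "finite A"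
  shows "(\<Sum>w\<in>words A m. wt x w * (q ^ j) ^ rmaj w) = (\<Sum>w | w \<in> words A m \<and> rotate j w = w. wt x w)"
proof -
  define e d where "e = gcd j m" and "d = m div e"
  have m: "m > 0" using assms by (simp add: primitive_root_def)
  have e: "e > 0" "m = e * d" using m by (auto simp: e_def d_def)
  have d: "d > 0" using e m by (cases d) auto
  have "rotate j w = w \<longleftrightarrow> rotate e w = w" if "w \<in> words A m" for w
    using rotate_gcd_iff[of j w] that by (simp add: e_def words_def)
  then have "{w. w \<in> words A m \<and> rotate j w = w} = {w. w \<in> words A (e * d) \<and> rotate e w = w}"
    using e(2) by auto
  then have "(\<Sum>w | w \<in> words A m \<and> rotate j w = w. wt x w) = (\<Sum>a\<in>A. x a ^ d) ^ e"
    using sum_fixed_words[OF d, where A = A and e = e and x = x] by simp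
  moreover have "primitive_root d (q ^ j)"
    using primitive_root_power[OF assms(1), of j] by (simp add: d_def e_def)
  ultimately show ?thesis
    using sum_words_rmaj_root[OF _ assms(2), where d = d and q = "q ^ j" and e = e and x = x] e by simp
qed

lemma sum_root_powers:
  assumes "primitive_root m q"
  shows "(\<Sum>j<m. (q ^ j) ^ r * inverse (q ^ j)) = (if [r = 1] (mod m) then of_nat m else 0)"
proof -
  define z where "z = q ^ r * inverse q"
  have q0: "q \<noteq> 0" using assms by (auto simp: primitive_root_def power_0_left)
  have zj: "(q ^ j) ^ r * inverse (q ^ j) = z ^ j" for j
    by (simp add: z_def power_mult_distrib power_inverse mult.commute flip: power_mult)
  have m: "m > 0" "q ^ m = 1" using assms by (auto simp: primitive_root_def)
  have m1: "1 + (m - 1) = m" using m(1) by linarith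
  \<comment> \<open>The exponent \<open>r - 1\<close> is replaced by \<open>r + (m - 1)\<close>,
    which agrees with it modulo \<open>m\<close> and is a natural number also for
    \<open>r = 0\<close>.\<close>
  have "z = 1 \<longleftrightarrow> q ^ r = q ^ 1" using q0 by (auto simp: z_def field_simps)
  moreover have "q ^ r = q ^ 1 \<longleftrightarrow> q ^ r * q ^ (m - 1) = q ^ 1 * q ^ (m - 1)" using q0 by simp
  moreover have "q ^ r * q ^ (m - 1) = q ^ (r + (m - 1))" by (simp add: power_add)
  moreover have "q ^ 1 * q ^ (m - 1) = 1"
    unfolding power_add[symmetric] m1 by (rule m(2))
  moreover have "[r = 1] (mod m) \<longleftrightarrow> [r + (m - 1) = 1 + (m - 1)] (mod m)"
    by (rule cong_add_rcancel_nat[symmetric])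
  moreover have "[r + (m - 1) = m] (mod m) \<longleftrightarrow> m dvd r + (m - 1)"
    by (simp add: cong_def dvd_eq_mod_eq_0)
  ultimately have z1: "z = 1 \<longleftrightarrow> [r = 1] (mod m)"
    using primitive_root_power_eq_1[OF assms, of "r + (m - 1)"] unfolding m1 by argo
  have "(q ^ r) ^ m = (q ^ m) ^ r" by (simp add: mult.commute flip: power_mult)
  then have zm: "z ^ m = 1" using m unfolding z_def by (simp add: power_mult_distrib power_inverse)
  show ?thesis
  proof (cases "z = 1")
    case True then show ?thesis using z1 by (simp add: zj)
  next
    case False
    then have "(\<Sum>j<m. z ^ j) = 0" using zm geometric_sum[OF False, of m] by simp
    then show ?thesis using z1 False by (simp add: zj)
  qed
qed

text \<open>Fourier inversion over the residues modulo \<open>m\<close>: the coefficients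
  \<open>inverse (q ^ j)\<close> extract the residue 1.\<close>

lemma sum_words_rmaj_cong_1:
  fixes A :: "'a::linorder set"
  assumes "primitive_root m q" "finite A"
  shows "of_nat m * (\<Sum>w | w \<in> words A m \<and> [rmaj w = 1] (mod m). wt x w) =
    (\<Sum>j<m. inverse (q ^ j) * (\<Sum>w | w \<in> words A m \<and> rotate j w = w. wt x w))"
proof -
  have "(\<Sum>j<m. inverse (q ^ j) * (\<Sum>w | w \<in> words A m \<and> rotate j w = w. wt x w)) =
      (\<Sum>j<m. \<Sum>w\<in>words A m. inverse (q ^ j) * (wt x w * (q ^ j) ^ rmaj w))"
    unfolding sum_words_rmaj_eq_fixed[OF assms, symmetric] sum_distrib_left ..
  also have "\<dots> = (\<Sum>w\<in>words A m. wt x w * (\<Sum>j<m. (q ^ j) ^ rmaj w * inverse (q ^ j)))"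
    by (subst sum.swap) (simp add: sum_distrib_left mult_ac)
  also have "\<dots> = (\<Sum>w\<in>words A m. if [rmaj w = 1] (mod m) then of_nat m * wt x w else 0)"
    by (intro sum.cong refl) (simp add: sum_root_powers[OF assms(1)])
  also have "\<dots> = of_nat m * (\<Sum>w | w \<in> words A m \<and> [rmaj w = 1] (mod m). wt x w)"
    using assms(2) by (simp add: sum.If_cases Int_def sum_distrib_left)
  finally show ?thesis by simp
qed

section \<open>Cyclic descents of permutations\<close>

text \<open>Element \<open>i\<close> compares the letters with indices \<open>i - 1\<close> and
  \<open>i\<close> counted from 0; it is the usual descent position counted from 1.\<close>

definition wdes :: "'a::linorder list \<Rightarrow> nat set" where
  "wdes w = {i. 0 < i \<and> i < length w \<and> w ! i < w ! (i - 1)}"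

definition maj :: "'a::linorder list \<Rightarrow> nat" where
  "maj w = \<Sum> (wdes w)"

lemma finite_wdes [simp]: "finite (wdes w)"
  by (rule finite_subset[of _ "{..<length w}"]) (auto simp: wdes_def)

lemma wdes_snoc:
  "wdes (w @ [a]) = wdes w \<union> (if w \<noteq> [] \<and> a < last w then {length w} else {})"
proof (cases "w = []")
  case False
  then show ?thesis
    by (auto simp: wdes_def nth_append last_conv_nth less_Suc_eq split: if_splits)
qed (auto simp: wdes_def)

lemma maj_rev: "maj (rev x) = rmaj x"
proof (induction x)
  case Nil
  then show ?case by (simp add: maj_def wdes_def)
next
  case (Cons a x)
  have "length x \<notin> wdes (rev x)" by (simp add: wdes_def)
  then have "maj (rev x @ [a]) = maj (rev x) + (if x \<noteq> [] \<and> a < hd x then length x else 0)"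
    unfolding maj_def wdes_snoc by (auto simp: last_rev)
  then show ?case by (simp add: rmaj_Cons Cons.IH)
qed

lemma rmaj_rev: "rmaj (rev x) = maj x"
  using maj_rev[of "rev x"] by simp

text \<open>Being a shuffle is a condition on two complementary subwords only, and reversal respects
  it; so the count by \<open>rmaj\<close> carries over.\<close>

lemma sum_shuffles_maj:
  assumes "set u \<inter> set v = {}"
  shows "(\<Sum>y\<in>shuffles u v. q ^ maj y) =
    q ^ (maj u + maj v) * qbin q (length u + length v) (length u)"
proof -
  let ?P = "\<lambda>x. x \<in> set u"
  have 1: "shuffles u v = List.partition ?P -` {(u, v)}"
    by (rule inv_image_partition[symmetric]) (use assms in auto)
  have 2: "shuffles (rev u) (rev v) = List.partition ?P -` {(rev u, rev v)}"
    by (rule inv_image_partition[symmetric]) (use assms in auto)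
  have "(\<Sum>y\<in>shuffles u v. q ^ maj y) = (\<Sum>y\<in>shuffles (rev u) (rev v). q ^ rmaj y)"
    unfolding 1 2
    by (rule sum.reindex_bij_witness[of _ rev rev]) (auto simp: rmaj_rev simp flip: rev_filter)
  also have "\<dots> = q ^ (maj u + maj v) * qbin q (length u + length v) (length u)"
    using sum_shuffles_rmaj[of "rev u" "rev v" q] assms maj_rev[of "rev u"] maj_rev[of "rev v"] by simp
  finally show ?thesis .
qed

definition perms :: "nat \<Rightarrow> nat list set" where
  "perms m = {\<sigma>. distinct \<sigma> \<and> set \<sigma> = {..<m}}"

lemma perms_length: "\<sigma> \<in> perms m \<Longrightarrow> length \<sigma> = m"
  by (metis (mono_tags, lifting) card_lessThan distinct_card mem_Collect_eq perms_def)

lemma perms_nth_less: "\<sigma> \<in> perms m \<Longrightarrow> i < m \<Longrightarrow> \<sigma> ! i < m"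
  using nth_mem[of i \<sigma>] perms_length[of \<sigma> m] by (auto simp: perms_def)

lemma perms_nth_eq_iff: "\<sigma> \<in> perms m \<Longrightarrow> i < m \<Longrightarrow> j < m \<Longrightarrow> \<sigma> ! i = \<sigma> ! j \<longleftrightarrow> i = j"
  using nth_eq_iff_index_eq[of \<sigma> i j] perms_length[of \<sigma> m] by (auto simp: perms_def)

lemma finite_perms [simp]: "finite (perms m)"
proof (rule finite_subset)
  show "perms m \<subseteq> words {..<m} m" using perms_length by (auto simp: words_def perms_def)
qed simp

definition cdesc :: "nat list \<Rightarrow> nat set" where
  "cdesc \<sigma> = {i. i < length \<sigma> \<and> \<sigma> ! (Suc i mod length \<sigma>) < \<sigma> ! i}"

text \<open>Index \<open>i\<close> in \<open>cdesc\<close> is the descent position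
  \<open>Suc i\<close>. The only possible addition to the ordinary descents is the one at the
  wrap-around, whose position \<open>length \<sigma>\<close> is invisible to
  \<open>q\<close>.\<close>

lemma root_maj_eq_cdesc:
  assumes "q ^ length \<sigma> = (1::complex)"
  shows "q ^ maj \<sigma> = q ^ (\<Sum>i\<in>cdesc \<sigma>. Suc i)"
proof -
  let ?m = "length \<sigma>"
  have f: "finite (cdesc \<sigma>)" by (simp add: cdesc_def)
  have eq: "wdes \<sigma> = Suc ` (cdesc \<sigma> - {?m - 1})"
  proof (intro equalityI subsetI)
    fix i assume "i \<in> wdes \<sigma>"
    then have "i - 1 \<in> cdesc \<sigma> - {?m - 1}" "i = Suc (i - 1)"
      by (auto simp: wdes_def cdesc_def)
    then show "i \<in> Suc ` (cdesc \<sigma> - {?m - 1})" by blast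
  next
    fix i assume "i \<in> Suc ` (cdesc \<sigma> - {?m - 1})"
    then obtain j where j0: "i = Suc j" "j \<in> cdesc \<sigma>" "j \<noteq> ?m - 1" by blast
    then have j: "i = Suc j" "j < ?m" "j \<noteq> ?m - 1" "\<sigma> ! (Suc j mod ?m) < \<sigma> ! j"
      unfolding cdesc_def by blast+
    then have "Suc j < ?m" by linarith
    then show "i \<in> wdes \<sigma>" using j by (auto simp: wdes_def)
  qed
  have "q ^ maj \<sigma> = q ^ (\<Sum>i\<in>cdesc \<sigma> - {?m - 1}. Suc i)"
    unfolding maj_def eq by (simp add: sum.reindex)
  also have "\<dots> = q ^ (\<Sum>i\<in>cdesc \<sigma>. Suc i)"
  proof (cases "?m - 1 \<in> cdesc \<sigma>")
    case True
    then have "Suc (?m - 1) = ?m" by (auto simp: cdesc_def)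
    then have "(\<Sum>i\<in>cdesc \<sigma>. Suc i) = ?m + (\<Sum>i\<in>cdesc \<sigma> - {?m - 1}. Suc i)"
      using sum.remove[OF f True, of Suc] by simp
    then show ?thesis using assms by (simp add: power_add)
  qed simp
  finally show ?thesis .
qed

text \<open>In one-line notation, conjugating by the cycle that adds 1 modulo \<open>m\<close>
  rotates the places by one and lowers every value by one modulo \<open>m\<close>.\<close>

definition conj_cycle :: "nat \<Rightarrow> nat list \<Rightarrow> nat list" where
  "conj_cycle m \<sigma> = map (\<lambda>x. if x = 0 then m - 1 else x - 1) (rotate1 \<sigma>)"

lemma length_conj_cycle [simp]: "length (conj_cycle m \<sigma>) = length \<sigma>"
  by (simp add: conj_cycle_def)

lemma nth_conj_cycle:
  "i < length \<sigma> \<Longrightarrow> conj_cycle m \<sigma> ! i =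
    (if \<sigma> ! (Suc i mod length \<sigma>) = 0 then m - 1 else \<sigma> ! (Suc i mod length \<sigma>) - 1)"
  by (simp add: conj_cycle_def nth_rotate1)

lemma conj_cycle_in_perms:
  assumes "\<sigma> \<in> perms m"
  shows "conj_cycle m \<sigma> \<in> perms m"
proof -
  let ?c = "\<lambda>x. if x = 0 then m - 1 else x - 1 :: nat"
  have inj: "inj_on ?c {..<m}" by (auto simp: inj_on_def split: if_splits)
  have "?c ` {..<m} \<subseteq> {..<m}" by auto
  then have "?c ` {..<m} = {..<m}" using endo_inj_surj[OF finite_lessThan _ inj] by blast
  then show ?thesis using assms inj unfolding perms_def conj_cycle_def
    by (simp only: mem_Collect_eq distinct_map set_map set_rotate1 distinct1_rotate)
qed

lemma bij_betw_conj_cycle: "bij_betw (conj_cycle m) (perms m) (perms m)"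
proof -
  let ?c = "\<lambda>x. if x = 0 then m - 1 else x - 1 :: nat"
  have inj: "inj_on ?c {..<m}" by (auto simp: inj_on_def split: if_splits)
  have "inj_on (conj_cycle m) (perms m)"
  proof (rule inj_onI)
    fix \<sigma> \<tau> assume st: "\<sigma> \<in> perms m" "\<tau> \<in> perms m" "conj_cycle m \<sigma> = conj_cycle m \<tau>"
    then have "rotate1 \<sigma> = rotate1 \<tau>"
      unfolding conj_cycle_def using inj
      by (subst (asm) inj_on_map_eq_map) (auto simp: perms_def)
    then show "\<sigma> = \<tau>" by (metis bij_betw_imp_inj_on bij_rotate1 injD)
  qed
  moreover have "conj_cycle m ` perms m \<subseteq> perms m" using conj_cycle_in_perms by auto
  ultimately show ?thesis by (simp add: bij_betw_def endo_inj_surj)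
qed

lemma sum_cyclic_shift:
  assumes "0 < m"
  shows "(\<Sum>i<m. f (Suc i mod m)) = (\<Sum>i<m. f i)"
proof -
  have "inj_on (\<lambda>i. Suc i mod m) {..<m}"
  proof (rule inj_onI)
    fix i j assume ij: "i \<in> {..<m}" "j \<in> {..<m}" "Suc i mod m = Suc j mod m"
    then show "i = j" by (simp add: mod_Suc split: if_splits)
  qed
  moreover have "(\<lambda>i. Suc i mod m) ` {..<m} \<subseteq> {..<m}" using assms by auto
  ultimately have "bij_betw (\<lambda>i. Suc i mod m) {..<m} {..<m}"
    by (simp add: bij_betw_def endo_inj_surj)
  from sum.reindex_bij_betw[OF this] show ?thesis .
qed

text \<open>
  Conjugating by the long cycle rotates the cyclic descents by one position, except that
  the descent into the value \<open>0\<close> moves one step.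
\<close>

lemma conj_cycle_cdesc:
  assumes \<sigma>: "\<sigma> \<in> perms m" and m: "2 \<le> m"
  shows "card (cdesc (conj_cycle m \<sigma>)) = card (cdesc \<sigma>)"
    and "[(\<Sum>i\<in>cdesc (conj_cycle m \<sigma>). Suc i) + card (cdesc \<sigma>) = (\<Sum>i\<in>cdesc \<sigma>. Suc i) + 1] (mod m)"
proof -
  have len: "length \<sigma> = m" using perms_length[OF \<sigma>] .
  let ?n = "\<lambda>i. Suc i mod m"
  define d where "d i = (of_bool (\<sigma> ! ?n i < \<sigma> ! i) :: int)" for i
  define z where "z i = (of_bool (\<sigma> ! i = 0) :: int)" for i
  \<comment> \<open>When the values drop by one, 0 becomes \<open>m - 1\<close>: the descent into it
    disappears and a descent out of it appears, while all other comparisons keep their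
    outcome.\<close>
  define h where "h i = d i - z (?n i) + z i" for i
  have n: "?n i < m" "?n i \<noteq> i" if "i < m" for i
  proof -
    show "?n i < m" using m by simp
    show "?n i \<noteq> i" using that m by (cases "Suc i = m") auto
  qed
  have h: "of_bool (i \<in> cdesc (conj_cycle m \<sigma>)) = h (?n i)" if i: "i < m" for i
  proof -
    have "\<sigma> ! ?n (?n i) \<noteq> \<sigma> ! ?n i"
      using n[of "?n i"] n[of i] i perms_nth_eq_iff[OF \<sigma>] by simp
    moreover have "\<sigma> ! ?n (?n i) < m" "\<sigma> ! ?n i < m"
      using n[of "?n i"] n[of i] i perms_nth_less[OF \<sigma>] by auto
    ultimately show ?thesis
      using i n[of i] len by (auto simp: cdesc_def h_def d_def z_def nth_conj_cycle)
  qed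
  have card_of_bool: "int (card (cdesc \<tau>)) = (\<Sum>i<m. of_bool (i \<in> cdesc \<tau>))"
    and sum_of_bool: "int (\<Sum>i\<in>cdesc \<tau>. Suc i) = (\<Sum>i<m. (int i + 1) * of_bool (i \<in> cdesc \<tau>))"
    if "length \<tau> = m" for \<tau>
  proof -
    have c: "cdesc \<tau> = {i \<in> {..<m}. i \<in> cdesc \<tau>}" using that by (auto simp: cdesc_def)
    show "int (card (cdesc \<tau>)) = (\<Sum>i<m. of_bool (i \<in> cdesc \<tau>))"
      by (subst c) (simp add: of_bool_def sum.If_cases Int_def)
    have "int (\<Sum>i\<in>cdesc \<tau>. Suc i) = (\<Sum>i\<in>{i \<in> {..<m}. i \<in> cdesc \<tau>}. int i + 1)"
      by (subst c) (simp add: add.commute)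
    also have "\<dots> = (\<Sum>i<m. if i \<in> cdesc \<tau> then int i + 1 else 0)"
      by (rule sum.inter_filter) simp
    also have "\<dots> = (\<Sum>i<m. (int i + 1) * of_bool (i \<in> cdesc \<tau>))"
      by (rule sum.cong) auto
    finally show "int (\<Sum>i\<in>cdesc \<tau>. Suc i) = (\<Sum>i<m. (int i + 1) * of_bool (i \<in> cdesc \<tau>))" .
  qed
  have d: "d i = of_bool (i \<in> cdesc \<sigma>)" if "i < m" for i
    using that len by (simp add: d_def cdesc_def)
  have sh: "(\<Sum>i<m. f (?n i)) = (\<Sum>i<m. f i)" for f :: "nat \<Rightarrow> int"
    by (rule sum_cyclic_shift) (use m in simp)
  have "int (card (cdesc (conj_cycle m \<sigma>))) = (\<Sum>i<m. h (?n i))"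
    using h by (simp add: card_of_bool len)
  also have "\<dots> = (\<Sum>i<m. h i)" by (rule sh)
  also have "\<dots> = (\<Sum>i<m. d i)" by (simp add: h_def sum.distrib sum_subtractf sh)
  also have "\<dots> = int (card (cdesc \<sigma>))" by (simp add: card_of_bool len d)
  finally show "card (cdesc (conj_cycle m \<sigma>)) = card (cdesc \<sigma>)" by simp
  have nc: "[int i + 1 = int (?n i)] (mod int m)" for i
    by (simp add: cong_def zmod_int add.commute)
  have z1: "(\<Sum>i<m. z i) = 1"
  proof -
    have "0 \<in> set \<sigma>" using \<sigma> m by (auto simp: perms_def)
    then obtain p where p: "p < m" "\<sigma> ! p = 0" using len by (auto simp: in_set_conv_nth)
    then have "\<And>i. i < m \<Longrightarrow> z i = (if i = p then 1 else 0)"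
      using perms_nth_eq_iff[OF \<sigma>, of _ p] by (auto simp: z_def)
    then show ?thesis using p by simp
  qed
  \<comment> \<open>The place before the value 0 is one less modulo \<open>m\<close> than the place
    of 0. The descent at 0 moves by this one step, which produces the \<open>+ 1\<close> of the
    claim; the rotation of places accounts for \<open>card (cdesc \<sigma>)\<close>.\<close>
  have "[(\<Sum>i<m. int i * z (?n i)) = (\<Sum>i<m. (int (?n i) - 1) * z (?n i))] (mod int m)"
  proof (rule cong_sum)
    fix i
    have "[int i = int (?n i) - 1] (mod int m)" using cong_diff[OF nc[of i] cong_refl[of 1]] by simp
    then show "[int i * z (?n i) = (int (?n i) - 1) * z (?n i)] (mod int m)" by (rule cong_scalar_right)
  qed
  also have "(\<Sum>i<m. (int (?n i) - 1) * z (?n i)) = (\<Sum>i<m. (int i - 1) * z i)"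
    using sh[of "\<lambda>i. (int i - 1) * z i"] by simp
  also have "\<dots> = (\<Sum>i<m. int i * z i) - 1"
    using z1 by (simp add: algebra_simps sum_subtractf)
  finally have zz: "[(\<Sum>i<m. int i * z (?n i)) = (\<Sum>i<m. int i * z i) - 1] (mod int m)" .
  have "[int (\<Sum>i\<in>cdesc (conj_cycle m \<sigma>). Suc i) = (\<Sum>i<m. int (?n i) * h (?n i))] (mod int m)"
  proof -
    have "int (\<Sum>i\<in>cdesc (conj_cycle m \<sigma>). Suc i) = (\<Sum>i<m. (int i + 1) * h (?n i))"
      by (subst sum_of_bool) (auto simp: len h)
    moreover have "[(\<Sum>i<m. (int i + 1) * h (?n i)) = (\<Sum>i<m. int (?n i) * h (?n i))] (mod int m)"
      by (rule cong_sum) (rule cong_scalar_right[OF nc])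
    ultimately show ?thesis by simp
  qed
  also have "(\<Sum>i<m. int (?n i) * h (?n i)) = (\<Sum>i<m. int i * h i)"
    using sh[of "\<lambda>i. int i * h i"] by simp
  also have "\<dots> = (\<Sum>i<m. int i * d i) + (\<Sum>i<m. int i * z i) - (\<Sum>i<m. int i * z (?n i))"
    by (simp add: h_def algebra_simps sum.distrib sum_subtractf)
  also have "[\<dots> = (\<Sum>i<m. int i * d i) + (\<Sum>i<m. int i * z i) - ((\<Sum>i<m. int i * z i) - 1)] (mod int m)"
    by (rule cong_diff[OF cong_refl zz])
  also have "(\<Sum>i<m. int i * d i) + (\<Sum>i<m. int i * z i) - ((\<Sum>i<m. int i * z i) - 1) =
      (\<Sum>i<m. (int i + 1) * d i) - (\<Sum>i<m. d i) + 1"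
    by (simp add: algebra_simps sum.distrib)
  also have "(\<Sum>i<m. (int i + 1) * d i) = int (\<Sum>i\<in>cdesc \<sigma>. Suc i)"
    by (subst sum_of_bool) (auto simp: len d)
  also have "(\<Sum>i<m. d i) = int (card (cdesc \<sigma>))" by (simp add: card_of_bool len d)
  finally have "[int (\<Sum>i\<in>cdesc (conj_cycle m \<sigma>). Suc i) + int (card (cdesc \<sigma>)) =
      int (\<Sum>i\<in>cdesc \<sigma>. Suc i) - int (card (cdesc \<sigma>)) + 1 + int (card (cdesc \<sigma>))] (mod int m)"
    by (rule cong_add) simp
  also have "int (\<Sum>i\<in>cdesc \<sigma>. Suc i) - int (card (cdesc \<sigma>)) + 1 + int (card (cdesc \<sigma>)) =
      int ((\<Sum>i\<in>cdesc \<sigma>. Suc i) + 1)" by simp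
  finally have "[int ((\<Sum>i\<in>cdesc (conj_cycle m \<sigma>). Suc i) + card (cdesc \<sigma>)) =
      int ((\<Sum>i\<in>cdesc \<sigma>. Suc i) + 1)] (mod int m)" by (simp only: of_nat_add)
  then show "[(\<Sum>i\<in>cdesc (conj_cycle m \<sigma>). Suc i) + card (cdesc \<sigma>) = (\<Sum>i\<in>cdesc \<sigma>. Suc i) + 1] (mod m)"
    by (simp only: cong_int_iff)
qed

lemma nth_rotate_upt: "i < m \<Longrightarrow> rotate j [0..<m] ! i = (j + i) mod m"
  by (simp add: nth_rotate)

text \<open>The only cyclic descent is the passage from the value \<open>m - 1\<close> to 0, and
  \<open>m - 1\<close> stands at index \<open>m - 1 - j\<close>.\<close>

lemma cdesc_rotate_upt:
  assumes "2 \<le> m" "j < m"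
  shows "cdesc (rotate j [0..<m]) = {m - 1 - j}"
proof -
  have "i \<in> cdesc (rotate j [0..<m]) \<longleftrightarrow> i = m - 1 - j" for i
  proof (cases "i < m")
    case True
    define s where "s = (j + i) mod m"
    have s: "s < m" using assms by (simp add: s_def)
    have n: "(j + Suc i mod m) mod m = Suc s mod m" by (simp add: s_def mod_simps)
    have "Suc i mod m < m" using assms by simp
    then have "i \<in> cdesc (rotate j [0..<m]) \<longleftrightarrow> Suc s mod m < s"
      using True n by (simp add: cdesc_def nth_rotate_upt s_def)
    also have "\<dots> \<longleftrightarrow> s = m - 1"
    proof (cases "Suc s = m")
      case True then show ?thesis using assms by auto
    next
      case False then show ?thesis using s by auto
    qed
    also have "\<dots> \<longleftrightarrow> i = m - 1 - j"
    proof (cases "j + i < m")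
      case True then show ?thesis using assms by (auto simp: s_def)
    next
      case False
      then have "s = j + i - m" using assms True by (simp add: s_def mod_if)
      then show ?thesis using assms True False by auto
    qed
    finally show ?thesis .
  next
    case False then show ?thesis using assms by (auto simp: cdesc_def)
  qed
  then show ?thesis by auto
qed

lemma rotate_upt_in_perms: "rotate j [0..<m] \<in> perms m"
  by (auto simp: perms_def)

text \<open>Rotating a permutation so that it starts just after its unique cyclic descent makes it
  increasing, hence the identity.\<close>

lemma card_cdesc_1_iff:
  assumes "2 \<le> m"
  shows "{\<sigma> \<in> perms m. card (cdesc \<sigma>) = 1} = (\<lambda>j. rotate j [0..<m]) ` {..<m}"
proof (intro equalityI subsetI)
  fix \<sigma> assume "\<sigma> \<in> {\<sigma> \<in> perms m. card (cdesc \<sigma>) = 1}"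
  then obtain p where \<sigma>: "\<sigma> \<in> perms m" and p: "cdesc \<sigma> = {p}" by (auto simp: card_1_singleton_iff)
  have len: "length \<sigma> = m" using perms_length[OF \<sigma>] .
  have pm: "p < m" using p len by (auto simp: cdesc_def)
  define \<tau> where "\<tau> = rotate (Suc p) \<sigma>"
  have "\<tau> ! i < \<tau> ! Suc i" if i: "Suc i < m" for i
  proof -
    let ?k = "(Suc p + i) mod m"
    have k: "?k < m" using pm by simp
    have "?k \<noteq> p"
    proof (cases "Suc p + i < m")
      case False
      then have "?k = Suc p + i - m" using pm i by (simp add: mod_if)
      then show ?thesis using i pm False by auto
    qed auto
    then have "?k \<notin> cdesc \<sigma>" using p by simp
    then have "\<sigma> ! ?k \<le> \<sigma> ! (Suc ?k mod m)" using k len by (simp add: cdesc_def)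
    moreover have "Suc ?k mod m = (Suc p + Suc i) mod m" by (simp add: mod_simps)
    moreover have "Suc ?k mod m \<noteq> ?k" using assms k by (cases "Suc ?k = m") auto
    ultimately have "\<sigma> ! ?k < \<sigma> ! ((Suc p + Suc i) mod m)"
      using perms_nth_eq_iff[OF \<sigma>, of ?k "Suc ?k mod m"] k pm by (simp add: le_less)
    then show ?thesis using i len by (simp add: \<tau>_def nth_rotate del: rotate_Suc)
  qed
  then have "sorted_wrt (<) \<tau>"
    using len by (subst sorted_wrt_iff_nth_Suc_transp) (auto simp: \<tau>_def transp_on_def)
  moreover have "set \<tau> = {..<m}" using \<sigma> by (simp add: \<tau>_def perms_def)
  ultimately have "\<tau> = [0..<m]"
    by (metis atLeast0LessThan set_upt sorted_wrt_upt strict_sorted_equal)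
  moreover have "rotate (m - Suc p) \<tau> = \<sigma>"
    using pm len by (simp add: \<tau>_def rotate_rotate del: rotate_Suc)
  ultimately have "\<sigma> = rotate (m - Suc p) [0..<m]" by simp
  then show "\<sigma> \<in> (\<lambda>j. rotate j [0..<m]) ` {..<m}" using pm by auto
next
  fix \<sigma> assume "\<sigma> \<in> (\<lambda>j. rotate j [0..<m]) ` {..<m}"
  then show "\<sigma> \<in> {\<sigma> \<in> perms m. card (cdesc \<sigma>) = 1}"
    using assms rotate_upt_in_perms by (auto simp: cdesc_rotate_upt)
qed

text \<open>On the permutations with \<open>k\<close> cyclic descents, conjugation by the long cycle
  is a bijection that multiplies \<open>q ^ maj\<close> by \<open>q\<close> to the power
  \<open>1 - k\<close> and preserves \<open>s\<close>. The sum over this class is therefore 0 unless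
  \<open>q ^ k = q\<close>; for \<open>k < m\<close> only \<open>k = 1\<close> remains, and that
  class consists of the rotations.\<close>

lemma sum_perms_root_maj:
  assumes q: "primitive_root m q"
    and s: "\<And>\<sigma>. \<sigma> \<in> perms m \<Longrightarrow> s (conj_cycle m \<sigma>) = s \<sigma>"
  shows "(\<Sum>\<sigma>\<in>perms m. q ^ maj \<sigma> * s \<sigma>) = (\<Sum>j<m. inverse (q ^ j) * s (rotate j [0..<m]))"
proof (cases "m = 1")
  case True
  have "perms 1 = {[0]}"
    using perms_length[of _ 1] by (fastforce simp: perms_def length_Suc_conv)
  moreover have "wdes [0::nat] = {}" by (auto simp: wdes_def)
  ultimately show ?thesis using True by (simp add: maj_def)
next
  case False
  have m: "2 \<le> m" and qm: "q ^ m = 1" using q False by (auto simp: primitive_root_def)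
  have q0: "q \<noteq> 0" using qm m by (auto simp: power_0_left)
  define S where "S k = (\<Sum>\<sigma> | \<sigma> \<in> perms m \<and> card (cdesc \<sigma>) = k. q ^ maj \<sigma> * s \<sigma>)" for k
  have S0: "S k = 0" if k: "k \<noteq> 1" "k < m" for k
  proof -
    let ?P = "{\<sigma>. \<sigma> \<in> perms m \<and> card (cdesc \<sigma>) = k}"
    have "inj_on (conj_cycle m) ?P"
      using bij_betw_conj_cycle[of m] by (auto simp: bij_betw_def inj_on_def)
    moreover have "conj_cycle m ` ?P \<subseteq> ?P"
      using conj_cycle_in_perms conj_cycle_cdesc(1)[OF _ m] by auto
    ultimately have bij: "bij_betw (conj_cycle m) ?P ?P"
      by (simp add: bij_betw_def endo_inj_surj)
    have "q ^ k * S k = (\<Sum>\<sigma>\<in>?P. q ^ k * (q ^ maj (conj_cycle m \<sigma>) * s (conj_cycle m \<sigma>)))"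
      unfolding S_def sum_distrib_left
      by (rule sum.reindex_bij_betw[OF bij, symmetric])
    also have "\<dots> = (\<Sum>\<sigma>\<in>?P. q * (q ^ maj \<sigma> * s \<sigma>))"
    proof (rule sum.cong)
      fix \<sigma> assume \<sigma>: "\<sigma> \<in> ?P"
      then have len: "length \<sigma> = m" using perms_length by auto
      let ?a = "\<Sum>i\<in>cdesc (conj_cycle m \<sigma>). Suc i" and ?b = "\<Sum>i\<in>cdesc \<sigma>. Suc i"
      have "[?a + k = ?b + 1] (mod m)" using conj_cycle_cdesc(2)[OF _ m, of \<sigma>] \<sigma> by simp
      then have "(?a + k) mod m = (?b + 1) mod m" by (simp add: cong_def)
      moreover have "q ^ n = q ^ (n mod m)" for n
      proof -
        have "q ^ n = q ^ (m * (n div m) + n mod m)" by simp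
        then show ?thesis using qm unfolding power_add power_mult by simp
      qed
      ultimately have "q ^ (?a + k) = q ^ (?b + 1)" by metis
      moreover have "q ^ maj (conj_cycle m \<sigma>) = q ^ ?a" "q ^ maj \<sigma> = q ^ ?b"
        using qm len by (simp_all add: root_maj_eq_cdesc)
      ultimately have "q ^ k * q ^ maj (conj_cycle m \<sigma>) = q * q ^ maj \<sigma>"
        by (simp add: power_add mult.commute)
      then show "q ^ k * (q ^ maj (conj_cycle m \<sigma>) * s (conj_cycle m \<sigma>)) = q * (q ^ maj \<sigma> * s \<sigma>)"
        using s \<sigma> by (simp flip: mult.assoc)
    qed simp
    also have "\<dots> = q * S k" by (simp add: S_def sum_distrib_left)
    finally have "(q ^ k - q) * S k = 0" by (simp add: algebra_simps)
    moreover have "q ^ k \<noteq> q"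
    proof
      assume e: "q ^ k = q"
      then have "q ^ (k + (m - 1)) = q ^ (1 + (m - 1))" by (simp only: power_add power_one_right)
      then have "q ^ (k + (m - 1)) = 1" using qm m by simp
      then have "m dvd k + (m - 1)" using primitive_root_power_eq_1[OF q] by blast
      then obtain c where c: "k + (m - 1) = m * c" by (auto elim: dvdE)
      have "m * c < m * 2" using c k m by linarith
      then have "c < 2" by simp
      then have "c = 0 \<or> c = 1" by linarith
      then show False using c k m by auto
    qed
    ultimately show ?thesis by simp
  qed
  have lt: "card (cdesc \<sigma>) < m" if "\<sigma> \<in> perms m" for \<sigma>
  proof -
    have len: "length \<sigma> = m" using perms_length[OF that] .
    have "0 \<in> set \<sigma>" using that m by (auto simp: perms_def)
    then obtain p where p: "p < m" "\<sigma> ! p = 0" using len by (auto simp: in_set_conv_nth)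
    have "p \<notin> cdesc \<sigma>" using p by (simp add: cdesc_def)
    then have "cdesc \<sigma> \<subseteq> {..<m} - {p}" using len by (auto simp: cdesc_def)
    then have "card (cdesc \<sigma>) \<le> card ({..<m} - {p})" by (intro card_mono) auto
    then show ?thesis using p by simp
  qed
  have "(\<Sum>\<sigma>\<in>perms m. q ^ maj \<sigma> * s \<sigma>) = (\<Sum>k<m. S k)"
    unfolding S_def using lt
    by (subst sum.group[of "perms m" "{..<m}" "\<lambda>\<sigma>. card (cdesc \<sigma>)"]) auto
  also have "\<dots> = (\<Sum>k\<in>{1}. S k)"
    using m S0 by (intro sum.mono_neutral_right) auto
  also have "\<dots> = (\<Sum>\<sigma>\<in>(\<lambda>j. rotate j [0..<m]) ` {..<m}. q ^ maj \<sigma> * s \<sigma>)"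
    using card_cdesc_1_iff[OF m] by (simp add: S_def)
  also have "\<dots> = (\<Sum>j<m. q ^ maj (rotate j [0..<m]) * s (rotate j [0..<m]))"
  proof (rule sum.reindex_cong[OF _ refl])
    show "inj_on (\<lambda>j. rotate j [0..<m]) {..<m}"
    proof (rule inj_onI)
      fix i j assume ij: "i \<in> {..<m}" "j \<in> {..<m}" "rotate i [0..<m] = rotate j [0..<m]"
      have "(i + 0) mod m = (j + 0) mod m"
        using nth_rotate_upt[of 0 m i] nth_rotate_upt[of 0 m j] m unfolding ij(3) by linarith
      then show "i = j" using ij by simp
    qed
  qed simp
  also have "\<dots> = (\<Sum>j<m. inverse (q ^ j) * s (rotate j [0..<m]))"
  proof (rule sum.cong)
    fix j assume j: "j \<in> {..<m}"
    have "q ^ maj (rotate j [0..<m]) = q ^ (\<Sum>i\<in>cdesc (rotate j [0..<m]). Suc i)"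
      by (rule root_maj_eq_cdesc) (simp add: qm)
    also have "(\<Sum>i\<in>cdesc (rotate j [0..<m]). Suc i) = Suc (m - 1 - j)"
      using j m by (simp add: cdesc_rotate_upt)
    also have "Suc (m - 1 - j) = m - j" using j by auto
    also have "q ^ (m - j) = inverse (q ^ j)"
    proof -
      have "q ^ (m - j) * q ^ j = 1" using j qm by (simp flip: power_add)
      then show ?thesis using q0 by (simp add: field_simps)
    qed
    finally show "q ^ maj (rotate j [0..<m]) * s (rotate j [0..<m]) = inverse (q ^ j) * s (rotate j [0..<m])"
      by simp
  qed simp
  finally show ?thesis .
qed

text \<open>Rotating words carries the words fixed by \<open>\<sigma>\<close> to those fixed by its
  conjugate and preserves weights, so \<open>sum_perms_root_maj\<close> applies. The sum over
  rotations that it leaves is the Fourier sum of \<open>sum_words_rmaj_cong_1\<close>.\<close>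

lemma sum_perms_fixed_words:
  fixes A :: "'a::linorder set"
  assumes q: "primitive_root m q" and "finite A"
  shows "(\<Sum>\<sigma>\<in>perms m. q ^ maj \<sigma> * (\<Sum>w | w \<in> words A m \<and> map ((!) w) \<sigma> = w. wt x w)) =
    of_nat m * (\<Sum>w | w \<in> words A m \<and> [maj w = 1] (mod m). wt x w)"
proof -
  let ?s = "\<lambda>\<sigma>. \<Sum>w | w \<in> words A m \<and> map ((!) w) \<sigma> = w. wt x w"
  have m: "0 < m" using q by (simp add: primitive_root_def)
  have inv: "?s (conj_cycle m \<sigma>) = ?s \<sigma>" if \<sigma>: "\<sigma> \<in> perms m" for \<sigma>
  proof -
    have len: "length \<sigma> = m" using perms_length[OF \<sigma>] .
    have *: "map ((!) (rotate1 w)) (conj_cycle m \<sigma>) = rotate1 (map ((!) w) \<sigma>)" if "length w = m" for w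
    proof (rule nth_equalityI)
      fix i assume "i < length (map ((!) (rotate1 w)) (conj_cycle m \<sigma>))"
      then have i: "i < m" using len by simp
      have si: "Suc i mod m < m" using m by simp
      let ?y = "\<sigma> ! (Suc i mod m)"
      have y: "?y < m" using perms_nth_less[OF \<sigma> si] .
      have "conj_cycle m \<sigma> ! i = (if ?y = 0 then m - 1 else ?y - 1)"
        using i len by (simp add: nth_conj_cycle)
      moreover have "rotate1 w ! (if ?y = 0 then m - 1 else ?y - 1) = w ! ?y"
        using y that by (auto simp: nth_rotate1)
      ultimately show "map ((!) (rotate1 w)) (conj_cycle m \<sigma>) ! i = rotate1 (map ((!) w) \<sigma>) ! i"
        using i len si by (simp add: nth_rotate1)
    qed (simp add: len)
    have inj: "rotate1 u = rotate1 v \<longleftrightarrow> u = v" for u v :: "'a list"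
      by (metis bij_betw_imp_inj_on bij_rotate1 injD)
    have surj: "\<exists>u. w = rotate1 u" for w :: "'a list"
      by (metis bij_betw_imp_surj bij_rotate1 surjD)
    have "{w. w \<in> words A m \<and> map ((!) w) (conj_cycle m \<sigma>) = w} =
        rotate1 ` {w. w \<in> words A m \<and> map ((!) w) \<sigma> = w}"
    proof (intro equalityI subsetI)
      fix w assume w: "w \<in> {w. w \<in> words A m \<and> map ((!) w) (conj_cycle m \<sigma>) = w}"
      obtain u where u: "w = rotate1 u" using surj by blast
      then show "w \<in> rotate1 ` {w. w \<in> words A m \<and> map ((!) w) \<sigma> = w}"
        using w *[of u] by (auto simp: words_def inj)
    next
      fix w assume "w \<in> rotate1 ` {w. w \<in> words A m \<and> map ((!) w) \<sigma> = w}"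
      then obtain u where u: "w = rotate1 u" "u \<in> words A m" "map ((!) u) \<sigma> = u" by blast
      then show "w \<in> {w. w \<in> words A m \<and> map ((!) w) (conj_cycle m \<sigma>) = w}"
        using *[of u] by (auto simp: words_def)
    qed
    moreover have "wt x (rotate1 w) = wt x w" for w by (cases w) (auto simp: mult.commute)
    ultimately show ?thesis by (simp add: sum.reindex inj_on_def inj)
  qed
  have "(\<Sum>\<sigma>\<in>perms m. q ^ maj \<sigma> * ?s \<sigma>) = (\<Sum>j<m. inverse (q ^ j) * ?s (rotate j [0..<m]))"
    by (rule sum_perms_root_maj[where s = ?s, OF q inv])
  also have "\<dots> = (\<Sum>j<m. inverse (q ^ j) * (\<Sum>w | w \<in> words A m \<and> rotate j w = w. wt x w))"
  proof -
    have "map ((!) w) (rotate j [0..<m]) = rotate j w" if "length w = m" for w :: "'a list" and j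
      using that by (simp flip: rotate_map) (metis map_nth)
    then have "{w. w \<in> words A m \<and> map ((!) w) (rotate j [0..<m]) = w} = {w. w \<in> words A m \<and> rotate j w = w}" for j
      by (auto simp: words_def)
    then show ?thesis by simp
  qed
  also have "\<dots> = of_nat m * (\<Sum>w | w \<in> words A m \<and> [rmaj w = 1] (mod m). wt x w)"
    by (rule sum_words_rmaj_cong_1[OF assms, symmetric])
  also have "(\<Sum>w | w \<in> words A m \<and> [rmaj w = 1] (mod m). wt x w) =
      (\<Sum>w | w \<in> words A m \<and> [maj w = 1] (mod m). wt x w)"
    by (rule sum.reindex_bij_witness[of _ rev rev]) (auto simp: words_def maj_rev rmaj_rev simp flip: rev_map)
  finally show ?thesis .
qed

section \<open>Linear extensions\<close>

text \<open>The linear functional with the values \<open>f\<close> on the basis. Coefficients of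
  images under linear maps are such pairings, so identities between maps reduce to identities
  between functions on words.\<close>

definition pair :: "('a \<Rightarrow> complex) \<Rightarrow> ('a \<Rightarrow>\<^sub>0 complex) \<Rightarrow> complex" where
  "pair f p = (\<Sum>x\<in>Poly_Mapping.keys p. Poly_Mapping.lookup p x * f x)"

lemma pair_superset:
  "finite S \<Longrightarrow> Poly_Mapping.keys p \<subseteq> S \<Longrightarrow> pair f p = (\<Sum>x\<in>S. Poly_Mapping.lookup p x * f x)"
  unfolding pair_def by (rule sum.mono_neutral_left) (auto simp: in_keys_iff)

lemma pair_0 [simp]: "pair f 0 = 0"
  by (simp add: pair_def)

lemma pair_add: "pair f (p + q) = pair f p + pair f q"
proof -
  let ?S = "Poly_Mapping.keys p \<union> Poly_Mapping.keys q"
  have "pair f (p + q) = (\<Sum>x\<in>?S. Poly_Mapping.lookup (p + q) x * f x)"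
    using keys_add[of p q] by (intro pair_superset) auto
  then show ?thesis
    by (simp add: pair_superset[of ?S p f] pair_superset[of ?S q f] lookup_add
        distrib_right sum.distrib)
qed

lemma keys_scale_subset: "Poly_Mapping.keys (scale c p) \<subseteq> Poly_Mapping.keys p"
  by (auto simp: in_keys_iff lookup_scale)

lemma pair_scale: "pair f (scale c p) = c * pair f p"
  by (subst pair_superset[of "Poly_Mapping.keys p"])
     (use keys_scale_subset[of c p] in \<open>auto simp: lookup_scale pair_def sum_distrib_left mult.assoc\<close>)

lemma pair_single [simp]: "pair f (Poly_Mapping.single a c) = c * f a"
  by (simp add: pair_def)

lemma pair_sum: "pair f (\<Sum>i\<in>I. p i) = (\<Sum>i\<in>I. pair f (p i))"
  by (induction I rule: infinite_finite_induct) (auto simp: pair_add)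

lemma diff_eq_scale: "p - q = p + scale (- 1) (q :: 'a \<Rightarrow>\<^sub>0 complex)"
  by (rule poly_mapping_eqI) (simp add: lookup_minus lookup_add lookup_scale)

lemma pair_diff: "pair f (p - q) = pair f p - pair f q"
  by (simp only: diff_eq_scale pair_add pair_scale) simp

lemma pair_cong: "(\<And>x. x \<in> Poly_Mapping.keys p \<Longrightarrow> f x = g x) \<Longrightarrow> pair f p = pair g p"
  by (simp add: pair_def)

lemma pair_fun_add: "pair (\<lambda>x. f x + g x) p = pair f p + pair g p"
  by (simp add: pair_def distrib_left sum.distrib)

lemma pair_fun_sum: "pair (\<lambda>x. \<Sum>i\<in>I. f i x) p = (\<Sum>i\<in>I. pair (f i) p)"
  unfolding pair_def sum_distrib_left by (rule sum.swap)

lemma pair_fun_mult_left: "pair (\<lambda>x. c * f x) p = c * pair f p"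
  by (simp add: pair_def sum_distrib_left mult_ac)

lemma pair_fun_mult_right: "pair (\<lambda>x. f x * c) p = pair f p * c"
  by (simp add: pair_def sum_distrib_left sum_distrib_right mult_ac)

lemma pair_delta: "pair (\<lambda>x. of_bool (x = v)) p = Poly_Mapping.lookup p v"
  by (simp add: pair_def of_bool_def if_distrib[of "\<lambda>z. _ * z"] in_keys_iff cong: if_cong)

lemma sum_single_lookup: "p = (\<Sum>x\<in>Poly_Mapping.keys p. Poly_Mapping.single x (Poly_Mapping.lookup p x))"
  by (rule poly_mapping_eqI) (simp add: lookup_sum lookup_single when_def in_keys_iff)

lemma pair_mult: "pair f (p * q) = pair (\<lambda>x. pair (\<lambda>y. f (x + y)) q) p"
  by (subst sum_single_lookup[of p], subst sum_single_lookup[of q])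
     (simp add: sum_product pair_sum mult_single, simp add: pair_def sum_distrib_left mult.assoc)

lemma lookup_linear_ext:
  "Poly_Mapping.lookup (linear_ext f p) k = pair (\<lambda>a. Poly_Mapping.lookup (f a) k) p"
  by (simp add: linear_ext_def pair_def lookup_sum lookup_scale)

lemma linear_ext_single [simp]: "linear_ext f (Poly_Mapping.single a c) = scale c (f a)"
  by (rule poly_mapping_eqI) (simp add: lookup_linear_ext lookup_scale)

lemma linear_ext_add: "linear_ext f (p + q) = linear_ext f p + linear_ext f q"
  by (rule poly_mapping_eqI) (simp add: lookup_linear_ext lookup_add pair_add)

lemma linear_ext_scale: "linear_ext f (scale c p) = scale c (linear_ext f p)"
  by (rule poly_mapping_eqI) (simp add: lookup_linear_ext lookup_scale pair_scale)

lemma linear_ext_0 [simp]: "linear_ext f 0 = 0"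
  by (simp add: linear_ext_def)

lemma linear_ext_sum: "linear_ext f (\<Sum>i\<in>I. p i) = (\<Sum>i\<in>I. linear_ext f (p i))"
  by (induction I rule: infinite_finite_induct) (auto simp: linear_ext_add)

lemma pair_linear_ext: "pair f (linear_ext g p) = pair (\<lambda>a. pair f (g a)) p"
  by (simp add: linear_ext_def pair_sum pair_scale, simp add: pair_def)

lemma scale_single: "scale c (Poly_Mapping.single a d) = Poly_Mapping.single a (c * d)"
  by (rule poly_mapping_eqI) (simp add: lookup_scale lookup_single when_def)

lemma linear_ext_id: "(\<And>a. a \<in> Poly_Mapping.keys p \<Longrightarrow> f a = Poly_Mapping.single a 1) \<Longrightarrow> linear_ext f p = p"
  by (subst (2) sum_single_lookup) (simp add: linear_ext_def scale_single)

section \<open>Primitive elements of the tensor algebra\<close>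

text \<open>
  \<open>shc u v x\<close> is the multiplicity of the word \<open>x\<close> in the shuffle product of \<open>u\<close> and \<open>v\<close>, i.e. the
  coefficient of \<open>u \<otimes> v\<close> in the unshuffling coproduct of \<open>x\<close>.
\<close>

fun shc :: "'a list \<Rightarrow> 'a list \<Rightarrow> 'a list \<Rightarrow> complex" where
  "shc u v [] = of_bool (u = [] \<and> v = [])"
| "shc u v (c # x) =
    (case u of [] \<Rightarrow> 0 | a # u' \<Rightarrow> if a = c then shc u' v x else 0) +
    (case v of [] \<Rightarrow> 0 | a # v' \<Rightarrow> if a = c then shc u v' x else 0)"

lemma shc_Nil_left: "shc [] v x = of_bool (x = v)"
  by (induction x arbitrary: v) (auto split: list.splits)

lemma shc_Nil_right: "shc u [] x = of_bool (x = u)"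
  by (induction x arbitrary: u) (auto split: list.splits)

lemma shc_length: "shc u v x \<noteq> 0 \<Longrightarrow> length x = length u + length v"
proof -
  have "length x \<noteq> length u + length v \<Longrightarrow> shc u v x = 0"
  proof (induction u v x rule: shc.induct)
    case (2 u v c x)
    then show ?case by (cases u; cases v) auto
  qed auto
  then show "shc u v x \<noteq> 0 \<Longrightarrow> length x = length u + length v" by blast
qed

text \<open>Cutting an interleaving cuts both of its constituents. This is the dual form of the
  multiplicativity of the unshuffling coproduct.\<close>

lemma shc_append:
  "shc u v (x @ y) = (\<Sum>i\<le>length u. \<Sum>j\<le>length v.
     shc (take i u) (take j v) x * shc (drop i u) (drop j v) y)"
proof (induction x arbitrary: u v)
  case Nil
  have "(\<Sum>i\<le>length u. \<Sum>j\<le>length v. shc (take i u) (take j v) [] * shc (drop i u) (drop j v) y) =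
      (\<Sum>i\<le>length u. \<Sum>j\<le>length v. if j = 0 then (if i = 0 then shc u v y else 0) else 0)"
    by (intro sum.cong refl) auto
  then show ?case by simp
next
  case (Cons c x)
  let ?T = "\<lambda>u v i j. shc (take i u) (take j v) x * shc (drop i u) (drop j v) y"
  have L: "(\<Sum>i\<le>length u. \<Sum>j\<le>length v.
      (case take i u of [] \<Rightarrow> 0 | a # u' \<Rightarrow> if a = c then shc u' (take j v) x else 0)
        * shc (drop i u) (drop j v) y) =
      (case u of [] \<Rightarrow> 0 | a # u' \<Rightarrow> if a = c then shc u' v (x @ y) else 0)"
  proof (cases u)
    case (Cons a u')
    then show ?thesis
      by (simp add: sum.atMost_Suc_shift Cons.IH[of u' v] del: sum.atMost_Suc)
  qed simp
  have R: "(\<Sum>i\<le>length u. \<Sum>j\<le>length v.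
      (case take j v of [] \<Rightarrow> 0 | a # v' \<Rightarrow> if a = c then shc (take i u) v' x else 0)
        * shc (drop i u) (drop j v) y) =
      (case v of [] \<Rightarrow> 0 | a # v' \<Rightarrow> if a = c then shc u v' (x @ y) else 0)"
  proof (cases v)
    case (Cons a v')
    then show ?thesis
      by (simp add: sum.atMost_Suc_shift Cons.IH[of u v'] del: sum.atMost_Suc)
  qed simp
  show ?case
    unfolding append_Cons shc.simps(2) distrib_right sum.distrib L R ..
qed

text \<open>The recursion at the last letter, opposite to the defining one. Cutting off
  \<open>c\<close> leaves, for reasons of length, only the two cuts that take \<open>c\<close> from
  \<open>u\<close> or from \<open>v\<close>.\<close>

lemma shc_snoc:
  "shc (u @ [a]) (v @ [b]) (x @ [c]) =
    (if a = c then shc u (v @ [b]) x else 0) + (if b = c then shc (u @ [a]) v x else 0)"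
proof -
  let ?u = "u @ [a]" and ?v = "v @ [b]"
  let ?F = "\<lambda>i j. shc (take i ?u) (take j ?v) x * shc (drop i ?u) (drop j ?v) [c]"
  have z: "?F i j = 0" if "i \<le> length ?u" "j \<le> length ?v"
    "(i, j) \<noteq> (length u, length ?v)" "(i, j) \<noteq> (length ?u, length v)" for i j
  proof -
    have "length [c] \<noteq> length (drop i ?u) + length (drop j ?v)" using that by auto
    then have "shc (drop i ?u) (drop j ?v) [c] = 0" using shc_length by blast
    then show ?thesis by simp
  qed
  have "shc ?u ?v (x @ [c]) = (\<Sum>p\<in>{..length ?u} \<times> {..length ?v}. ?F (fst p) (snd p))"
    by (simp only: shc_append sum.cartesian_product case_prod_unfold)
  also have "\<dots> = (\<Sum>p\<in>{(length u, length ?v), (length ?u, length v)}. ?F (fst p) (snd p))"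
  proof (rule sum.mono_neutral_right)
    show "\<forall>p\<in>{..length ?u} \<times> {..length ?v} - {(length u, length ?v), (length ?u, length v)}.
        ?F (fst p) (snd p) = 0"
      by (intro ballI z) auto
  qed auto
  also have "\<dots> = (if a = c then shc u (v @ [b]) x else 0) + (if b = c then shc (u @ [a]) v x else 0)"
    by simp
  finally show ?thesis .
qed

text \<open>Primitivity for the unshuffling coproduct: the coefficients of
  \<open>u \<otimes> v\<close> with two nonempty factors vanish. This is Ree's orthogonality to all
  proper shuffles.\<close>

definition primitive_elt :: "('a list \<Rightarrow>\<^sub>0 complex) \<Rightarrow> bool" where
  "primitive_elt p \<longleftrightarrow> Poly_Mapping.lookup p [] = 0 \<and> (\<forall>u v. u \<noteq> [] \<longrightarrow> v \<noteq> [] \<longrightarrow> pair (shc u v) p = 0)"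

lemma pair_shc_mult:
  "pair (shc u v) (p * q) = (\<Sum>i\<le>length u. \<Sum>j\<le>length v.
     pair (shc (take i u) (take j v)) p * pair (shc (drop i u) (drop j v)) q)"
  by (simp add: pair_mult plus_list_def shc_append pair_fun_sum pair_fun_mult_left pair_fun_mult_right)

lemma pair_shc_Nil: "pair (shc [] v) p = Poly_Mapping.lookup p v" "pair (shc u []) p = Poly_Mapping.lookup p u"
proof -
  have "shc [] v = (\<lambda>x. of_bool (x = v))" "shc u [] = (\<lambda>x. of_bool (x = u))"
    by (auto simp: shc_Nil_left shc_Nil_right)
  then show "pair (shc [] v) p = Poly_Mapping.lookup p v" "pair (shc u []) p = Poly_Mapping.lookup p u"
    by (simp_all add: pair_delta)
qed

text \<open>Primitivity kills every cut except those that give one word entirely to \<open>p\<close>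
  and the other to \<open>q\<close>. The result is symmetric in \<open>p\<close> and
  \<open>q\<close>, so commutators of primitive elements are primitive.\<close>

lemma pair_shc_mult_primitive:
  assumes "primitive_elt p" "primitive_elt q" "u \<noteq> []" "v \<noteq> []"
  shows "pair (shc u v) (p * q) =
    Poly_Mapping.lookup p u * Poly_Mapping.lookup q v + Poly_Mapping.lookup p v * Poly_Mapping.lookup q u"
proof -
  let ?F = "\<lambda>i j. pair (shc (take i u) (take j v)) p * pair (shc (drop i u) (drop j v)) q"
  have z: "?F i j = 0" if ij: "i \<le> length u" "j \<le> length v"
    "(i, j) \<noteq> (length u, 0)" "(i, j) \<noteq> (0, length v)" for i j
  proof -
    have "i = length u \<longrightarrow> j \<noteq> 0" "i = 0 \<longrightarrow> j \<noteq> length v" "length u \<noteq> 0" "length v \<noteq> 0"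
      using ij assms(3,4) by auto
    then consider "i = 0" "j = 0" | "i = length u" "j = length v" | "i \<noteq> 0" "j \<noteq> 0"
      | "i \<noteq> length u" "j \<noteq> length v"
      by (metis (full_types))
    then show ?thesis
      by cases (use assms ij in \<open>auto simp: primitive_elt_def pair_shc_Nil\<close>)
  qed
  have "pair (shc u v) (p * q) = (\<Sum>p\<in>{..length u} \<times> {..length v}. ?F (fst p) (snd p))"
    by (simp only: pair_shc_mult sum.cartesian_product case_prod_unfold)
  also have "\<dots> = (\<Sum>p\<in>{(length u, 0), (0, length v)}. ?F (fst p) (snd p))"
  proof (rule sum.mono_neutral_right)
    show "\<forall>p\<in>{..length u} \<times> {..length v} - {(length u, 0), (0, length v)}. ?F (fst p) (snd p) = 0"
      by (intro ballI z) auto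
  qed auto
  also have "\<dots> = Poly_Mapping.lookup p u * Poly_Mapping.lookup q v + Poly_Mapping.lookup p v * Poly_Mapping.lookup q u"
    using assms by (simp add: pair_shc_Nil)
  finally show ?thesis .
qed

lemma lookup_mult_Nil:
  "Poly_Mapping.lookup (p * q) [] = Poly_Mapping.lookup p [] * Poly_Mapping.lookup (q :: 'a list \<Rightarrow>\<^sub>0 complex) []"
  using pair_shc_mult[of "[]" "[]" p q] by (simp add: pair_shc_Nil)

lemma free_lie_primitive: "p \<in> free_lie N \<Longrightarrow> primitive_elt p"
proof (induction rule: free_lie.induct)
  case (generator v)
  have "shc u w [a] = 0" if "u \<noteq> []" "w \<noteq> []" for u w and a :: nat
    using that shc_length[of u w "[a]"] by (cases u; cases w) auto
  then show ?case
    by (auto simp: primitive_elt_def tens_of_def pair_linear_ext lookup_linear_ext lookup_single)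
       (simp_all add: pair_def)
next
  case (bracket p q)
  then show ?case
    unfolding primitive_elt_def[of "p * q - q * p"]
    by (auto simp: pair_diff pair_shc_mult_primitive lookup_minus lookup_mult_Nil)
qed (auto simp: primitive_elt_def pair_add pair_scale lookup_add lookup_scale)

subsection \<open>The Dynkin operator\<close>

text \<open>The right-normed bracket \<open>[a, [b, [c, ...]]]\<close>; its linear extension is the
  Dynkin operator.\<close>

fun nested_bracket :: "'a list \<Rightarrow> ('a list \<Rightarrow>\<^sub>0 complex)" where
  "nested_bracket [] = 0"
| "nested_bracket [a] = Poly_Mapping.single [a] 1"
| "nested_bracket (a # b # x) =
    Poly_Mapping.single [a] 1 * nested_bracket (b # x) - nested_bracket (b # x) * Poly_Mapping.single [a] 1"

lemma lookup_single_letter_mult: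
  "Poly_Mapping.lookup (Poly_Mapping.single [a] 1 * (r :: 'a list \<Rightarrow>\<^sub>0 complex)) v =
    (case v of [] \<Rightarrow> 0 | c # v' \<Rightarrow> if c = a then Poly_Mapping.lookup r v' else 0)"
proof -
  have "pair (\<lambda>x. of_bool (x = v)) (Poly_Mapping.single [a] 1 * r) =
      pair (\<lambda>y. of_bool (a # y = v)) r"
    by (simp add: pair_mult plus_list_def)
  also have "\<dots> = (case v of [] \<Rightarrow> 0 | c # v' \<Rightarrow> if c = a then Poly_Mapping.lookup r v' else 0)"
  proof (cases v)
    case (Cons c v')
    then show ?thesis using pair_delta[of v' r]
      by (cases "c = a") (auto simp: pair_def of_bool_def)
  qed (simp add: pair_def)
  finally show ?thesis by (simp add: pair_delta)
qed

lemma lookup_mult_single_letter: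
  "Poly_Mapping.lookup ((r :: 'a list \<Rightarrow>\<^sub>0 complex) * Poly_Mapping.single [a] 1) v =
    (if v \<noteq> [] \<and> last v = a then Poly_Mapping.lookup r (butlast v) else 0)"
proof -
  have "pair (\<lambda>x. of_bool (x = v)) (r * Poly_Mapping.single [a] 1) =
      pair (\<lambda>y. of_bool (y @ [a] = v)) r"
    by (simp add: pair_mult plus_list_def)
  also have "\<dots> = (if v \<noteq> [] \<and> last v = a then Poly_Mapping.lookup r (butlast v) else 0)"
  proof (cases v rule: rev_cases)
    case (snoc v' c)
    then show ?thesis using pair_delta[of v' r]
      by (cases "c = a") (auto simp: pair_def of_bool_def)
  qed (simp add: pair_def)
  finally show ?thesis by (simp add: pair_delta)
qed

text \<open>Expanding the nested bracket of \<open>x\<close>, the last letter is the centre and each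
  other letter goes to its left, in order, or to its right, in reverse order and with a sign. This
  counts the ways to obtain \<open>v\<close> with the centre at index \<open>k\<close>, signs
  aside.\<close>

definition dynkin_term :: "'a list \<Rightarrow> nat \<Rightarrow> 'a list \<Rightarrow> complex" where
  "dynkin_term v k x =
    (if x \<noteq> [] \<and> last x = v ! k then shc (take k v) (rev (drop (Suc k) v)) (butlast x) else 0)"

text \<open>The first letter of the bracketed word belongs to the outermost bracket, so in
  \<open>v\<close> it is the first or the last letter.\<close>

lemma dynkin_term_Cons:
  assumes "x \<noteq> []" "k < length v"
  shows "dynkin_term v k (a # x) =
    (if k > 0 \<and> hd v = a then dynkin_term (tl v) (k - 1) x else 0) +
    (if Suc k < length v \<and> last v = a then dynkin_term (butlast v) k x else 0)"
proof -
  have 1: "(case take k v of [] \<Rightarrow> 0 | b # u' \<Rightarrow> if b = a then shc u' w z else 0) =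
      (if k > 0 \<and> hd v = a then shc (take (k - 1) (tl v)) w z else 0)" for w z
    using assms by (cases v; cases k) auto
  have 2: "(case rev (drop (Suc k) v) of [] \<Rightarrow> 0 | b # w' \<Rightarrow> if b = a then shc u w' z else 0) =
      (if Suc k < length v \<and> last v = a then shc u (rev (drop (Suc k) (butlast v))) z else 0)" for u z
  proof (cases "Suc k < length v")
    case True
    then have "v \<noteq> []" by auto
    then have "v = butlast v @ [last v]" "length (butlast v) \<ge> Suc k" using True by auto
    then have "rev (drop (Suc k) v) = last v # rev (drop (Suc k) (butlast v))"
      by (metis drop_append diff_is_0_eq drop_0 rev_append rev.simps append_Nil append_Cons)
    then show ?thesis using True by simp
  qed (use assms in auto)
  have 3: "drop (Suc (k - 1)) (tl v) = drop (Suc k) v" "tl v ! (k - 1) = v ! k" if "k > 0"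
    using that assms by (cases v; simp)+
  have 4: "take k (butlast v) = take k v" "butlast v ! k = v ! k" if "Suc k < length v"
    using that by (simp_all add: take_butlast nth_butlast)
  show ?thesis
    using assms 3 4 by (auto simp: dynkin_term_def 1 2)
qed

lemma lookup_nested_bracket:
  "x \<noteq> [] \<Longrightarrow> Poly_Mapping.lookup (nested_bracket x) v =
    (\<Sum>k<length v. (- 1) ^ (length v - Suc k) * dynkin_term v k x)"
proof (induction x arbitrary: v rule: nested_bracket.induct)
  case (2 a)
  have "(\<Sum>k<length v. (- 1) ^ (length v - Suc k) * dynkin_term v k [a]) =
      (\<Sum>k<length v. if k = 0 then of_bool (v = [a]) else 0)"
  proof (rule sum.cong)
    fix k assume "k \<in> {..<length v}"
    then show "(- 1) ^ (length v - Suc k) * dynkin_term v k [a] = (if k = 0 then of_bool (v = [a]) else 0)"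
      by (cases v) (auto simp: dynkin_term_def)
  qed simp
  then show ?case by (cases v) (auto simp: lookup_single when_def)
next
  case (3 a b x)
  let ?x = "b # x" and ?n = "length v"
  let ?r = "nested_bracket (b # x)"
  let ?t = "\<lambda>v k. (- 1) ^ (length v - Suc k) * dynkin_term v k ?x"
  have "(\<Sum>k<?n. (- 1) ^ (?n - Suc k) * dynkin_term v k (a # ?x)) =
      (\<Sum>k<?n. if k > 0 \<and> hd v = a then (- 1) ^ (?n - Suc k) * dynkin_term (tl v) (k - 1) ?x else 0) +
      (\<Sum>k<?n. if Suc k < ?n \<and> last v = a then (- 1) ^ (?n - Suc k) * dynkin_term (butlast v) k ?x else 0)"
    unfolding sum.distrib[symmetric]
  proof (rule sum.cong)
    fix k assume "k \<in> {..<?n}"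
    then have k: "k < ?n" by simp
    show "(- 1) ^ (?n - Suc k) * dynkin_term v k (a # ?x) =
        (if k > 0 \<and> hd v = a then (- 1) ^ (?n - Suc k) * dynkin_term (tl v) (k - 1) ?x else 0) +
        (if Suc k < ?n \<and> last v = a then (- 1) ^ (?n - Suc k) * dynkin_term (butlast v) k ?x else 0)"
      unfolding dynkin_term_Cons[OF list.distinct(2) k] distrib_left
      by (intro arg_cong2[of _ _ _ _ "(+)"]) simp_all
  qed simp
  also have "(\<Sum>k<?n. if k > 0 \<and> hd v = a then (- 1) ^ (?n - Suc k) * dynkin_term (tl v) (k - 1) ?x else 0) =
      (case v of [] \<Rightarrow> 0 | c # v' \<Rightarrow> if c = a then Poly_Mapping.lookup ?r v' else 0)"
  proof (cases v)
    case (Cons c v')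
    then show ?thesis using "3.IH"(1)[of v']
      by (simp add: sum.lessThan_Suc_shift del: sum.lessThan_Suc)
  qed simp
  also have "(\<Sum>k<?n. if Suc k < ?n \<and> last v = a then (- 1) ^ (?n - Suc k) * dynkin_term (butlast v) k ?x else 0) =
      - (if v \<noteq> [] \<and> last v = a then Poly_Mapping.lookup ?r (butlast v) else 0)"
  proof (cases v rule: rev_cases)
    case (snoc v' c)
    have "(\<Sum>k<length v'. (- 1) ^ (length v' - k) * dynkin_term v' k ?x) =
        (\<Sum>k<length v'. - ((- 1) ^ (length v' - Suc k) * dynkin_term v' k ?x))"
      by (intro sum.cong refl) (auto simp flip: Suc_diff_Suc)
    then show ?thesis using "3.IH"(1)[of v'] snoc by (simp add: sum_negf)
  qed simp
  finally show ?case
    by (simp add: lookup_minus lookup_single_letter_mult lookup_mult_single_letter)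
qed simp

text \<open>
  For a primitive element all but the outermost shuffles in the coefficients of the nested
  bracket telescope, which gives the Dynkin--Specht--Wever theorem.
\<close>

lemma pair_dynkin_term:
  assumes "primitive_elt p" "Suc k < length v"
  shows "pair (dynkin_term v k) p = - pair (dynkin_term v (Suc k)) p"
proof -
  let ?u = "take k v" and ?a = "v ! k" and ?b = "v ! Suc k" and ?w = "rev (drop (Suc (Suc k)) v)"
  have u: "take (Suc k) v = ?u @ [?a]" using assms by (simp add: take_Suc_conv_app_nth)
  have w: "rev (drop (Suc k) v) = ?w @ [?b]"
    using assms by (simp add: Cons_nth_drop_Suc[symmetric])
  have "shc (?u @ [?a]) (?w @ [?b]) x = dynkin_term v k x + dynkin_term v (Suc k) x" for x
  proof (cases x rule: rev_cases)
    case (snoc y c)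
    then show ?thesis by (simp add: shc_snoc dynkin_term_def u w)
  qed (simp add: dynkin_term_def)
  then have "shc (?u @ [?a]) (?w @ [?b]) = (\<lambda>x. dynkin_term v k x + dynkin_term v (Suc k) x)"
    by (rule ext)
  then have "pair (shc (?u @ [?a]) (?w @ [?b])) p = pair (dynkin_term v k) p + pair (dynkin_term v (Suc k)) p"
    by (simp only: pair_fun_add)
  moreover have "pair (shc (?u @ [?a]) (?w @ [?b])) p = 0"
    using assms by (simp add: primitive_elt_def)
  ultimately show ?thesis by (simp add: add_eq_0_iff)
qed

lemma nested_bracket_primitive:
  assumes p: "primitive_elt p" and m: "0 < m" and deg: "\<And>x. x \<in> Poly_Mapping.keys p \<Longrightarrow> length x = m"
  shows "linear_ext nested_bracket p = scale (of_nat m) p"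
proof (rule poly_mapping_eqI)
  fix v
  have "Poly_Mapping.lookup (linear_ext nested_bracket p) v =
      pair (\<lambda>x. \<Sum>k<length v. (- 1) ^ (length v - Suc k) * dynkin_term v k x) p"
    unfolding lookup_linear_ext
    by (rule pair_cong, rule lookup_nested_bracket) (use deg m in auto)
  also have "\<dots> = (\<Sum>k<length v. (- 1) ^ (length v - Suc k) * pair (dynkin_term v k) p)"
    by (simp add: pair_fun_sum pair_fun_mult_left)
  also have "\<dots> = (\<Sum>k<length v. Poly_Mapping.lookup p v)"
  proof (rule sum.cong)
    fix k assume "k \<in> {..<length v}"
    then have "k < length v" by simp
    \<comment> \<open>Moving the centre one place to the left flips the sign of the pairing. With
      the centre at the end of \<open>v\<close> the shuffle is with the empty word and the pairing
      is the coefficient of \<open>v\<close>, so all places contribute the same amount.\<close>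
    have "(- 1) ^ i * pair (dynkin_term v (length v - Suc i)) p = Poly_Mapping.lookup p v"
      if "i < length v" for i
      using that
    proof (induction i)
      case 0
      have "x \<noteq> [] \<and> last x = last v \<and> butlast x = butlast v \<longleftrightarrow> x = v" for x
        using 0 by (auto, metis append_butlast_last_id length_greater_0_conv)
      then have "dynkin_term v (length v - Suc 0) = (\<lambda>x. of_bool (x = v))"
        using 0 by (intro ext) (auto simp: dynkin_term_def shc_Nil_right last_conv_nth butlast_conv_take)
      then show ?case by (simp add: pair_delta)
    next
      case (Suc i)
      have "Suc (length v - Suc (Suc i)) = length v - Suc i" using Suc.prems by simp
      then have "pair (dynkin_term v (length v - Suc (Suc i))) p = - pair (dynkin_term v (length v - Suc i)) p"
        using pair_dynkin_term[OF p, of "length v - Suc (Suc i)" v] Suc.prems by simp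
      then show ?case using Suc by simp
    qed
    from this[of "length v - Suc k"] \<open>k < length v\<close>
    show "(- 1) ^ (length v - Suc k) * pair (dynkin_term v k) p = Poly_Mapping.lookup p v"
      by (simp add: Suc_diff_Suc)
  qed simp
  also have "\<dots> = of_nat m * Poly_Mapping.lookup p v"
    using deg[of v] by (cases "v \<in> Poly_Mapping.keys p") (auto simp: in_keys_iff)
  finally show "Poly_Mapping.lookup (linear_ext nested_bracket p) v = Poly_Mapping.lookup (scale (of_nat m) p) v"
    by (simp add: lookup_scale)
qed

lemma single_letter_in_std_space: "a < N \<Longrightarrow> Poly_Mapping.single a 1 \<in> std_space N"
  unfolding std_space_def by (rule pm.span_base) auto

lemma tens_of_single: "tens_of (Poly_Mapping.single a 1) = Poly_Mapping.single [a] 1"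
  by (simp add: tens_of_def)

lemma nested_bracket_in_free_lie:
  "set x \<subseteq> {..<N} \<Longrightarrow> nested_bracket x \<in> free_lie N"
proof (induction x rule: nested_bracket.induct)
  case (2 a)
  then show ?case
    using free_lie.generator[OF single_letter_in_std_space[of a N]] by (simp add: tens_of_single)
next
  case (3 a b x)
  have "Poly_Mapping.single [a] 1 \<in> free_lie N"
    using 3 free_lie.generator[OF single_letter_in_std_space[of a N]] by (simp add: tens_of_single)
  then show ?case using 3 by (simp add: free_lie.bracket)
qed (simp add: free_lie.zero)

lemma free_lie_sum: "(\<And>i. i \<in> I \<Longrightarrow> p i \<in> free_lie N) \<Longrightarrow> (\<Sum>i\<in>I. p i) \<in> free_lie N"
  by (induction I rule: infinite_finite_induct) (auto intro: free_lie.zero free_lie.add)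

lemma primitive_in_free_lie:
  assumes "primitive_elt p" "0 < m" "Poly_Mapping.keys p \<subseteq> words {..<N} m"
  shows "p \<in> free_lie N"
proof -
  have "linear_ext nested_bracket p \<in> free_lie N"
    unfolding linear_ext_def
    by (intro free_lie_sum free_lie.scale nested_bracket_in_free_lie) (use assms in \<open>auto simp: words_def\<close>)
  then have "scale (inverse (of_nat m)) (linear_ext nested_bracket p) \<in> free_lie N"
    by (rule free_lie.scale)
  also have "scale (inverse (of_nat m)) (linear_ext nested_bracket p) = p"
  proof -
    have "length x = m" if "x \<in> Poly_Mapping.keys p" for x
      using that assms(3) by (auto simp: words_def)
    then show ?thesis using nested_bracket_primitive[OF assms(1,2)] assms(2) by simp
  qed
  finally show ?thesis .
qed

section \<open>The Klyachko idempotent\<close>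

text \<open>Distinct letters serve as labels of the places: an interleaving is the choice of a set
  \<open>B\<close> of labels for \<open>u\<close>, and \<open>f\<close> turns labels into the actual
  letters. Repeated letters are thus counted with multiplicity.\<close>

lemma shc_map_distinct:
  "distinct x \<Longrightarrow> shc u v (map f x) =
    (\<Sum>B\<in>Pow (set x). of_bool (map f (filter (\<lambda>a. a \<in> B) x) = u \<and> map f (filter (\<lambda>a. a \<notin> B) x) = v))"
proof (induction x arbitrary: u v)
  case (Cons c x)
  let ?g = "\<lambda>x u v B. of_bool (map f (filter (\<lambda>a. a \<in> B) x) = u \<and> map f (filter (\<lambda>a. a \<notin> B) x) = v) :: complex"
  have c: "c \<notin> set x" using Cons.prems by simp
  have inj: "inj_on (insert c) (Pow (set x))"
    using c by (auto simp: inj_on_def)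
  have "(\<Sum>B\<in>Pow (set (c # x)). ?g (c # x) u v B) =
      (\<Sum>B\<in>Pow (set x). ?g (c # x) u v B) + (\<Sum>B\<in>insert c ` Pow (set x). ?g (c # x) u v B)"
    unfolding list.set Pow_insert using c by (intro sum.union_disjoint) auto
  also have "(\<Sum>B\<in>insert c ` Pow (set x). ?g (c # x) u v B) = (\<Sum>B\<in>Pow (set x). ?g (c # x) u v (insert c B))"
    by (simp add: sum.reindex[OF inj])
  also have "\<dots> = (\<Sum>B\<in>Pow (set x). case u of [] \<Rightarrow> 0 | a # u' \<Rightarrow> if a = f c then ?g x u' v B else 0)"
  proof (rule sum.cong)
    fix B assume "B \<in> Pow (set x)"
    have "filter (\<lambda>a. a \<in> insert c B) x = filter (\<lambda>a. a \<in> B) x"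
      "filter (\<lambda>a. a \<notin> insert c B) x = filter (\<lambda>a. a \<notin> B) x"
      using c by (auto intro!: filter_cong)
    then show "?g (c # x) u v (insert c B) = (case u of [] \<Rightarrow> 0 | a # u' \<Rightarrow> if a = f c then ?g x u' v B else 0)"
      by (cases u) auto
  qed simp
  also have "\<dots> = (case u of [] \<Rightarrow> 0 | a # u' \<Rightarrow> if a = f c then shc u' v (map f x) else 0)"
    using Cons by (cases u) auto
  also have "(\<Sum>B\<in>Pow (set x). ?g (c # x) u v B) =
      (\<Sum>B\<in>Pow (set x). case v of [] \<Rightarrow> 0 | a # v' \<Rightarrow> if a = f c then ?g x u v' B else 0)"
  proof (rule sum.cong)
    fix B assume "B \<in> Pow (set x)"
    then have "c \<notin> B" using c by auto
    then show "?g (c # x) u v B = (case v of [] \<Rightarrow> 0 | a # v' \<Rightarrow> if a = f c then ?g x u v' B else 0)"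
      by (cases v) auto
  qed simp
  also have "\<dots> = (case v of [] \<Rightarrow> 0 | a # v' \<Rightarrow> if a = f c then shc u v' (map f x) else 0)"
    using Cons by (cases v) auto
  finally show ?case by (simp add: add.commute)
qed (auto simp: of_bool_def)

text \<open>Fixing the order inside \<open>P\<close> and inside its complement leaves exactly one
  class of shuffles. Both halves of the Klyachko argument split a sum over permutations into such
  classes.\<close>

lemma partition_fiber:
  assumes "\<sigma>0 \<in> perms m"
  shows "{\<sigma> \<in> perms m. (filter P \<sigma>, filter (\<lambda>x. \<not> P x) \<sigma>) = (filter P \<sigma>0, filter (\<lambda>x. \<not> P x) \<sigma>0)} =
    shuffles (filter P \<sigma>0) (filter (\<lambda>x. \<not> P x) \<sigma>0)" (is "?L = shuffles ?a ?b")
proof -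
  have "shuffles ?a ?b = List.partition P -` {(?a, ?b)}"
    by (rule inv_image_partition[symmetric]) auto
  also have "\<dots> = {\<sigma>. filter P \<sigma> = ?a \<and> filter (\<lambda>x. \<not> P x) \<sigma> = ?b}"
    by (auto simp: o_def)
  finally have sh: "shuffles ?a ?b = {\<sigma>. filter P \<sigma> = ?a \<and> filter (\<lambda>x. \<not> P x) \<sigma> = ?b}" .
  have "\<sigma> \<in> perms m" if "\<sigma> \<in> shuffles ?a ?b" for \<sigma>
  proof -
    have "distinct \<sigma>"
      using that assms by (intro distinct_disjoint_shuffles[OF _ _ _ that]) (auto simp: perms_def)
    moreover have "set \<sigma> = {..<m}" using set_shuffles[OF that] assms by (auto simp: perms_def)
    ultimately show ?thesis by (simp add: perms_def)
  qed
  then show ?thesis using sh by auto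
qed

lemma sum_perms_partition:
  "(\<Sum>\<sigma>\<in>perms m. F \<sigma>) =
    (\<Sum>ab\<in>(\<lambda>\<sigma>. (filter P \<sigma>, filter (\<lambda>x. \<not> P x) \<sigma>)) ` perms m. \<Sum>\<sigma>\<in>shuffles (fst ab) (snd ab). F \<sigma>)"
proof -
  let ?P = "\<lambda>\<sigma>. (filter P \<sigma>, filter (\<lambda>x. \<not> P x) \<sigma>)"
  have "(\<Sum>\<sigma>\<in>perms m. F \<sigma>) = (\<Sum>ab\<in>?P ` perms m. sum F {\<sigma> \<in> perms m. ?P \<sigma> = ab})"
    by (rule sum.image_gen) simp
  also have "\<dots> = (\<Sum>ab\<in>?P ` perms m. \<Sum>\<sigma>\<in>shuffles (fst ab) (snd ab). F \<sigma>)"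
    by (rule sum.cong) (auto simp: partition_fiber[simplified])
  finally show ?thesis .
qed

text \<open>For a fixed label set \<open>B\<close> the indicator is constant on every shuffle class,
  where the weights add up to a multiple of \<open>qbin q m (length a)\<close>. If the indicator is
  1, both subwords are nonempty, so this Gaussian binomial vanishes.\<close>

lemma sum_perms_maj_shc:
  assumes q: "primitive_root m q" and "u \<noteq> []" "v \<noteq> []"
  shows "(\<Sum>\<sigma>\<in>perms m. q ^ maj \<sigma> * shc u v (map f \<sigma>)) = 0"
proof -
  have "(\<Sum>\<sigma>\<in>perms m. q ^ maj \<sigma> *
      of_bool (map f (filter (\<lambda>a. a \<in> B) \<sigma>) = u \<and> map f (filter (\<lambda>a. a \<notin> B) \<sigma>) = v)) = 0" for B
    unfolding sum_perms_partition[of _ m "\<lambda>a. a \<in> B"]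
  proof (rule sum.neutral, rule ballI)
    fix ab assume "ab \<in> (\<lambda>\<sigma>. (filter (\<lambda>a. a \<in> B) \<sigma>, filter (\<lambda>a. a \<notin> B) \<sigma>)) ` perms m"
    then obtain \<sigma>0 where s0: "\<sigma>0 \<in> perms m"
      and ab: "ab = (filter (\<lambda>a. a \<in> B) \<sigma>0, filter (\<lambda>a. a \<notin> B) \<sigma>0)" by auto
    obtain a b where a: "a = filter (\<lambda>a. a \<in> B) \<sigma>0" and b: "b = filter (\<lambda>a. a \<notin> B) \<sigma>0" by auto
    have len: "length a + length b = m"
      using perms_length[OF s0] sum_length_filter_compl[of "\<lambda>a. a \<in> B" \<sigma>0] by (simp add: a b)
    have "(\<Sum>\<sigma>\<in>shuffles a b. q ^ maj \<sigma> *
        of_bool (map f (filter (\<lambda>a. a \<in> B) \<sigma>) = u \<and> map f (filter (\<lambda>a. a \<notin> B) \<sigma>) = v)) =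
        (\<Sum>\<sigma>\<in>shuffles a b. q ^ maj \<sigma> * of_bool (map f a = u \<and> map f b = v))"
    proof (rule sum.cong)
      fix \<sigma> assume "\<sigma> \<in> shuffles a b"
      then have "filter (\<lambda>a. a \<in> B) \<sigma> = a" "filter (\<lambda>a. a \<notin> B) \<sigma> = b"
        unfolding a b partition_fiber[OF s0, symmetric] by auto
      then show "q ^ maj \<sigma> * of_bool (map f (filter (\<lambda>a. a \<in> B) \<sigma>) = u \<and> map f (filter (\<lambda>a. a \<notin> B) \<sigma>) = v) =
          q ^ maj \<sigma> * of_bool (map f a = u \<and> map f b = v)" by simp
    qed simp
    also have "\<dots> = (\<Sum>\<sigma>\<in>shuffles a b. q ^ maj \<sigma>) * of_bool (map f a = u \<and> map f b = v)"
      by (simp add: sum_distrib_right)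
    also have "\<dots> = q ^ (maj a + maj b) * qbin q m (length a) * of_bool (map f a = u \<and> map f b = v)"
      using len by (subst sum_shuffles_maj) (auto simp: a b)
    also have "\<dots> = 0"
    proof (cases "map f a = u \<and> map f b = v")
      case True
      then have "0 < length a" "length a < m" using assms len by auto
      then show ?thesis using qbin_primitive_root[OF q] by simp
    qed simp
    finally show "(\<Sum>\<sigma>\<in>shuffles (fst ab) (snd ab). q ^ maj \<sigma> *
        of_bool (map f (filter (\<lambda>a. a \<in> B) \<sigma>) = u \<and> map f (filter (\<lambda>a. a \<notin> B) \<sigma>) = v)) = 0"
      by (simp add: ab a b)
  qed
  note * = this
  have "(\<Sum>\<sigma>\<in>perms m. q ^ maj \<sigma> * shc u v (map f \<sigma>)) =
      (\<Sum>\<sigma>\<in>perms m. \<Sum>B\<in>Pow {..<m}. q ^ maj \<sigma> *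
        of_bool (map f (filter (\<lambda>a. a \<in> B) \<sigma>) = u \<and> map f (filter (\<lambda>a. a \<notin> B) \<sigma>) = v))"
    by (rule sum.cong) (auto simp: perms_def shc_map_distinct sum_distrib_left)
  also have "\<dots> = 0"
    by (subst sum.swap) (simp only: * sum.neutral_const)
  finally show ?thesis .
qed

definition klyachko :: "nat \<Rightarrow> complex \<Rightarrow> 'a list \<Rightarrow> ('a list \<Rightarrow>\<^sub>0 complex)" where
  "klyachko m q w = scale (inverse (of_nat m)) (\<Sum>\<sigma>\<in>perms m. Poly_Mapping.single (map ((!) w) \<sigma>) (q ^ maj \<sigma>))"

lemma pair_klyachko:
  "pair f (klyachko m q w) = inverse (of_nat m) * (\<Sum>\<sigma>\<in>perms m. q ^ maj \<sigma> * f (map ((!) w) \<sigma>))"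
  by (simp add: klyachko_def pair_scale pair_sum)

lemma lookup_klyachko:
  "Poly_Mapping.lookup (klyachko m q w) v =
    inverse (of_nat m) * (\<Sum>\<sigma>\<in>perms m. q ^ maj \<sigma> * of_bool (map ((!) w) \<sigma> = v))"
  by (simp only: pair_delta[symmetric] pair_klyachko)

lemma keys_klyachko:
  assumes "w \<in> words A m"
  shows "Poly_Mapping.keys (klyachko m q w) \<subseteq> words A m"
proof
  fix v assume "v \<in> Poly_Mapping.keys (klyachko m q w)"
  then have "(\<Sum>\<sigma>\<in>perms m. q ^ maj \<sigma> * of_bool (map ((!) w) \<sigma> = v)) \<noteq> (0 :: complex)"
    by (auto simp: in_keys_iff lookup_klyachko)
  then obtain \<sigma> where \<sigma>: "\<sigma> \<in> perms m" "map ((!) w) \<sigma> = v"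
    by (auto elim!: sum.not_neutral_contains_not_neutral split: if_splits simp: of_bool_def)
  have "length v = m" using \<sigma> perms_length by auto
  moreover have "set v \<subseteq> A"
  proof -
    have "set \<sigma> = {..<length w}" using \<sigma>(1) assms by (simp add: perms_def words_def)
    then have "set v \<subseteq> set w" using \<sigma>(2) by (auto simp: set_conv_nth[of w])
    then show ?thesis using assms by (auto simp: words_def)
  qed
  ultimately show "v \<in> words A m" by (simp add: words_def)
qed

lemma klyachko_primitive:
  assumes "primitive_root m q"
  shows "primitive_elt (klyachko m q w)"
  unfolding primitive_elt_def
proof (intro conjI allI impI)
  have "map ((!) w) \<sigma> \<noteq> []" if "\<sigma> \<in> perms m" for \<sigma>
    using perms_length[OF that] assms by (auto simp: primitive_root_def)
  then show "Poly_Mapping.lookup (klyachko m q w) [] = 0"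
    by (auto simp: lookup_klyachko intro!: sum.neutral)
  show "pair (shc u v) (klyachko m q w) = 0" if "u \<noteq> []" "v \<noteq> []" for u v
    by (simp add: pair_klyachko sum_perms_maj_shc[OF assms that])
qed

text \<open>\<open>shuffles\<close> yields a set and cannot count repetitions. On disjoint alphabets
  different interleavings are different words, so relabelling by \<open>f\<close> only afterwards
  recovers the multiplicities.\<close>

lemma shc_map_eq_sum_shuffles:
  "set a \<inter> set b = {} \<Longrightarrow> shc (map f a) (map f b) x = (\<Sum>\<tau>\<in>shuffles a b. of_bool (x = map f \<tau>))"
proof (induction x arbitrary: a b)
  case Nil
  have "(\<Sum>\<tau>\<in>shuffles a b. of_bool ([] = map f \<tau>) :: complex) = (\<Sum>\<tau>\<in>shuffles a b. if \<tau> = [] then 1 else 0)"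
    by (rule sum.cong) auto
  then show ?case by simp
next
  case (Cons c x)
  consider "a = []" | "b = []" | a1 a2 b1 b2 where "a = a1 # a2" "b = b1 # b2"
    by (metis neq_Nil_conv)
  then show ?case
  proof cases
    case 1 then show ?thesis by (simp add: shc_Nil_left del: shc.simps)
  next
    case 2 then show ?thesis by (simp add: shc_Nil_right del: shc.simps)
  next
    case 3
    have ne: "a1 \<noteq> b1" using Cons.prems 3 by auto
    have "(\<Sum>\<tau>\<in>shuffles a b. of_bool (c # x = map f \<tau>) :: complex) =
        (\<Sum>\<tau>\<in>shuffles a2 b. of_bool (c # x = f a1 # map f \<tau>)) + (\<Sum>\<tau>\<in>shuffles a b2. of_bool (c # x = f b1 # map f \<tau>))"
      unfolding 3 sum_shuffles_Cons_Cons[OF ne] by (simp only: list.map)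
    also have "(\<Sum>\<tau>\<in>shuffles a2 b. of_bool (c # x = f a1 # map f \<tau>) :: complex) =
        (if f a1 = c then shc (map f a2) (map f b) x else 0)"
      using Cons.IH[of a2 b] Cons.prems 3 by (auto simp: of_bool_def)
    also have "(\<Sum>\<tau>\<in>shuffles a b2. of_bool (c # x = f b1 # map f \<tau>) :: complex) =
        (if f b1 = c then shc (map f a) (map f b2) x else 0)"
      using Cons.IH[of a b2] Cons.prems 3 by (auto simp: of_bool_def)
    finally show ?thesis by (simp add: 3)
  qed
qed

lemma sum_shuffles_lookup:
  assumes "set a \<inter> set b = {}"
  shows "(\<Sum>\<tau>\<in>shuffles a b. Poly_Mapping.lookup p (map f \<tau>)) = pair (shc (map f a) (map f b)) p"
proof -
  have "shc (map f a) (map f b) = (\<lambda>x. \<Sum>\<tau>\<in>shuffles a b. of_bool (x = map f \<tau>))"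
    using shc_map_eq_sum_shuffles[OF assms] by blast
  then show ?thesis by (simp only: pair_fun_sum pair_delta)
qed

section \<open>Inverse descents, and the idempotent on primitive elements\<close>

definition perm_inv :: "nat \<Rightarrow> nat list \<Rightarrow> nat list" where
  "perm_inv m \<tau> = map (inv_into {..<m} ((!) \<tau>)) [0..<m]"

lemma perms_bij: "\<tau> \<in> perms m \<Longrightarrow> bij_betw ((!) \<tau>) {..<m} {..<m}"
  using perms_length[of \<tau> m] by (intro bij_betw_nth) (auto simp: perms_def)

lemma perm_inv_nth: "i < m \<Longrightarrow> perm_inv m \<tau> ! i = inv_into {..<m} ((!) \<tau>) i"
  by (simp add: perm_inv_def)

lemma nth_perm_inv:
  assumes "\<tau> \<in> perms m" "i < m"
  shows "\<tau> ! (perm_inv m \<tau> ! i) = i" "perm_inv m \<tau> ! (\<tau> ! i) = i" "perm_inv m \<tau> ! i < m"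
proof -
  note b = perms_bij[OF assms(1)]
  show "\<tau> ! (perm_inv m \<tau> ! i) = i"
    using b assms(2) by (simp add: perm_inv_nth bij_betw_inv_into_right)
  show "perm_inv m \<tau> ! (\<tau> ! i) = i"
    using b assms perms_nth_less[OF assms] by (simp add: perm_inv_nth bij_betw_inv_into_left)
  show "perm_inv m \<tau> ! i < m"
    using bij_betw_apply[OF bij_betw_inv_into[OF b], of i] assms(2) by (simp add: perm_inv_nth)
qed

lemma length_perm_inv [simp]: "length (perm_inv m \<tau>) = m"
  by (simp add: perm_inv_def)

lemma perm_inv_in_perms:
  assumes "\<tau> \<in> perms m"
  shows "perm_inv m \<tau> \<in> perms m"
proof -
  have "bij_betw (inv_into {..<m} ((!) \<tau>)) {..<m} {..<m}"
    by (rule bij_betw_inv_into[OF perms_bij[OF assms]])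
  then show ?thesis
    by (auto simp: perms_def perm_inv_def distinct_map bij_betw_def atLeast0LessThan)
qed

lemma perm_inv_perm_inv:
  assumes "\<tau> \<in> perms m"
  shows "perm_inv m (perm_inv m \<tau>) = \<tau>"
proof (rule nth_equalityI)
  fix i assume "i < length (perm_inv m (perm_inv m \<tau>))"
  then have i: "i < m" by simp
  have "perm_inv m \<tau> ! (perm_inv m (perm_inv m \<tau>) ! i) = i"
    using nth_perm_inv(1)[OF perm_inv_in_perms[OF assms] i] .
  moreover have "perm_inv m (perm_inv m \<tau>) ! i < m"
    using nth_perm_inv(3)[OF perm_inv_in_perms[OF assms] i] .
  ultimately show "perm_inv m (perm_inv m \<tau>) ! i = \<tau> ! i"
    using nth_perm_inv(1)[OF assms, of "perm_inv m (perm_inv m \<tau>) ! i"] by simp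
qed (simp add: perms_length[OF assms])

lemma map_nth_eq_iff_perm_inv:
  assumes "\<sigma> \<in> perms m" "length x = m" "length v = m"
  shows "map ((!) x) \<sigma> = v \<longleftrightarrow> x = map ((!) v) (perm_inv m \<sigma>)"
proof
  assume v: "map ((!) x) \<sigma> = v"
  show "x = map ((!) v) (perm_inv m \<sigma>)"
  proof (rule nth_equalityI)
    fix i assume "i < length x"
    then have i: "i < m" using assms by simp
    then show "x ! i = map ((!) v) (perm_inv m \<sigma>) ! i"
      using nth_perm_inv[OF assms(1) i] perms_length[OF assms(1)] by (simp flip: v)
  qed (simp add: assms)
next
  assume x: "x = map ((!) v) (perm_inv m \<sigma>)"
  show "map ((!) x) \<sigma> = v"
  proof (rule nth_equalityI)
    fix i assume "i < length (map ((!) x) \<sigma>)"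
    then have i: "i < m" using perms_length[OF assms(1)] by simp
    then show "map ((!) x) \<sigma> ! i = v ! i"
      using nth_perm_inv[OF assms(1) i] perms_length[OF assms(1)] perms_nth_less[OF assms(1) i] by (simp add: x)
  qed (simp add: assms perms_length[OF assms(1)])
qed

text \<open>The descents of the inverse permutation: \<open>i\<close> stands to the left of
  \<open>i - 1\<close>. Stated through a subsequence, this visibly does not depend on how the
  remaining letters are shuffled in.\<close>

definition ides :: "nat \<Rightarrow> nat list \<Rightarrow> nat set" where
  "ides m \<tau> = {i. 0 < i \<and> i < m \<and> filter (\<lambda>x. x = i \<or> x = i - 1) \<tau> = [i, i - 1]}"

lemma filter_eq_single: "distinct xs \<Longrightarrow> a \<in> set xs \<Longrightarrow> filter (\<lambda>x. x = a) xs = [a]"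
  by (induction xs) (auto simp: filter_empty_conv)

lemma filter_two:
  "distinct \<tau> \<Longrightarrow> a < b \<Longrightarrow> b < length \<tau> \<Longrightarrow> filter (\<lambda>x. x = \<tau> ! a \<or> x = \<tau> ! b) \<tau> = [\<tau> ! a, \<tau> ! b]"
proof (induction \<tau> arbitrary: a b)
  case (Cons c \<tau>)
  obtain b' where b: "b = Suc b'" using Cons.prems by (cases b) auto
  show ?case
  proof (cases a)
    case 0
    have "filter (\<lambda>x. x = c \<or> x = \<tau> ! b') \<tau> = filter (\<lambda>x. x = \<tau> ! b') \<tau>"
      using Cons.prems by (intro filter_cong) auto
    also have "\<dots> = [\<tau> ! b']"
      using Cons.prems b by (simp add: filter_eq_single)
    finally show ?thesis using 0 b by simp
  next
    case (Suc a')
    moreover have "c \<noteq> \<tau> ! a'" "c \<noteq> \<tau> ! b'"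
      using Cons.prems Suc b by (auto simp: set_conv_nth)
    ultimately show ?thesis using Cons b by simp
  qed
qed simp

lemma wdes_perm_inv:
  assumes \<tau>: "\<tau> \<in> perms m"
  shows "wdes (perm_inv m \<tau>) = ides m \<tau>"
proof -
  have d: "distinct \<tau>" using \<tau> by (simp add: perms_def)
  have "perm_inv m \<tau> ! i < perm_inv m \<tau> ! (i - 1) \<longleftrightarrow> filter (\<lambda>x. x = i \<or> x = i - 1) \<tau> = [i, i - 1]"
    if i: "0 < i" "i < m" for i
  proof -
    let ?a = "perm_inv m \<tau> ! i" and ?b = "perm_inv m \<tau> ! (i - 1)"
    have i1: "i - 1 < m" using i by simp
    note A = nth_perm_inv[OF \<tau> i(2)] and B = nth_perm_inv[OF \<tau> i1]
    have ne: "?a \<noteq> ?b" using A(1) B(1) i by (metis Suc_pred' n_not_Suc_n)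
    show ?thesis
    proof (cases "?a < ?b")
      case True
      then show ?thesis using filter_two[OF d True] A B perms_length[OF \<tau>] by simp
    next
      case False
      then have "?b < ?a" using ne by simp
      then have "filter (\<lambda>x. x = i - 1 \<or> x = i) \<tau> = [i - 1, i]"
        using filter_two[OF d, of ?b ?a] A B perms_length[OF \<tau>] by simp
      moreover have "(\<lambda>x. x = i - 1 \<or> x = i) = (\<lambda>x. x = i \<or> x = i - 1)" by auto
      ultimately show ?thesis using False i by auto
    qed
  qed
  then show ?thesis by (auto simp: wdes_def ides_def)
qed

text \<open>
  Summing over all ways to interleave the values below \<open>k\<close> with the remaining ones produces a
  proper shuffle, against which a primitive element vanishes.
\<close>

lemma sum_perms_ides_primitive:
  assumes p: "primitive_elt p" and k: "0 < k" "k < m" and G: "\<And>S. G S = G (S - {k})"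
  shows "(\<Sum>\<tau>\<in>perms m. G (ides m \<tau>) * Poly_Mapping.lookup p (map f \<tau>)) = 0"
  unfolding sum_perms_partition[of _ m "\<lambda>x. x < k"]
proof (rule sum.neutral, rule ballI)
  fix ab assume "ab \<in> (\<lambda>\<sigma>. (filter (\<lambda>x. x < k) \<sigma>, filter (\<lambda>x. \<not> x < k) \<sigma>)) ` perms m"
  then obtain \<sigma>0 where s0: "\<sigma>0 \<in> perms m"
    and ab: "ab = (filter (\<lambda>x. x < k) \<sigma>0, filter (\<lambda>x. \<not> x < k) \<sigma>0)" by auto
  obtain a b where a: "a = filter (\<lambda>x. x < k) \<sigma>0" and b: "b = filter (\<lambda>x. \<not> x < k) \<sigma>0" by auto
  \<comment> \<open>An inverse descent \<open>i\<close> other than \<open>k\<close> compares two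
    values on the same side of the cut at \<open>k\<close>, so it is common to all shuffles of
    \<open>a\<close> and \<open>b\<close>.\<close>
  define H where "H = {i. 0 < i \<and> i < m \<and> i \<noteq> k \<and>
    filter (\<lambda>x. x = i \<or> x = i - 1) (if i < k then a else b) = [i, i - 1]}"
  have ne: "a \<noteq> []" "b \<noteq> []"
  proof -
    have "0 \<in> set a" "k \<in> set b" using s0 k by (auto simp: a b perms_def)
    then show "a \<noteq> []" "b \<noteq> []" by auto
  qed
  have H: "ides m \<sigma> - {k} = H" if "\<sigma> \<in> shuffles a b" for \<sigma>
  proof -
    have f: "filter (\<lambda>x. x < k) \<sigma> = a" "filter (\<lambda>x. \<not> x < k) \<sigma> = b"
      using that unfolding a b partition_fiber[OF s0, symmetric] by auto
    have "filter (\<lambda>x. x = i \<or> x = i - 1) \<sigma> = filter (\<lambda>x. x = i \<or> x = i - 1) (if i < k then a else b)"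
      if "0 < i" "i \<noteq> k" for i
      unfolding f[symmetric] using that by (auto intro!: filter_cong)
    then show ?thesis unfolding ides_def H_def by auto
  qed
  have "(\<Sum>\<tau>\<in>shuffles a b. G (ides m \<tau>) * Poly_Mapping.lookup p (map f \<tau>)) =
      (\<Sum>\<tau>\<in>shuffles a b. G H * Poly_Mapping.lookup p (map f \<tau>))"
  proof (rule sum.cong)
    fix \<tau> assume "\<tau> \<in> shuffles a b"
    then have "G (ides m \<tau>) = G H" using G[of "ides m \<tau>"] H by simp
    then show "G (ides m \<tau>) * Poly_Mapping.lookup p (map f \<tau>) = G H * Poly_Mapping.lookup p (map f \<tau>)" by simp
  qed simp
  also have "\<dots> = G H * pair (shc (map f a) (map f b)) p"
    by (subst sum_shuffles_lookup[symmetric]) (auto simp: a b sum_distrib_left)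
  also have "\<dots> = 0" using p ne by (simp add: primitive_elt_def)
  finally show "(\<Sum>\<sigma>\<in>shuffles (fst ab) (snd ab). G (ides m \<sigma>) * Poly_Mapping.lookup p (map f \<sigma>)) = 0"
    by (simp add: ab a b)
qed

text \<open>The polynomial \<open>1 + z + ... + z ^ (m - 1)\<close> is the product of the
  \<open>z - q ^ j\<close>, and both are evaluated at 1. They agree because they have the same
  leading coefficient and coincide at \<open>m - 1\<close> points.\<close>

lemma prod_one_minus_roots:
  assumes q: "primitive_root m q"
  shows "(\<Prod>j\<in>{1..<m}. 1 - q ^ j) = of_nat m"
proof -
  have m: "0 < m" "q ^ m = 1" using q by (auto simp: primitive_root_def)
  define A where "A = (\<Sum>i<m. monom (1::complex) i)"
  define B where "B = (\<Prod>j\<in>{1..<m}. [:- (q ^ j), 1:])"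
  have degB: "degree B = m - 1" unfolding B_def by (subst degree_prod_eq_sum_degree) auto
  have "lead_coeff B = 1" unfolding B_def by (simp add: lead_coeff_prod)
  then have cB: "poly.coeff B (m - 1) = 1" by (simp add: degB)
  have cA: "poly.coeff A (m - 1) = 1"
    using m by (simp add: A_def coeff_sum)
  have degA: "degree A \<le> m - 1"
    unfolding A_def by (intro degree_sum_le) (auto simp: degree_monom_eq)
  have q0: "q \<noteq> 0" using m by (auto simp: power_0_left)
  have inj: "inj_on (\<lambda>j. q ^ j) {1..<m}"
  proof (rule linorder_inj_onI)
    fix i j assume ij: "i < j" "i \<in> {1..<m}" "j \<in> {1..<m}"
    show "q ^ i \<noteq> q ^ j"
    proof
      assume "q ^ i = q ^ j"
      moreover have "q ^ i * q ^ (j - i) = q ^ j" using ij by (simp flip: power_add)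
      ultimately have "q ^ (j - i) = 1" using q0 by simp
      then show False using q ij by (auto simp: primitive_root_def)
    qed
  qed auto
  have "A = B"
  proof (rule poly_eqI_degree_lead_coeff[where A = "(\<lambda>j. q ^ j) ` {1..<m}" and n = "m - 1"])
    fix z assume "z \<in> (\<lambda>j. q ^ j) ` {1..<m}"
    then obtain j where j: "z = q ^ j" "j \<in> {1..<m}" by auto
    have "z \<noteq> 1" using j q by (auto simp: primitive_root_def)
    moreover have "z ^ m = 1" using j m by (metis mult.commute power_mult power_one)
    ultimately have "poly A z = 0" by (simp add: A_def poly_sum poly_monom geometric_sum)
    moreover have "poly B z = 0" using j by (auto simp: B_def poly_prod)
    ultimately show "poly A z = poly B z" by simp
  qed (use inj degA degB cA cB in \<open>auto simp: card_image\<close>)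
  then have "poly A 1 = poly B 1" by simp
  then show ?thesis by (simp add: A_def B_def poly_sum poly_prod poly_monom)
qed

lemma ides_eq_empty_iff:
  assumes "\<tau> \<in> perms m"
  shows "ides m \<tau> = {} \<longleftrightarrow> \<tau> = [0..<m]"
proof
  have upt: "[0..<m] \<in> perms m" by (auto simp: perms_def)
  have id: "perm_inv m [0..<m] = [0..<m]"
  proof (rule nth_equalityI)
    fix i assume "i < length (perm_inv m [0..<m])"
    then have "i < m" by simp
    then show "perm_inv m [0..<m] ! i = [0..<m] ! i"
      using nth_perm_inv(1,3)[OF upt, of i] by simp
  qed simp
  { assume e: "ides m \<tau> = {}"
    let ?s = "perm_inv m \<tau>"
    have s: "?s \<in> perms m" by (rule perm_inv_in_perms[OF assms])
    have "?s ! i < ?s ! Suc i" if "Suc i < m" for i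
    proof -
      have "Suc i \<notin> wdes ?s" using e wdes_perm_inv[OF assms] by simp
      then have "?s ! i \<le> ?s ! Suc i" using that by (simp add: wdes_def)
      then show ?thesis using perms_nth_eq_iff[OF s, of i "Suc i"] that by (simp add: le_less)
    qed
    then have "sorted_wrt (<) ?s"
      by (subst sorted_wrt_iff_nth_Suc_transp) (auto simp: transp_on_def)
    moreover have "set ?s = {..<m}" using s by (simp add: perms_def)
    ultimately have "?s = [0..<m]"
      by (metis atLeast0LessThan set_upt sorted_wrt_upt strict_sorted_equal)
    then show "\<tau> = [0..<m]" using perm_inv_perm_inv[OF assms] id by simp }
  { assume "\<tau> = [0..<m]"
    then have "ides m \<tau> = wdes [0..<m]" using wdes_perm_inv[OF assms] id by simp
    also have "\<dots> = {}" by (auto simp: wdes_def)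
    finally show "ides m \<tau> = {}" . }
qed

text \<open>The weight is a product over positions \<open>j\<close> with factor \<open>q ^ j\<close>
  at inverse descents and 1 elsewhere. By \<open>sum_perms_ides_primitive\<close>, subtracting the
  constant \<open>q ^ j\<close> from the factor at \<open>j\<close> changes nothing; the factor
  becomes 0 at inverse descents and \<open>1 - q ^ j\<close> elsewhere. After all positions only the
  identity is left, with weight \<open>m\<close>.\<close>

lemma sum_perms_maj_primitive:
  assumes q: "primitive_root m q" and p: "primitive_elt p"
  shows "(\<Sum>\<tau>\<in>perms m. q ^ (\<Sum>(ides m \<tau>)) * Poly_Mapping.lookup p (map f \<tau>)) =
    of_nat m * Poly_Mapping.lookup p (map f [0..<m])"
proof -
  \<comment> \<open>The factor at \<open>j\<close> once the positions up to \<open>J\<close> have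
    been treated; \<open>G 0\<close> is the original weight and \<open>G (m - 1)\<close> the final
    one.\<close>
  define g where "g J S j = (if j \<le> J then (1 - q ^ j) * of_bool (j \<notin> S) else if j \<in> S then q ^ j else 1)"
    for J :: nat and S :: "nat set" and j
  define G where "G J S = (\<Prod>j\<in>{1..<m}. g J S j)" for J S
  define \<Phi> where "\<Phi> G = (\<Sum>\<tau>\<in>perms m. G (ides m \<tau>) * Poly_Mapping.lookup p (map f \<tau>))" for G
  have step: "\<Phi> (G (Suc J)) = \<Phi> (G J)" if J: "Suc J < m" for J
  proof -
    define R where "R S = q ^ Suc J * (\<Prod>j\<in>{1..<m} - {Suc J}. g J S j)" for S
    have k: "Suc J \<in> {1..<m}" using J by simp
    have "G J S = G (Suc J) S + R S" for S
    proof -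
      have e: "(\<Prod>j\<in>{1..<m} - {Suc J}. g (Suc J) S j) = (\<Prod>j\<in>{1..<m} - {Suc J}. g J S j)"
        by (rule prod.cong) (auto simp: g_def)
      have "G J S = g J S (Suc J) * (\<Prod>j\<in>{1..<m} - {Suc J}. g J S j)"
        unfolding G_def by (rule prod.remove[OF _ k]) simp
      moreover have "G (Suc J) S = g (Suc J) S (Suc J) * (\<Prod>j\<in>{1..<m} - {Suc J}. g J S j)"
        unfolding G_def e[symmetric] by (rule prod.remove[OF _ k]) simp
      moreover have "g J S (Suc J) = g (Suc J) S (Suc J) + q ^ Suc J" by (auto simp: g_def)
      ultimately show ?thesis by (simp add: R_def distrib_right del: power_Suc)
    qed
    then have "\<Phi> (G J) = \<Phi> (G (Suc J)) + \<Phi> R"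
      by (simp add: \<Phi>_def distrib_right sum.distrib)
    moreover have "\<Phi> R = 0"
      unfolding \<Phi>_def
    proof (rule sum_perms_ides_primitive[OF p, of "Suc J"])
      show "R S = R (S - {Suc J})" for S
        unfolding R_def by (intro arg_cong[where f = "\<lambda>z. q ^ Suc J * z"] prod.cong) (auto simp: g_def)
    qed (use J in auto)
    ultimately show ?thesis by simp
  qed
  have m: "0 < m" using q by (simp add: primitive_root_def)
  have all: "\<Phi> (G J) = \<Phi> (G 0)" if "J < m" for J
    using that by (induction J) (auto simp: step)
  have "G 0 (ides m \<tau>) = q ^ (\<Sum>(ides m \<tau>))" for \<tau>
  proof -
    have i: "ides m \<tau> \<subseteq> {1..<m}" by (auto simp: ides_def)
    have "G 0 (ides m \<tau>) = (\<Prod>j\<in>{1..<m}. if j \<in> ides m \<tau> then q ^ j else 1)"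
      unfolding G_def by (rule prod.cong) (auto simp: g_def)
    also have "\<dots> = (\<Prod>j\<in>{1..<m} \<inter> ides m \<tau>. q ^ j)" by (simp add: prod.inter_restrict)
    also have "{1..<m} \<inter> ides m \<tau> = ides m \<tau>" using i by auto
    finally show ?thesis by (simp add: power_sum)
  qed
  then have "(\<Sum>\<tau>\<in>perms m. q ^ (\<Sum>(ides m \<tau>)) * Poly_Mapping.lookup p (map f \<tau>)) = \<Phi> (G 0)"
    by (simp add: \<Phi>_def)
  also have "\<dots> = \<Phi> (G (m - 1))" using all[of "m - 1"] m by simp
  also have "\<dots> = (\<Sum>\<tau>\<in>perms m. if \<tau> = [0..<m] then of_nat m * Poly_Mapping.lookup p (map f \<tau>) else 0)"
    unfolding \<Phi>_def
  proof (rule sum.cong)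
    fix \<tau> assume \<tau>: "\<tau> \<in> perms m"
    have "G (m - 1) (ides m \<tau>) = (\<Prod>j\<in>{1..<m}. 1 - q ^ j) * (\<Prod>j\<in>{1..<m}. of_bool (j \<notin> ides m \<tau>))"
      unfolding G_def prod.distrib[symmetric] by (rule prod.cong) (auto simp: g_def)
    also have "(\<Prod>j\<in>{1..<m}. of_bool (j \<notin> ides m \<tau>) :: complex) = of_bool (ides m \<tau> = {})"
    proof (cases "ides m \<tau> = {}")
      case False
      then obtain j where "j \<in> ides m \<tau>" by auto
      moreover from this have "j \<in> {1..<m}" by (auto simp: ides_def)
      ultimately have "(\<Prod>j\<in>{1..<m}. of_bool (j \<notin> ides m \<tau>) :: complex) = 0"
        by (intro prod_zero) (auto intro!: bexI[of _ j])
      then show ?thesis using False by simp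
    qed simp
    finally have "G (m - 1) (ides m \<tau>) = of_nat m * of_bool (\<tau> = [0..<m])"
      using prod_one_minus_roots[OF q] ides_eq_empty_iff[OF \<tau>] by simp
    then show "G (m - 1) (ides m \<tau>) * Poly_Mapping.lookup p (map f \<tau>) =
        (if \<tau> = [0..<m] then of_nat m * Poly_Mapping.lookup p (map f \<tau>) else 0)" by simp
  qed simp
  also have "\<dots> = of_nat m * Poly_Mapping.lookup p (map f [0..<m])"
  proof -
    have "[0..<m] \<in> perms m" by (auto simp: perms_def)
    then show ?thesis by simp
  qed
  finally show ?thesis .
qed

text \<open>In the coefficient of \<open>v\<close> the permutation has to be moved from the words of
  \<open>p\<close> to \<open>v\<close>, which inverts it; major indices become sums of inverse
  descents.\<close>

lemma klyachko_fixes_primitive: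
  assumes q: "primitive_root m q" and p: "primitive_elt p"
    and deg: "\<And>x. x \<in> Poly_Mapping.keys p \<Longrightarrow> length x = m"
  shows "linear_ext (klyachko m q) p = p"
proof (rule poly_mapping_eqI)
  fix v
  have m: "0 < m" using q by (simp add: primitive_root_def)
  have "Poly_Mapping.lookup (linear_ext (klyachko m q) p) v =
      inverse (of_nat m) * (\<Sum>\<sigma>\<in>perms m. q ^ maj \<sigma> * pair (\<lambda>x. of_bool (map ((!) x) \<sigma> = v)) p)"
    by (simp only: lookup_linear_ext lookup_klyachko pair_fun_sum pair_fun_mult_left)
  also have "(\<Sum>\<sigma>\<in>perms m. q ^ maj \<sigma> * pair (\<lambda>x. of_bool (map ((!) x) \<sigma> = v)) p) =
      of_nat m * Poly_Mapping.lookup p v"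
  proof (cases "length v = m")
    case True
    have "(\<Sum>\<sigma>\<in>perms m. q ^ maj \<sigma> * pair (\<lambda>x. of_bool (map ((!) x) \<sigma> = v)) p) =
        (\<Sum>\<sigma>\<in>perms m. q ^ maj \<sigma> * Poly_Mapping.lookup p (map ((!) v) (perm_inv m \<sigma>)))"
    proof (rule sum.cong)
      fix \<sigma> assume \<sigma>: "\<sigma> \<in> perms m"
      have "pair (\<lambda>x. of_bool (map ((!) x) \<sigma> = v)) p = pair (\<lambda>x. of_bool (x = map ((!) v) (perm_inv m \<sigma>))) p"
        by (rule pair_cong) (use map_nth_eq_iff_perm_inv[OF \<sigma> _ True] deg in simp)
      then show "q ^ maj \<sigma> * pair (\<lambda>x. of_bool (map ((!) x) \<sigma> = v)) p =
          q ^ maj \<sigma> * Poly_Mapping.lookup p (map ((!) v) (perm_inv m \<sigma>))" by (simp add: pair_delta)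
    qed simp
    also have "\<dots> = (\<Sum>\<tau>\<in>perms m. q ^ (\<Sum>(ides m \<tau>)) * Poly_Mapping.lookup p (map ((!) v) \<tau>))"
      by (rule sum.reindex_bij_witness[of _ "perm_inv m" "perm_inv m"])
         (auto simp: perm_inv_perm_inv perm_inv_in_perms maj_def simp flip: wdes_perm_inv)
    also have "\<dots> = of_nat m * Poly_Mapping.lookup p v"
      using sum_perms_maj_primitive[OF q p, of "(!) v"] True map_nth[of v] by simp
    finally show ?thesis .
  next
    case False
    have "pair (\<lambda>x. of_bool (map ((!) x) \<sigma> = v)) p = 0" if "\<sigma> \<in> perms m" for \<sigma>
    proof -
      have "map ((!) x) \<sigma> \<noteq> v" for x using perms_length[OF that] False by auto
      then show ?thesis by (simp add: pair_def)
    qed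
    moreover have "Poly_Mapping.lookup p v = 0" using deg[of v] False by (auto simp: in_keys_iff)
    ultimately show ?thesis by simp
  qed
  finally show "Poly_Mapping.lookup (linear_ext (klyachko m q) p) v = Poly_Mapping.lookup p v"
    using m by simp
qed

section \<open>Traces via projections\<close>

text \<open>
  In \<open>proj_data X W \<pi> h\<close> the linear extension of \<open>\<pi>\<close> is a projection of the span of \<open>X\<close> onto \<open>W\<close>, and that
  of \<open>h\<close> is the endomorphism of \<open>W\<close> whose trace is sought.
\<close>

definition proj_data ::
    "'a set \<Rightarrow> ('a \<Rightarrow>\<^sub>0 complex) set \<Rightarrow> ('a \<Rightarrow> ('a \<Rightarrow>\<^sub>0 complex)) \<Rightarrow> ('a \<Rightarrow> ('a \<Rightarrow>\<^sub>0 complex)) \<Rightarrow> bool" where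
  "proj_data X W \<pi> h \<longleftrightarrow> finite X \<and> pm.subspace W \<and> (\<forall>x\<in>X. \<pi> x \<in> W) \<and>
     (\<forall>w\<in>W. Poly_Mapping.keys w \<subseteq> X \<and> linear_ext \<pi> w = w \<and> linear_ext h w \<in> W)"

definition proj_trace :: "'a set \<Rightarrow> ('a \<Rightarrow> ('a \<Rightarrow>\<^sub>0 complex)) \<Rightarrow> ('a \<Rightarrow> ('a \<Rightarrow>\<^sub>0 complex)) \<Rightarrow> complex" where
  "proj_trace X \<pi> h = (\<Sum>x\<in>X. Poly_Mapping.lookup (linear_ext h (\<pi> x)) x)"

lemma scale_single_1: "scale c (Poly_Mapping.single x 1) = Poly_Mapping.single x c"
  by (simp add: scale_single)

lemma in_span_singles:
  assumes "Poly_Mapping.keys w \<subseteq> X"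
  shows "w \<in> pm.span ((\<lambda>x. Poly_Mapping.single x 1) ` X)"
proof -
  have "(\<Sum>x\<in>Poly_Mapping.keys w. scale (Poly_Mapping.lookup w x) (Poly_Mapping.single x 1))
      \<in> pm.span ((\<lambda>x. Poly_Mapping.single x 1) ` X)"
    by (intro pm.span_sum pm.span_scale pm.span_base) (use assms in auto)
  also have "(\<Sum>x\<in>Poly_Mapping.keys w. scale (Poly_Mapping.lookup w x) (Poly_Mapping.single x 1)) = w"
    by (simp only: scale_single_1 sum_single_lookup[symmetric])
  finally show ?thesis .
qed

text \<open>
  The trace of an endomorphism of \<open>W\<close> is that of its composition with a projection onto \<open>W\<close>,
  computed in the coordinates of the ambient space.
\<close>

lemma trace_on_eq_proj_trace:
  assumes "proj_data X W \<pi> h"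
  shows "trace_on W (linear_ext h) = proj_trace X \<pi> h"
proof -
  have X: "finite X" and W: "pm.subspace W" and \<pi>: "\<And>x. x \<in> X \<Longrightarrow> \<pi> x \<in> W"
    and kW: "\<And>w. w \<in> W \<Longrightarrow> Poly_Mapping.keys w \<subseteq> X" and fixW: "\<And>w. w \<in> W \<Longrightarrow> linear_ext \<pi> w = w"
    and hW: "\<And>w. w \<in> W \<Longrightarrow> linear_ext h w \<in> W"
    using assms by (auto simp: proj_data_def)
  obtain B0 where B0: "B0 \<subseteq> W" "pm.independent B0" "W \<subseteq> pm.span B0"
    using pm.maximal_independent_subset by blast
  then have "pm.independent B0 \<and> pm.span B0 = W" using W by (simp add: pm.span_subspace)
  then have ex: "\<exists>B. pm.independent B \<and> pm.span B = W" by blast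
  define B where "B = (SOME B. pm.independent B \<and> pm.span B = W)"
  have B: "pm.independent B" "pm.span B = W" using someI_ex[OF ex] by (auto simp: B_def)
  have BW: "B \<subseteq> W" using B(2) pm.span_superset by blast
  have "B \<subseteq> pm.span ((\<lambda>x. Poly_Mapping.single x 1) ` X)"
    using BW by (intro subsetI in_span_singles kW) auto
  then have fB: "finite B"
    using pm.independent_span_bound[OF finite_imageI[OF X] B(1)] by simp
  let ?R = "\<lambda>w b. pm.representation B w b"
  have R: "?R (linear_ext h b) b = (\<Sum>x\<in>X. Poly_Mapping.lookup (linear_ext h b) x * ?R (\<pi> x) b)"
    if b: "b \<in> B" for b
  proof -
    let ?w = "linear_ext h b"
    have w: "?w \<in> W" using hW BW b by auto
    \<comment> \<open>An element of \<open>W\<close> is its own projection, so it is a combination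
      of the \<open>\<pi> x\<close> with its ambient coordinates as coefficients.\<close>
    have "?w = (\<Sum>x\<in>X. scale (Poly_Mapping.lookup ?w x) (\<pi> x))"
      using fixW[OF w] kW[OF w] X unfolding linear_ext_def[of \<pi>]
      by (subst (asm) sum.mono_neutral_left[of X]) (auto simp: in_keys_iff)
    then have "?R ?w b = ?R (\<Sum>x\<in>X. scale (Poly_Mapping.lookup ?w x) (\<pi> x)) b" by simp
    also have "\<dots> = (\<Sum>x\<in>X. Poly_Mapping.lookup ?w x * ?R (\<pi> x) b)"
      using B \<pi> by (subst pm.representation_sum) (auto simp: pm.representation_scale pm.span_scale)
    finally show ?thesis .
  qed
  have "trace_on W (linear_ext h) = (\<Sum>b\<in>B. ?R (linear_ext h b) b)"
    unfolding trace_on_def Let_def B_def ..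
  also have "\<dots> = (\<Sum>b\<in>B. \<Sum>x\<in>X. Poly_Mapping.lookup (linear_ext h b) x * ?R (\<pi> x) b)"
    by (intro sum.cong refl R)
  also have "\<dots> = (\<Sum>x\<in>X. \<Sum>b\<in>B. Poly_Mapping.lookup (linear_ext h b) x * ?R (\<pi> x) b)"
    by (rule sum.swap)
  also have "\<dots> = (\<Sum>x\<in>X. Poly_Mapping.lookup (linear_ext h (\<pi> x)) x)"
  proof (rule sum.cong)
    fix x assume "x \<in> X"
    then have "(\<Sum>b\<in>B. scale (?R (\<pi> x) b) b) = \<pi> x"
      using pm.sum_representation_eq[OF B(1) _ fB subset_refl, of "\<pi> x"] \<pi> B(2) by simp
    then have "Poly_Mapping.lookup (linear_ext h (\<pi> x)) x =
        Poly_Mapping.lookup (linear_ext h (\<Sum>b\<in>B. scale (?R (\<pi> x) b) b)) x" by simp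
    also have "\<dots> = (\<Sum>b\<in>B. Poly_Mapping.lookup (linear_ext h b) x * ?R (\<pi> x) b)"
      by (simp only: linear_ext_sum linear_ext_scale lookup_sum lookup_scale mult.commute)
    finally show "(\<Sum>b\<in>B. Poly_Mapping.lookup (linear_ext h b) x * ?R (\<pi> x) b) =
        Poly_Mapping.lookup (linear_ext h (\<pi> x)) x" by simp
  qed simp
  finally show ?thesis by (simp add: proj_trace_def)
qed

section \<open>Projections and traces on tensor products\<close>

lemma linear_ext_mult:
  fixes F :: "'a::monoid_add \<Rightarrow> ('b::monoid_add \<Rightarrow>\<^sub>0 complex)"
  assumes "\<And>x y. x \<in> Poly_Mapping.keys p \<Longrightarrow> y \<in> Poly_Mapping.keys q \<Longrightarrow> F (x + y) = f x * g y"
  shows "linear_ext F (p * q) = linear_ext f p * linear_ext g q"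
proof -
  have scale_mult: "scale (c * d) (r * s) = scale c r * scale d s" for c d and r s :: "'b \<Rightarrow>\<^sub>0 complex"
    by (rule poly_mapping_eqI)
       (simp only: lookup_scale pair_delta[symmetric] pair_mult pair_scale pair_fun_mult_left mult.assoc mult.left_commute)
  have "linear_ext F (p * q) = linear_ext F ((\<Sum>x\<in>Poly_Mapping.keys p. Poly_Mapping.single x (Poly_Mapping.lookup p x)) *
      (\<Sum>y\<in>Poly_Mapping.keys q. Poly_Mapping.single y (Poly_Mapping.lookup q y)))"
    by (simp flip: sum_single_lookup)
  also have "\<dots> = (\<Sum>x\<in>Poly_Mapping.keys p. \<Sum>y\<in>Poly_Mapping.keys q.
      scale (Poly_Mapping.lookup p x * Poly_Mapping.lookup q y) (F (x + y)))"
    by (simp add: sum_product linear_ext_sum mult_single)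
  also have "\<dots> = (\<Sum>x\<in>Poly_Mapping.keys p. \<Sum>y\<in>Poly_Mapping.keys q.
      scale (Poly_Mapping.lookup p x) (f x) * scale (Poly_Mapping.lookup q y) (g y))"
    by (intro sum.cong refl) (simp add: assms scale_mult)
  also have "\<dots> = linear_ext f p * linear_ext g q"
    by (simp add: linear_ext_def sum_product)
  finally show ?thesis .
qed

lemma linear_ext_linear_ext: "linear_ext g (linear_ext f p) = linear_ext (\<lambda>a. linear_ext g (f a)) p"
  by (simp add: linear_ext_def[of f] linear_ext_sum linear_ext_scale) (simp add: linear_ext_def)

lemma keys_tens_of: "Poly_Mapping.keys (tens_of u) \<subseteq> (\<lambda>a. [a]) ` Poly_Mapping.keys u"
proof
  fix w assume "w \<in> Poly_Mapping.keys (tens_of u)"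
  then have "pair (\<lambda>a. Poly_Mapping.lookup (Poly_Mapping.single [a] (1::complex)) w) u \<noteq> 0"
    by (simp add: in_keys_iff tens_of_def lookup_linear_ext)
  then obtain a where "a \<in> Poly_Mapping.keys u" "Poly_Mapping.lookup (Poly_Mapping.single [a] (1::complex)) w \<noteq> 0"
    unfolding pair_def by (metis (no_types, lifting) mult_not_zero sum.not_neutral_contains_not_neutral)
  then show "w \<in> (\<lambda>a. [a]) ` Poly_Mapping.keys u" by (auto simp: lookup_single when_def split: if_splits)
qed

lemma lookup_tens_of_mult:
  "Poly_Mapping.lookup (tens_of u * r) v =
    (case v of [] \<Rightarrow> 0 | c # v' \<Rightarrow> Poly_Mapping.lookup u c * Poly_Mapping.lookup r v')"
proof -
  have "Poly_Mapping.lookup (tens_of u * r) v = pair (\<lambda>a. pair (\<lambda>y. of_bool (a # y = v)) r) u"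
    by (simp add: pair_delta[symmetric] pair_mult tens_of_def pair_linear_ext plus_list_def)
  also have "\<dots> = (case v of [] \<Rightarrow> 0 | c # v' \<Rightarrow> Poly_Mapping.lookup u c * Poly_Mapping.lookup r v')"
  proof (cases v)
    case (Cons c v')
    have "pair (\<lambda>y. of_bool (a # y = v)) r = of_bool (a = c) * Poly_Mapping.lookup r v'" for a
      using pair_delta[of v' r] Cons by (cases "a = c") (auto simp: pair_def of_bool_def)
    then show ?thesis using Cons by (simp only: pair_fun_mult_right pair_delta) simp
  qed (simp add: pair_def)
  finally show ?thesis .
qed

lemma linear_ext_tens_of_mult:
  assumes "\<And>a w. F (a # w) = f a * g w"
  shows "linear_ext F (tens_of u * r) = linear_ext f u * linear_ext g r"
proof -
  have "linear_ext F (tens_of u * r) = linear_ext (\<lambda>w. f (hd w)) (tens_of u) * linear_ext g r"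
    by (rule linear_ext_mult) (use keys_tens_of[of u] assms in \<open>auto simp: plus_list_def\<close>)
  also have "linear_ext (\<lambda>w. f (hd w)) (tens_of u) = linear_ext f u"
    by (simp add: tens_of_def linear_ext_linear_ext)
  finally show ?thesis .
qed

lemma tens_of_linear_ext: "tens_of (linear_ext f u) = linear_ext (\<lambda>a. tens_of (f a)) u"
  by (simp add: tens_of_def linear_ext_linear_ext)

lemma one_list_single: "(1 :: 'a list \<Rightarrow>\<^sub>0 complex) = Poly_Mapping.single [] 1"
  by (simp add: zero_list_def flip: single_one)

abbreviation tensor_word :: "('a \<Rightarrow>\<^sub>0 complex) list \<Rightarrow> ('a list \<Rightarrow>\<^sub>0 complex)" where
  "tensor_word us \<equiv> prod_list (map tens_of us)"

fun tensor_proj :: "('i \<Rightarrow> 'a \<Rightarrow> ('a \<Rightarrow>\<^sub>0 complex)) \<Rightarrow> 'i list \<Rightarrow> 'a list \<Rightarrow> ('a list \<Rightarrow>\<^sub>0 complex)" where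
  "tensor_proj \<pi> (i # is) (a # w) = tens_of (\<pi> i a) * tensor_proj \<pi> is w"
| "tensor_proj \<pi> is w = 1"

definition tensor_ext :: "('a \<Rightarrow> ('a \<Rightarrow>\<^sub>0 complex)) \<Rightarrow> 'a list \<Rightarrow> ('a list \<Rightarrow>\<^sub>0 complex)" where
  "tensor_ext h w = prod_list (map (\<lambda>a. tens_of (h a)) w)"

lemma tensor_ext_Cons: "tensor_ext h (a # w) = tens_of (h a) * tensor_ext h w"
  by (simp add: tensor_ext_def)

lemma linear_ext_tensor_ext: "linear_ext (tensor_ext h) (tensor_word us) = tensor_word (map (linear_ext h) us)"
proof (induction us)
  case Nil
  then show ?case by (simp add: one_list_single tensor_ext_def)
next
  case (Cons u us)
  have "linear_ext (tensor_ext h) (tens_of u * tensor_word us) =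
      linear_ext (\<lambda>a. tens_of (h a)) u * linear_ext (tensor_ext h) (tensor_word us)"
    by (rule linear_ext_tens_of_mult) (simp add: tensor_ext_Cons)
  then show ?case using Cons.IH by (simp add: tens_of_linear_ext)
qed

lemma finite_listset: "(\<And>A. A \<in> set As \<Longrightarrow> finite A) \<Longrightarrow> finite (listset As)"
proof (induction As)
  case (Cons A As)
  have "set_Cons A (listset As) = (\<lambda>(a, w). a # w) ` (A \<times> listset As)"
    by (auto simp: set_Cons_def)
  then show ?case using Cons by simp
qed simp

lemma sum_listset_Cons: "(\<Sum>w\<in>listset (A # As). f w) = (\<Sum>a\<in>A. \<Sum>w\<in>listset As. f (a # w))"
proof -
  have "listset (A # As) = (\<lambda>(a, w). a # w) ` (A \<times> listset As)"
    by (auto simp: set_Cons_def)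
  then show ?thesis
    by (simp add: sum.reindex inj_on_def case_prod_unfold sum.cartesian_product)
qed

lemma keys_tensor_word:
  "list_all2 (\<lambda>u A. Poly_Mapping.keys u \<subseteq> A) us As \<Longrightarrow> Poly_Mapping.keys (tensor_word us) \<subseteq> listset As"
proof (induction rule: list_all2_induct)
  case (Cons u us A As)
  show ?case
  proof
    fix v assume "v \<in> Poly_Mapping.keys (tensor_word (u # us))"
    then obtain c v' where "v = c # v'" "c \<in> Poly_Mapping.keys u" "v' \<in> Poly_Mapping.keys (tensor_word us)"
      by (cases v) (auto simp: in_keys_iff lookup_tens_of_mult)
    then show "v \<in> listset (A # As)" using Cons by (auto simp: set_Cons_def)
  qed
qed (simp add: one_list_single)

text \<open>Pure tensors have the required properties factor by factor, and the vectors with these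
  properties form a subspace, which therefore contains the span.\<close>

lemma proj_data_tensor_product:
  assumes "\<And>i. i \<in> set is \<Longrightarrow> proj_data (X i) (U i) (\<pi> i) h"
  shows "proj_data (listset (map X is)) (tensor_product (map U is)) (tensor_proj \<pi> is) (tensor_ext h)"
proof -
  let ?W = "tensor_product (map U is)" and ?Y = "listset (map X is)"
  let ?P = "{w. Poly_Mapping.keys w \<subseteq> ?Y \<and> linear_ext (tensor_proj \<pi> is) w = w \<and> linear_ext (tensor_ext h) w \<in> ?W}"
  have fin: "finite ?Y" using assms by (intro finite_listset) (auto simp: proj_data_def)
  have sub: "pm.subspace ?W" by (simp add: tensor_product_def pm.subspace_span)
  have gen: "tensor_word us \<in> ?P" if us: "list_all2 (\<in>) us (map U is)" for us
  proof -
    have us': "list_all2 (\<lambda>u i. u \<in> U i) us is" using us by (simp add: list_all2_map2)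
    have "list_all2 (\<lambda>u A. Poly_Mapping.keys u \<subseteq> A) us (map X is)"
      unfolding list_all2_map2 using us' assms
      by (auto simp: proj_data_def list_all2_conv_all_nth)
    then have 1: "Poly_Mapping.keys (tensor_word us) \<subseteq> ?Y" by (rule keys_tensor_word)
    have 2: "linear_ext (tensor_proj \<pi> is) (tensor_word us) = tensor_word us"
      using us' assms
    proof (induction rule: list_all2_induct)
      case Nil
      then show ?case by (simp add: one_list_single)
    next
      case (Cons u us i "is")
      have "linear_ext (tensor_proj \<pi> (i # is)) (tens_of u * tensor_word us) =
          linear_ext (\<lambda>a. tens_of (\<pi> i a)) u * linear_ext (tensor_proj \<pi> is) (tensor_word us)"
        by (rule linear_ext_tens_of_mult) simp
      also have "\<dots> = tens_of (linear_ext (\<pi> i) u) * tensor_word us"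
        using Cons by (simp add: tens_of_linear_ext)
      also have "linear_ext (\<pi> i) u = u" using Cons by (simp add: proj_data_def)
      finally show ?case by simp
    qed
    have "list_all2 (\<in>) (map (linear_ext h) us) (map U is)"
      using us' assms by (auto simp: proj_data_def list_all2_conv_all_nth)
    then have 3: "linear_ext (tensor_ext h) (tensor_word us) \<in> ?W"
      unfolding linear_ext_tensor_ext tensor_product_def by (intro pm.span_base) blast
    show ?thesis using 1 2 3 by simp
  qed
  have "pm.subspace ?P"
    by (rule pm.subspaceI)
       (use sub keys_add keys_scale_subset in \<open>auto simp: linear_ext_add linear_ext_scale pm.subspace_0
          pm.subspace_add pm.subspace_scale dest!: subsetD[OF keys_add] subsetD[OF keys_scale_subset]\<close>)
  then have WP: "?W \<subseteq> ?P"
    unfolding tensor_product_def using gen by (intro pm.span_minimal) (auto simp: tensor_product_def)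
  have "\<exists>us. list_all2 (\<in>) us (map U is) \<and> tensor_proj \<pi> is w = tensor_word us" if "w \<in> ?Y" for w
    using that assms
  proof (induction "is" arbitrary: w)
    case (Cons i "is")
    then obtain a w' where w: "w = a # w'" "a \<in> X i" "w' \<in> listset (map X is)" by (auto simp: set_Cons_def)
    then obtain us where "list_all2 (\<in>) us (map U is)" "tensor_proj \<pi> is w' = tensor_word us"
      using Cons by (metis list.set_intros(2))
    moreover have "\<pi> i a \<in> U i" using Cons.prems(2)[of i] w by (simp add: proj_data_def)
    ultimately have "list_all2 (\<in>) (\<pi> i a # us) (map U (i # is)) \<and> tensor_proj \<pi> (i # is) w = tensor_word (\<pi> i a # us)"
      using w by simp
    then show ?case by blast
  qed simp
  then have "tensor_proj \<pi> is w \<in> ?W" if "w \<in> ?Y" for w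
    using that unfolding tensor_product_def by (blast intro: pm.span_base)
  then show ?thesis using fin sub WP by (auto simp: proj_data_def)
qed

text \<open>The diagonal coefficient at a word factors letter by letter, so the sum over
  \<open>listset\<close> is a product of sums.\<close>

lemma proj_trace_tensor_product:
  "proj_trace (listset (map X is)) (tensor_proj \<pi> is) (tensor_ext h) = (\<Prod>i\<leftarrow>is. proj_trace (X i) (\<pi> i) h)"
proof (induction "is")
  case Nil
  then show ?case by (simp add: proj_trace_def one_list_single tensor_ext_def)
next
  case (Cons i "is")
  have "Poly_Mapping.lookup (linear_ext (tensor_ext h) (tens_of (\<pi> i a) * r)) (a # w) =
      Poly_Mapping.lookup (linear_ext h (\<pi> i a)) a * Poly_Mapping.lookup (linear_ext (tensor_ext h) r) w" for a r w
  proof -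
    have "linear_ext (tensor_ext h) (tens_of (\<pi> i a) * r) =
        linear_ext (\<lambda>a. tens_of (h a)) (\<pi> i a) * linear_ext (tensor_ext h) r"
      by (rule linear_ext_tens_of_mult) (simp add: tensor_ext_Cons)
    then show ?thesis by (simp add: lookup_tens_of_mult flip: tens_of_linear_ext)
  qed
  then show ?case using Cons.IH
    by (simp add: proj_trace_def sum_listset_Cons del: listset.simps flip: sum_product)
qed

subsection \<open>Symmetric powers of exponent at most one\<close>

lemma sym_power_0: "sym_power 0 U = pm.span {1}"
  by (simp add: sym_power_def)

lemma linear_ext_one: "linear_ext f 1 = f 0"
  using linear_ext_single[of f 0 1] by simp

lemma proj_data_sym_power_0:
  assumes "h {#} = 1"
  shows "proj_data {{#}} (sym_power 0 U) (\<lambda>M. 1) h"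
proof -
  have "pm.subspace {w. Poly_Mapping.keys w \<subseteq> {{#}} \<and> linear_ext (\<lambda>M. 1) w = w \<and> linear_ext h w \<in> sym_power 0 U}"
    by (rule pm.subspaceI)
       (auto simp: linear_ext_add linear_ext_scale sym_power_0 pm.span_zero
          pm.span_add pm.span_scale dest!: subsetD[OF keys_add] subsetD[OF keys_scale_subset])
  then have "sym_power 0 U \<subseteq> {w. Poly_Mapping.keys w \<subseteq> {{#}} \<and> linear_ext (\<lambda>M. 1) w = w \<and> linear_ext h w \<in> sym_power 0 U}"
    by (subst sym_power_0, intro pm.span_minimal)
       (auto simp: linear_ext_one assms sym_power_0 intro: pm.span_base)
  then show ?thesis
    by (auto simp: proj_data_def sym_power_0 pm.subspace_span intro: pm.span_base)
qed

lemma proj_trace_sym_power_0: "h {#} = 1 \<Longrightarrow> proj_trace {{#}} (\<lambda>M. 1) h = 1"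
  by (simp add: proj_trace_def linear_ext_one)

lemma sym_of_add: "sym_of (u + v) = sym_of u + sym_of v"
  and sym_of_scale: "sym_of (scale c u) = scale c (sym_of u)"
  by (simp_all add: sym_of_def linear_ext_add linear_ext_scale)

lemma sym_of_0 [simp]: "sym_of 0 = 0"
  by (simp add: sym_of_def)

text \<open>The products of length one already form a subspace, so they equal their span.\<close>

lemma sym_power_1:
  assumes "pm.subspace U"
  shows "sym_power 1 U = sym_of ` U"
proof -
  have "{prod_list (map sym_of us) |us. length us = 1 \<and> set us \<subseteq> U} = sym_of ` U"
  proof (intro equalityI subsetI)
    fix x assume "x \<in> sym_of ` U"
    then obtain u where "u \<in> U" "x = sym_of u" by auto
    then have "x = prod_list (map sym_of [u]) \<and> length [u] = 1 \<and> set [u] \<subseteq> U" by simp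
    then show "x \<in> {prod_list (map sym_of us) |us. length us = 1 \<and> set us \<subseteq> U}" by blast
  qed (auto simp: length_Suc_conv)
  moreover have "pm.subspace (sym_of ` U)"
  proof (rule pm.subspaceI)
    show "0 \<in> sym_of ` U" using pm.subspace_0[OF assms] by (force intro: image_eqI[of _ _ 0])
  qed (use assms in \<open>auto simp: pm.subspace_add pm.subspace_scale simp flip: sym_of_add sym_of_scale\<close>)
  ultimately show ?thesis unfolding sym_power_def by (simp add: pm.span_eq_iff)
qed

lemma lookup_sym_of: "Poly_Mapping.lookup (sym_of u) {#a#} = Poly_Mapping.lookup u a"
proof -
  have "Poly_Mapping.lookup (sym_of u) {#a#} = pair (\<lambda>b. of_bool (b = a)) u"
    unfolding sym_of_def lookup_linear_ext by (rule pair_cong) (auto simp: lookup_single)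
  then show ?thesis by (simp add: pair_delta)
qed

lemma keys_sym_of: "Poly_Mapping.keys (sym_of u) \<subseteq> (\<lambda>a. {#a#}) ` Poly_Mapping.keys u"
proof
  fix w assume "w \<in> Poly_Mapping.keys (sym_of u)"
  then have "pair (\<lambda>a. Poly_Mapping.lookup (Poly_Mapping.single {#a#} (1::complex)) w) u \<noteq> 0"
    by (simp add: in_keys_iff sym_of_def lookup_linear_ext)
  then obtain a where "a \<in> Poly_Mapping.keys u" "Poly_Mapping.lookup (Poly_Mapping.single {#a#} (1::complex)) w \<noteq> 0"
    unfolding pair_def by (metis (no_types, lifting) mult_not_zero sum.not_neutral_contains_not_neutral)
  then show "w \<in> (\<lambda>a. {#a#}) ` Poly_Mapping.keys u" by (auto simp: lookup_single when_def split: if_splits)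
qed

lemma linear_ext_sym_of: "linear_ext F (sym_of u) = linear_ext (\<lambda>a. F {#a#}) u"
  by (simp add: sym_of_def linear_ext_linear_ext)

lemma sym_of_linear_ext: "sym_of (linear_ext f u) = linear_ext (\<lambda>a. sym_of (f a)) u"
  by (simp add: sym_of_def linear_ext_linear_ext)

definition sym_proj :: "('a \<Rightarrow> ('a \<Rightarrow>\<^sub>0 complex)) \<Rightarrow> 'a multiset \<Rightarrow> ('a multiset \<Rightarrow>\<^sub>0 complex)" where
  "sym_proj \<pi> M = sym_of (\<pi> (SOME a. M = {#a#}))"

lemma sym_proj_single [simp]: "sym_proj \<pi> {#a#} = sym_of (\<pi> a)"
  by (simp add: sym_proj_def)

lemma proj_data_sym_power_1:
  assumes "proj_data X U \<pi> h" "\<And>a. hs {#a#} = sym_of (h a)"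
  shows "proj_data ((\<lambda>a. {#a#}) ` X) (sym_power 1 U) (sym_proj \<pi>) hs"
proof -
  have U: "pm.subspace U" using assms by (simp add: proj_data_def)
  show ?thesis
    unfolding proj_data_def sym_power_1[OF U]
  proof (intro conjI ballI)
    show "pm.subspace (sym_of ` U)" unfolding sym_power_1[OF U, symmetric] sym_power_def by (rule pm.subspace_span)
    fix w assume "w \<in> sym_of ` U"
    then obtain u where u: "w = sym_of u" "u \<in> U" by auto
    show "Poly_Mapping.keys w \<subseteq> (\<lambda>a. {#a#}) ` X"
      using keys_sym_of[of u] u assms(1) by (fastforce simp: proj_data_def)
    show "linear_ext (sym_proj \<pi>) w = w" "linear_ext hs w \<in> sym_of ` U"
      using u assms by (auto simp: linear_ext_sym_of proj_data_def simp flip: sym_of_linear_ext)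
  qed (use assms in \<open>auto simp: proj_data_def\<close>)
qed

lemma proj_trace_sym_power_1:
  assumes "\<And>a. hs {#a#} = sym_of (h a)"
  shows "proj_trace ((\<lambda>a. {#a#}) ` X) (sym_proj \<pi>) hs = proj_trace X \<pi> h"
  unfolding proj_trace_def
  by (subst sum.reindex)
     (auto simp: inj_on_def linear_ext_sym_of assms lookup_sym_of simp flip: sym_of_linear_ext)

section \<open>The character of the free Lie algebra\<close>

definition mat_prod :: "complex mat \<Rightarrow> nat list \<Rightarrow> nat list \<Rightarrow> complex" where
  "mat_prod A w v = (\<Prod>i<length w. A $$ (w ! i, v ! i))"

lemma mat_prod_Cons: "mat_prod A (a # w) (b # v) = A $$ (a, b) * mat_prod A w v"
  by (simp add: mat_prod_def prod.lessThan_Suc_shift del: prod.lessThan_Suc)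

lemma mat_prod_Nil [simp]: "mat_prod A [] v = 1"
  by (simp add: mat_prod_def)

text \<open>On words of a fixed length \<open>mat_prod A\<close> is the matrix of the tensor power
  of \<open>A\<close>, so this is the functoriality of tensor powers.\<close>

lemma mat_prod_mult:
  assumes A: "A \<in> carrier_mat N N" and B: "B \<in> carrier_mat N N"
  shows "length w = length v \<Longrightarrow> set w \<subseteq> {..<N} \<Longrightarrow> set v \<subseteq> {..<N} \<Longrightarrow>
    mat_prod (A * B) w v = (\<Sum>u\<in>words {..<N} (length w). mat_prod A w u * mat_prod B u v)"
proof (induction w v rule: list_induct2)
  case (Cons a w b v)
  have ab: "(A * B) $$ (a, b) = (\<Sum>c<N. A $$ (a, c) * B $$ (c, b))"
    using A B Cons.prems by (simp add: scalar_prod_def atLeast0LessThan)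
  have "mat_prod (A * B) (a # w) (b # v) = (\<Sum>c<N. A $$ (a, c) * B $$ (c, b)) *
      (\<Sum>u\<in>words {..<N} (length w). mat_prod A w u * mat_prod B u v)"
    using Cons by (simp add: mat_prod_Cons ab)
  also have "\<dots> = (\<Sum>c<N. \<Sum>u\<in>words {..<N} (length w). mat_prod A (a # w) (c # u) * mat_prod B (c # u) (b # v))"
    unfolding sum_product by (intro sum.cong refl) (simp add: mat_prod_Cons)
  also have "\<dots> = (\<Sum>u\<in>words {..<N} (Suc 0 + length w). mat_prod A (a # w) u * mat_prod B u (b # v))"
    unfolding sum_words_append sum_words_1 by simp
  finally show ?case by simp
qed simp

lemma words_nth: "w \<in> words A m \<Longrightarrow> i < m \<Longrightarrow> w ! i \<in> A"
  unfolding words_def using nth_mem by blast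

lemma permute_word_in_words:
  assumes "\<sigma> \<in> perms m" "w \<in> words A m"
  shows "map ((!) w) \<sigma> \<in> words A m"
proof -
  have "set \<sigma> = {..<length w}" using assms by (simp add: perms_def words_def)
  then have "set (map ((!) w) \<sigma>) \<subseteq> set w" by (auto simp: set_conv_nth[of w])
  then show ?thesis using assms perms_length[OF assms(1)] by (auto simp: words_def)
qed

lemma bij_betw_permute_words:
  assumes \<sigma>: "\<sigma> \<in> perms m"
  shows "bij_betw (\<lambda>w. map ((!) w) \<sigma>) (words A m) (words A m)"
proof (rule bij_betw_byWitness[where f' = "\<lambda>v. map ((!) v) (perm_inv m \<sigma>)"])
  show "\<forall>w\<in>words A m. map ((!) (map ((!) w) \<sigma>)) (perm_inv m \<sigma>) = w"
  proof
    fix w assume w: "w \<in> words A m"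
    then have "map ((!) w) \<sigma> \<in> words A m" by (rule permute_word_in_words[OF \<sigma>])
    then show "map ((!) (map ((!) w) \<sigma>)) (perm_inv m \<sigma>) = w"
      using map_nth_eq_iff_perm_inv[OF \<sigma>, of w "map ((!) w) \<sigma>"] w by (simp add: words_def)
  qed
  show "\<forall>v\<in>words A m. map ((!) (map ((!) v) (perm_inv m \<sigma>))) \<sigma> = v"
  proof
    fix v assume v: "v \<in> words A m"
    then have "map ((!) v) (perm_inv m \<sigma>) \<in> words A m"
      by (rule permute_word_in_words[OF perm_inv_in_perms[OF \<sigma>]])
    then show "map ((!) (map ((!) v) (perm_inv m \<sigma>))) \<sigma> = v"
      using map_nth_eq_iff_perm_inv[OF \<sigma>, of "map ((!) v) (perm_inv m \<sigma>)" v] v by (simp add: words_def)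
  qed
qed (use permute_word_in_words[OF \<sigma>] permute_word_in_words[OF perm_inv_in_perms[OF \<sigma>]] in auto)

lemma mat_prod_permute:
  assumes \<sigma>: "\<sigma> \<in> perms m" and "length w = m"
  shows "mat_prod A (map ((!) w) \<sigma>) (map ((!) v) \<sigma>) = mat_prod A w v"
proof -
  have "mat_prod A (map ((!) w) \<sigma>) (map ((!) v) \<sigma>) = (\<Prod>i<m. A $$ (w ! (\<sigma> ! i), v ! (\<sigma> ! i)))"
    unfolding mat_prod_def using perms_length[OF \<sigma>] by simp
  also have "\<dots> = (\<Prod>i<m. A $$ (w ! i, v ! i))"
    by (rule prod.reindex_bij_betw[OF perms_bij[OF \<sigma>]])
  finally show ?thesis using assms by (simp add: mat_prod_def)
qed

text \<open>The sum is a trace of the tensor power composed with a place permutation. The two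
  commute (\<open>mat_prod_permute\<close>), so \<open>P\<close> can be moved cyclically to the
  other end and cancels against \<open>Q\<close>.\<close>

lemma sum_mat_prod_similar:
  assumes \<sigma>: "\<sigma> \<in> perms m"
    and B: "B \<in> carrier_mat N N" and P: "P \<in> carrier_mat N N" and Q: "Q \<in> carrier_mat N N" and QP: "Q * P = 1\<^sub>m N"
  shows "(\<Sum>w\<in>words {..<N} m. mat_prod (P * B * Q) w (map ((!) w) \<sigma>)) =
    (\<Sum>w\<in>words {..<N} m. mat_prod B w (map ((!) w) \<sigma>))"
proof -
  let ?E = "words {..<N} m" and ?s = "\<lambda>w. map ((!) w) \<sigma>"
  have BQ: "B * Q \<in> carrier_mat N N" using B Q by simp
  have mem: "?s w \<in> ?E" if "w \<in> ?E" for w using permute_word_in_words[OF \<sigma> that] .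
  have mult: "mat_prod (C * D) w v = (\<Sum>u\<in>?E. mat_prod C w u * mat_prod D u v)"
    if "C \<in> carrier_mat N N" "D \<in> carrier_mat N N" "w \<in> ?E" "v \<in> ?E" for C D w v
    using mat_prod_mult[OF that(1,2), of w v] that(3,4) by (simp add: words_def)
  have "P * B * Q = P * (B * Q)" using B P Q by simp
  then have "(\<Sum>w\<in>?E. mat_prod (P * B * Q) w (?s w)) =
      (\<Sum>w\<in>?E. \<Sum>u\<in>?E. mat_prod P (?s w) (?s u) * mat_prod (B * Q) u (?s w))"
  proof (intro sum.cong)
    fix w assume w: "w \<in> ?E"
    have "mat_prod (P * (B * Q)) w (?s w) = (\<Sum>u\<in>?E. mat_prod P w u * mat_prod (B * Q) u (?s w))"
      by (rule mult[OF P BQ w mem[OF w]])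
    also have "\<dots> = (\<Sum>u\<in>?E. mat_prod P (?s w) (?s u) * mat_prod (B * Q) u (?s w))"
      using w by (simp add: mat_prod_permute[OF \<sigma>] words_def)
    finally show "mat_prod (P * B * Q) w (?s w) = (\<Sum>u\<in>?E. mat_prod P (?s w) (?s u) * mat_prod (B * Q) u (?s w))"
      using \<open>P * B * Q = P * (B * Q)\<close> by simp
  qed simp
  also have "\<dots> = (\<Sum>u\<in>?E. \<Sum>w\<in>?E. mat_prod (B * Q) u (?s w) * mat_prod P (?s w) (?s u))"
    by (subst sum.swap) (simp add: mult.commute)
  also have "\<dots> = (\<Sum>u\<in>?E. \<Sum>w\<in>?E. mat_prod (B * Q) u w * mat_prod P w (?s u))"
    by (rule sum.cong[OF refl]) (rule sum.reindex_bij_betw[OF bij_betw_permute_words[OF \<sigma>]])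
  also have "\<dots> = (\<Sum>u\<in>?E. mat_prod (B * Q * P) u (?s u))"
    by (intro sum.cong refl) (simp add: mult[OF BQ P] mem)
  also have "B * Q * P = B" using B P Q QP by (simp add: assoc_mult_mat[of _ N N _ N _ N])
  finally show ?thesis .
qed

text \<open>A nonzero product needs \<open>w ! i \<le> w ! (\<sigma> ! i)\<close> for all
  \<open>i\<close>. Both sides have the same sum over \<open>i\<close>, so equality holds throughout
  and \<open>\<sigma>\<close> fixes \<open>w\<close>.\<close>

lemma mat_prod_upper_triangular:
  assumes \<sigma>: "\<sigma> \<in> perms m" and B: "B \<in> carrier_mat N N" "upper_triangular B" and w: "w \<in> words {..<N} m"
  shows "mat_prod B w (map ((!) w) \<sigma>) = (if map ((!) w) \<sigma> = w then wt (\<lambda>i. B $$ (i, i)) w else 0)"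
proof (cases "map ((!) w) \<sigma> = w")
  case True
  have "wt x w = (\<Prod>i<length w. x (w ! i))" for x :: "nat \<Rightarrow> complex"
    by (simp add: prod.list_conv_set_nth atLeast0LessThan)
  then show ?thesis using True by (simp add: mat_prod_def)
next
  case False
  have len: "length w = m" "length \<sigma> = m" using w perms_length[OF \<sigma>] by (auto simp: words_def)
  have "\<exists>i<m. B $$ (w ! i, w ! (\<sigma> ! i)) = 0"
  proof (rule ccontr)
    assume nz: "\<not> (\<exists>i<m. B $$ (w ! i, w ! (\<sigma> ! i)) = 0)"
    have le: "w ! i \<le> w ! (\<sigma> ! i)" if i: "i < m" for i
    proof (rule ccontr)
      assume "\<not> w ! i \<le> w ! (\<sigma> ! i)"
      moreover have "w ! i < N" using words_nth[OF w i] by simp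
      ultimately have "B $$ (w ! i, w ! (\<sigma> ! i)) = 0" using B by (auto simp: upper_triangular_def)
      then show False using nz i by blast
    qed
    have "(\<Sum>i<m. w ! i) = (\<Sum>i<m. w ! (\<sigma> ! i))"
      by (rule sum.reindex_bij_betw[OF perms_bij[OF \<sigma>], symmetric])
    then have "w ! i = w ! (\<sigma> ! i)" if "i < m" for i
      using sum_mono_inv[of "\<lambda>i. w ! i" "{..<m}" "\<lambda>i. w ! (\<sigma> ! i)" i] le that by simp
    then have "map ((!) w) \<sigma> = w" using len by (intro nth_equalityI) auto
    then show False using False by simp
  qed
  then show ?thesis using False len unfolding mat_prod_def by (auto intro!: prod_zero)
qed

lemma sum_mat_prod_eigenvalues:
  assumes \<sigma>: "\<sigma> \<in> perms m" and g: "g \<in> carrier_mat N N" and cp: "char_poly g = (\<Prod>x\<leftarrow>xs. [:- x, 1:])"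
  shows "(\<Sum>w\<in>words {..<N} m. mat_prod g w (map ((!) w) \<sigma>)) =
    (\<Sum>w | w \<in> words {..<N} m \<and> map ((!) w) \<sigma> = w. wt ((!) xs) w)"
proof -
  \<comment> \<open>The triangular form has the eigenvalues on its diagonal in the order of
    \<open>xs\<close>, so the letter \<open>i\<close> gets the weight \<open>xs ! i\<close>.\<close>
  obtain B P Q where s: "schur_decomposition g xs = (B, P, Q)" by (cases "schur_decomposition g xs") auto
  from schur_decomposition[OF g cp s] have sim: "similar_mat_wit g B P Q"
    and up: "upper_triangular B" and dg: "diag_mat B = xs" by auto
  have car: "B \<in> carrier_mat N N" "P \<in> carrier_mat N N" "Q \<in> carrier_mat N N" "Q * P = 1\<^sub>m N" "g = P * B * Q"
    using sim g by (auto simp: similar_mat_wit_def Let_def)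
  have dg': "B $$ (i, i) = xs ! i" if "i < N" for i
    using that car(1) by (simp add: diag_mat_def flip: dg)
  have "(\<Sum>w\<in>words {..<N} m. mat_prod g w (map ((!) w) \<sigma>)) =
      (\<Sum>w\<in>words {..<N} m. mat_prod B w (map ((!) w) \<sigma>))"
    unfolding car(5) by (rule sum_mat_prod_similar[OF \<sigma> car(1-4)])
  also have "\<dots> = (\<Sum>w\<in>words {..<N} m. if map ((!) w) \<sigma> = w then wt ((!) xs) w else 0)"
  proof (rule sum.cong)
    fix w assume w: "w \<in> words {..<N} m"
    have "wt (\<lambda>i. B $$ (i, i)) w = wt ((!) xs) w"
      by (rule arg_cong[where f = prod_list], rule map_cong) (use w dg' in \<open>auto simp: words_def\<close>)
    then show "mat_prod B w (map ((!) w) \<sigma>) = (if map ((!) w) \<sigma> = w then wt ((!) xs) w else 0)"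
      by (simp add: mat_prod_upper_triangular[OF \<sigma> car(1) up w])
  qed simp
  also have "\<dots> = (\<Sum>w | w \<in> words {..<N} m \<and> map ((!) w) \<sigma> = w. wt ((!) xs) w)"
    by (rule sum.inter_filter[symmetric]) simp
  finally show ?thesis .
qed

section \<open>Tensor powers and Lie parts as subspaces, with projections\<close>

lemma std_space_eq: "std_space N = {v. Poly_Mapping.keys v \<subseteq> {..<N}}"
proof (intro equalityI subsetI)
  fix v assume "v \<in> {v :: nat \<Rightarrow>\<^sub>0 complex. Poly_Mapping.keys v \<subseteq> {..<N}}"
  then show "v \<in> std_space N" unfolding std_space_def by (intro in_span_singles) auto
next
  have "pm.subspace {v :: nat \<Rightarrow>\<^sub>0 complex. Poly_Mapping.keys v \<subseteq> {..<N}}"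
    by (rule pm.subspaceI) (auto dest!: subsetD[OF keys_add] subsetD[OF keys_scale_subset])
  then have "std_space N \<subseteq> {v. Poly_Mapping.keys v \<subseteq> {..<N}}"
    unfolding std_space_def by (intro pm.span_minimal) auto
  then show "v \<in> std_space N \<Longrightarrow> v \<in> {v. Poly_Mapping.keys v \<subseteq> {..<N}}" for v by auto
qed

definition mat_column :: "nat \<Rightarrow> complex mat \<Rightarrow> nat \<Rightarrow> (nat \<Rightarrow>\<^sub>0 complex)" where
  "mat_column N g a = (\<Sum>i<N. Poly_Mapping.single i (g $$ (i, a)))"

lemma mat_action_eq: "g \<in> carrier_mat N N \<Longrightarrow> mat_action g = linear_ext (mat_column N g)"
  by (simp add: mat_action_def mat_column_def[abs_def])

lemma lookup_mat_column: "i < N \<Longrightarrow> Poly_Mapping.lookup (mat_column N g a) i = g $$ (i, a)"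
  by (simp add: mat_column_def lookup_sum lookup_single when_def)

lemma keys_mat_column: "Poly_Mapping.keys (mat_column N g a) \<subseteq> {..<N}"
  unfolding mat_column_def using keys_sum[of "\<lambda>i. Poly_Mapping.single i (g $$ (i, a))" "{..<N}"]
  by (force split: if_splits)

lemma linear_ext_mat_column_in_std_space: "linear_ext (mat_column N g) v \<in> std_space N"
proof -
  have "pm.subspace (std_space N)" by (simp add: std_space_def pm.subspace_span)
  moreover have "mat_column N g a \<in> std_space N" for a using keys_mat_column by (simp add: std_space_eq)
  ultimately show ?thesis unfolding linear_ext_def by (intro pm.subspace_sum pm.subspace_scale)
qed

lemma proj_data_std_space:
  "proj_data {..<N} (std_space N) (\<lambda>a. Poly_Mapping.single a 1) (mat_column N g)"
  unfolding proj_data_def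
  by (auto simp: std_space_def pm.subspace_span linear_ext_id intro: single_letter_in_std_space[unfolded std_space_def]
        linear_ext_mat_column_in_std_space[unfolded std_space_def])
     (use std_space_eq[of N] in \<open>auto simp: std_space_def\<close>)

lemma listset_replicate: "listset (replicate m A) = words A m"
proof (induction m)
  case (Suc m)
  have "w \<in> listset (replicate (Suc m) A) \<longleftrightarrow> w \<in> words A (Suc m)" for w
    using Suc by (cases w) (auto simp: set_Cons_def words_def)
  then show ?case by blast
qed (auto simp: words_def)

lemma proj_data_tensor_power:
  "\<exists>\<pi>. proj_data (words {..<N} m) (tensor_product (replicate m (std_space N))) \<pi> (tensor_ext (mat_column N g))"
  using proj_data_tensor_product[of "replicate m ()" "\<lambda>_. {..<N}" "\<lambda>_. std_space N"
      "\<lambda>_ a. Poly_Mapping.single a 1" "mat_column N g"] proj_data_std_space[of N g]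
  by (auto simp: listset_replicate)

lemma single_eq_tensor_word: "Poly_Mapping.single w (1 :: complex) = tensor_word (map (\<lambda>a. Poly_Mapping.single a 1) w)"
proof (induction w)
  case (Cons a w)
  have "Poly_Mapping.single (a # w) (1 :: complex) = Poly_Mapping.single [a] 1 * Poly_Mapping.single w 1"
    by (simp add: mult_single plus_list_def)
  then show ?case using Cons by (simp add: tens_of_single)
qed (simp add: one_list_single)

lemma tensor_power_eq:
  "tensor_product (replicate m (std_space N)) = {p. Poly_Mapping.keys p \<subseteq> words {..<N} m}"
proof (intro equalityI subsetI)
  fix p assume "p \<in> tensor_product (replicate m (std_space N))"
  then show "p \<in> {p. Poly_Mapping.keys p \<subseteq> words {..<N} m}"
    \<comment> \<open>The statement about supports is the same for every matrix; the zero matrix is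
      an arbitrary witness.\<close>
    using proj_data_tensor_power[of N m "0\<^sub>m N N"] by (auto simp: proj_data_def)
next
  fix p assume "p \<in> {p :: nat list \<Rightarrow>\<^sub>0 complex. Poly_Mapping.keys p \<subseteq> words {..<N} m}"
  then have "p \<in> pm.span ((\<lambda>x. Poly_Mapping.single x 1) ` words {..<N} m)" by (intro in_span_singles) auto
  moreover have "(\<lambda>x. Poly_Mapping.single x 1) ` words {..<N} m \<subseteq> tensor_product (replicate m (std_space N))"
  proof
    fix r :: "nat list \<Rightarrow>\<^sub>0 complex"
    assume "r \<in> (\<lambda>x. Poly_Mapping.single x 1) ` words {..<N} m"
    then obtain w where w: "w \<in> words {..<N} m" "r = Poly_Mapping.single w 1" by auto
    have "list_all2 (\<in>) (map (\<lambda>a. Poly_Mapping.single a 1) w) (replicate m (std_space N))"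
      using w words_nth[OF w(1)] by (auto simp: list_all2_conv_all_nth words_def intro: single_letter_in_std_space)
    then show "r \<in> tensor_product (replicate m (std_space N))"
      unfolding w(2) single_eq_tensor_word tensor_product_def by (intro pm.span_base) blast
  qed
  then have "pm.span ((\<lambda>x. Poly_Mapping.single x 1) ` words {..<N} m) \<subseteq> tensor_product (replicate m (std_space N))"
    by (rule pm.span_minimal) (simp add: tensor_product_def pm.subspace_span)
  ultimately show "p \<in> tensor_product (replicate m (std_space N))" by blast
qed

lemma free_lie_invariant:
  assumes "p \<in> free_lie N"
  shows "linear_ext (tensor_ext (mat_column N g)) p \<in> free_lie N"
  using assms
proof (induction rule: free_lie.induct)
  case (generator v)
  have "linear_ext (tensor_ext (mat_column N g)) (tens_of v) = tens_of (linear_ext (mat_column N g) v)"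
    using linear_ext_tensor_ext[of "mat_column N g" "[v]"] by simp
  then show ?case using free_lie.generator[OF linear_ext_mat_column_in_std_space] by simp
next
  case (bracket p q)
  have "linear_ext (tensor_ext (mat_column N g)) (a * b) =
      linear_ext (tensor_ext (mat_column N g)) a * linear_ext (tensor_ext (mat_column N g)) b" for a b
    by (rule linear_ext_mult) (simp add: tensor_ext_def plus_list_def)
  moreover have "linear_ext F (a - b) = linear_ext F a - linear_ext F b" for F :: "nat list \<Rightarrow> (nat list \<Rightarrow>\<^sub>0 complex)" and a b
    by (rule poly_mapping_eqI) (simp add: lookup_linear_ext pair_diff lookup_minus)
  ultimately show ?case using free_lie.bracket[OF bracket.IH] by simp
qed (simp_all add: linear_ext_add linear_ext_scale free_lie.intros)

lemma proj_data_lie_part: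
  assumes q: "primitive_root m q"
  shows "proj_data (words {..<N} m) (lie_part N m) (klyachko m q) (tensor_ext (mat_column N g))"
  unfolding proj_data_def
proof (intro conjI ballI)
  have m: "0 < m" using q by (simp add: primitive_root_def)
  show "finite (words {..<N} m)" by simp
  show "pm.subspace (lie_part N m)"
    unfolding lie_part_def tensor_power_eq
    by (rule pm.subspaceI) (auto intro: free_lie.intros dest!: subsetD[OF keys_add] subsetD[OF keys_scale_subset])
  show "klyachko m q w \<in> lie_part N m" if "w \<in> words {..<N} m" for w
    unfolding lie_part_def tensor_power_eq
    using primitive_in_free_lie[OF klyachko_primitive[OF q] m keys_klyachko[OF that]] keys_klyachko[OF that] by auto
  fix p assume p: "p \<in> lie_part N m"
  then have keys: "Poly_Mapping.keys p \<subseteq> words {..<N} m" and lie: "p \<in> free_lie N"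
    unfolding lie_part_def tensor_power_eq by auto
  show "Poly_Mapping.keys p \<subseteq> words {..<N} m" by (rule keys)
  show "linear_ext (klyachko m q) p = p"
    using klyachko_fixes_primitive[OF q free_lie_primitive[OF lie]] keys by (auto simp: words_def)
  show "linear_ext (tensor_ext (mat_column N g)) p \<in> lie_part N m"
    using free_lie_invariant[OF lie, of g] p proj_data_tensor_power[of N m g]
    unfolding lie_part_def by (auto simp: proj_data_def)
qed

lemma lookup_tensor_ext:
  "length w = length v \<Longrightarrow> Poly_Mapping.lookup (tensor_ext h v) w = (\<Prod>i<length w. Poly_Mapping.lookup (h (v ! i)) (w ! i))"
proof (induction w v rule: list_induct2)
  case Nil
  then show ?case by (simp add: tensor_ext_def one_list_single)
next
  case (Cons a w b v)
  then show ?case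
    by (simp add: tensor_ext_Cons lookup_tens_of_mult prod.lessThan_Suc_shift del: prod.lessThan_Suc)
qed

lemma proj_trace_lie_part:
  assumes q: "primitive_root m q" and g: "g \<in> carrier_mat N N" and cp: "char_poly g = (\<Prod>x\<leftarrow>xs. [:- x, 1:])"
  shows "proj_trace (words {..<N} m) (klyachko m q) (tensor_ext (mat_column N g)) =
    (\<Sum>w | w \<in> words {..<N} m \<and> [maj w = 1] (mod m). wt ((!) xs) w)"
proof -
  have m: "0 < m" using q by (simp add: primitive_root_def)
  have "proj_trace (words {..<N} m) (klyachko m q) (tensor_ext (mat_column N g)) =
      (\<Sum>w\<in>words {..<N} m. inverse (of_nat m) * (\<Sum>\<sigma>\<in>perms m. q ^ maj \<sigma> * mat_prod g w (map ((!) w) \<sigma>)))"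
    unfolding proj_trace_def lookup_linear_ext pair_klyachko
  proof (rule sum.cong)
    fix w assume w: "w \<in> words {..<N} m"
    have "Poly_Mapping.lookup (tensor_ext (mat_column N g) (map ((!) w) \<sigma>)) w = mat_prod g w (map ((!) w) \<sigma>)"
      if "\<sigma> \<in> perms m" for \<sigma>
    proof -
      have "w ! i < N" if "i < m" for i using words_nth[OF w that] by simp
      then show ?thesis
        using w perms_length[OF that] by (subst lookup_tensor_ext) (auto simp: words_def mat_prod_def lookup_mat_column)
    qed
    then show "inverse (of_nat m) * (\<Sum>\<sigma>\<in>perms m. q ^ maj \<sigma> *
          Poly_Mapping.lookup (tensor_ext (mat_column N g) (map ((!) w) \<sigma>)) w) =
        inverse (of_nat m) * (\<Sum>\<sigma>\<in>perms m. q ^ maj \<sigma> * mat_prod g w (map ((!) w) \<sigma>))" by simp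
  qed simp
  also have "\<dots> = inverse (of_nat m) * (\<Sum>\<sigma>\<in>perms m. q ^ maj \<sigma> * (\<Sum>w\<in>words {..<N} m. mat_prod g w (map ((!) w) \<sigma>)))"
    unfolding sum_distrib_left by (rule sum.swap)
  also have "\<dots> = inverse (of_nat m) * (\<Sum>\<sigma>\<in>perms m. q ^ maj \<sigma> *
      (\<Sum>w | w \<in> words {..<N} m \<and> map ((!) w) \<sigma> = w. wt ((!) xs) w))"
    using sum_mat_prod_eigenvalues[OF _ g cp] by simp
  also have "\<dots> = (\<Sum>w | w \<in> words {..<N} m \<and> [maj w = 1] (mod m). wt ((!) xs) w)"
    using m by (subst sum_perms_fixed_words[OF q]) auto
  finally show ?thesis .
qed

lemma primitive_root_cis:
  assumes "0 < m"
  shows "primitive_root m (cis (2 * pi / real m))"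
  unfolding primitive_root_def
proof (intro conjI allI impI)
  show "0 < m" by fact
  show "cis (2 * pi / real m) ^ m = 1" using assms by (simp add: DeMoivre)
  fix k assume k: "0 < k \<and> k < m"
  have "inj_on (\<lambda>k. cis (2 * pi * real k / real m)) {..<m}"
    using bij_betw_roots_unity[OF assms] by (simp add: bij_betw_def)
  then have "cis (2 * pi * real k / real m) \<noteq> cis (2 * pi * real 0 / real m)"
    using k inj_onD[of _ "{..<m}" k 0] by (metis lessThan_iff less_numeral_extra(3) order.strict_trans)
  then show "cis (2 * pi / real m) ^ k \<noteq> 1" by (simp add: DeMoivre mult_ac)
qed

text \<open>Distinct parts make every multiplicity 0 or 1. The factors with exponent 0 have trace 1,
  so the product over all degrees reduces to the parts; each degree uses a root of unity of its own
  order.\<close>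

lemma trace_higher_lie:
  assumes lam: "lam \<in> partitions n" "distinct lam"
    and g: "g \<in> carrier_mat N N" and cp: "char_poly g = (\<Prod>x\<leftarrow>xs. [:- x, 1:])"
  shows "trace_on (higher_lie lam N) (higher_lie_action g) =
    (\<Prod>m\<leftarrow>lam. \<Sum>w | w \<in> words {..<N} m \<and> [maj w = 1] (mod m). wt ((!) xs) w)"
proof -
  let ?h = "tensor_ext (mat_column N g)" and ?q = "\<lambda>i. cis (2 * pi / real i)"
  let ?hs = "\<lambda>M. \<Prod>a\<in>#M. sym_of (?h a)"
  let ?is = "[1..<Suc (sum_list lam)]"
  let ?c = "\<lambda>m. \<Sum>w | w \<in> words {..<N} m \<and> [maj w = 1] (mod m). wt ((!) xs) w"
  define X where "X i = (if i \<in> set lam then (\<lambda>w. {#w#}) ` words {..<N} i else {{#}})" for i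
  define \<pi> :: "nat \<Rightarrow> nat list multiset \<Rightarrow> (nat list multiset \<Rightarrow>\<^sub>0 complex)" where "\<pi> i = (if i \<in> set lam then sym_proj (klyachko i (?q i)) else (\<lambda>M. 1))" for i
  define U where "U i = sym_power (count_list lam i) (lie_part N i)" for i
  have cnt: "count_list lam i = (if i \<in> set lam then 1 else 0)" for i
    using lam(2) by (induction lam) auto
  have pd: "proj_data (X i) (U i) (\<pi> i) ?hs" and tr: "proj_trace (X i) (\<pi> i) ?hs = (if i \<in> set lam then ?c i else 1)"
    if "i \<in> set ?is" for i
  proof -
    have q: "primitive_root i (?q i)" using that by (intro primitive_root_cis) (simp del: upt_Suc)
    show "proj_data (X i) (U i) (\<pi> i) ?hs"
    proof (cases "i \<in> set lam")
      case True
      then show ?thesis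
        using proj_data_sym_power_1[OF proj_data_lie_part[OF q, of N g], of ?hs] by (simp add: X_def U_def \<pi>_def cnt)
    next
      case False
      then show ?thesis using proj_data_sym_power_0[of ?hs "lie_part N i"] by (simp add: X_def U_def \<pi>_def cnt)
    qed
    show "proj_trace (X i) (\<pi> i) ?hs = (if i \<in> set lam then ?c i else 1)"
      using proj_trace_sym_power_1[of ?hs ?h "words {..<N} i" "klyachko i (?q i)"] proj_trace_lie_part[OF q g cp]
        proj_trace_sym_power_0[of ?hs] by (simp add: X_def \<pi>_def)
  qed
  have single: "linear_ext f (Poly_Mapping.single a 1) = f a" for f :: "'c \<Rightarrow> ('d \<Rightarrow>\<^sub>0 complex)" and a
    by simp
  have "tensor_map (mat_action g) = linear_ext ?h"
    unfolding tensor_map_def mat_action_eq[OF g] by (simp add: tensor_ext_def[abs_def])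
  then have "sym_map (tensor_map (mat_action g)) = linear_ext ?hs"
    unfolding sym_map_def by simp
  then have act: "higher_lie_action g = linear_ext (tensor_ext ?hs)"
    unfolding higher_lie_action_def tensor_map_def by (simp add: tensor_ext_def[abs_def])
  have "proj_data (listset (map X ?is)) (tensor_product (map U ?is)) (tensor_proj \<pi> ?is) (tensor_ext ?hs)"
    by (rule proj_data_tensor_product[OF pd])
  from trace_on_eq_proj_trace[OF this]
  have "trace_on (higher_lie lam N) (higher_lie_action g) = (\<Prod>i\<leftarrow>?is. proj_trace (X i) (\<pi> i) ?hs)"
    unfolding act higher_lie_def U_def[symmetric, abs_def] proj_trace_tensor_product .
  also have "\<dots> = (\<Prod>i\<leftarrow>?is. if i \<in> set lam then ?c i else 1)"
    by (rule arg_cong[where f = prod_list], rule map_cong) (auto simp: tr)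
  also have "\<dots> = (\<Prod>i\<in>set ?is. if i \<in> set lam then ?c i else 1)"
    by (rule prod.distinct_set_conv_list[symmetric]) simp
  also have "\<dots> = (\<Prod>i\<in>set ?is \<inter> set lam. ?c i)"
    by (rule prod.inter_restrict[symmetric]) simp
  also have "set ?is \<inter> set lam = set lam"
  proof -
    have "i \<le> sum_list lam" if "i \<in> set lam" for i using that by (simp add: member_le_sum_list)
    moreover have "0 < i" if "i \<in> set lam" for i using that lam(1) by (auto simp: partitions_def)
    ultimately show ?thesis by (auto simp: Suc_le_eq less_Suc_eq_le simp del: upt_Suc)
  qed
  also have "(\<Prod>i\<in>set lam. ?c i) = (\<Prod>m\<leftarrow>lam. ?c m)"
    by (rule prod.distinct_set_conv_list[OF lam(2)])
  finally show ?thesis .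
qed

section \<open>Pieri's rule\<close>

text \<open>Shapes are functions on all row indices that vanish from some row on, so shapes with
  different numbers of rows can be compared row by row.\<close>

definition fin_supp :: "(nat \<Rightarrow> nat) \<Rightarrow> bool" where
  "fin_supp f \<longleftrightarrow> (\<exists>L. \<forall>i\<ge>L. f i = 0)"

definition shape_size :: "(nat \<Rightarrow> nat) \<Rightarrow> nat" where
  "shape_size f = (\<Sum>i | f i \<noteq> 0. f i)"

text \<open>\<open>\<kappa> / \<nu>\<close> is a horizontal strip, stated as interlacing. The chain
  \<open>\<kappa> (Suc i) \<le> \<nu> i \<le> \<kappa> i\<close> also forces both shapes to be
  weakly decreasing.\<close>

definition hstrip :: "(nat \<Rightarrow> nat) \<Rightarrow> (nat \<Rightarrow> nat) \<Rightarrow> bool" where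
  "hstrip \<nu> \<kappa> \<longleftrightarrow> (\<forall>i. \<nu> i \<le> \<kappa> i \<and> \<kappa> (Suc i) \<le> \<nu> i)"

lemma shape_size_eq:
  assumes "\<And>i. L \<le> i \<Longrightarrow> f i = 0"
  shows "shape_size f = (\<Sum>i<L. f i)"
proof -
  have "i < L" if "f i \<noteq> 0" for i using assms[of i] that by (cases "i < L") auto
  then show ?thesis unfolding shape_size_def by (intro sum.mono_neutral_left) auto
qed

lemma fin_supp_obtain:
  assumes "fin_supp f" "fin_supp g"
  obtains L where "\<And>i. L \<le> i \<Longrightarrow> f i = 0" "\<And>i. L \<le> i \<Longrightarrow> g i = 0"
proof -
  obtain L1 L2 where "\<forall>i\<ge>L1. f i = 0" "\<forall>i\<ge>L2. g i = 0" using assms by (auto simp: fin_supp_def)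
  then show ?thesis using that[of "max L1 L2"] by simp
qed

lemma fin_supp_le: "fin_supp g \<Longrightarrow> (\<And>i. f i \<le> g i) \<Longrightarrow> fin_supp f"
  unfolding fin_supp_def by (metis le_zero_eq)

lemma le_psize: "fin_supp f \<Longrightarrow> f i \<le> shape_size f"
proof -
  assume "fin_supp f"
  then obtain L where L: "\<forall>i\<ge>L. f i = 0" by (auto simp: fin_supp_def)
  then have "shape_size f = (\<Sum>i<max L (Suc i). f i)" by (intro shape_size_eq) auto
  then show ?thesis using member_le_sum[of i "{..<max L (Suc i)}" f] by simp
qed

lemma shape_size_mono:
  assumes "fin_supp g" "\<And>i. f i \<le> g i"
  shows "shape_size f \<le> shape_size g"
proof -
  obtain L where "\<And>i. L \<le> i \<Longrightarrow> f i = 0" "\<And>i. L \<le> i \<Longrightarrow> g i = 0"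
    using fin_supp_obtain[OF fin_supp_le[OF assms] assms(1)] by blast
  then show ?thesis using assms(2) by (simp add: shape_size_eq[of L] sum_mono)
qed

lemma finite_bounded_shapes:
  assumes "fin_supp b"
  shows "finite {f :: nat \<Rightarrow> nat. \<forall>i. f i \<le> b i}"
proof -
  obtain L where L: "\<And>i. L \<le> i \<Longrightarrow> b i = 0" using assms by (auto simp: fin_supp_def)
  have "{f. \<forall>i. f i \<le> b i} \<subseteq> {f. \<forall>i. (i \<in> {..<L} \<longrightarrow> f i \<in> {..shape_size b}) \<and> (i \<notin> {..<L} \<longrightarrow> f i = 0)}"
  proof (intro subsetI CollectI allI conjI impI)
    fix f i assume f: "f \<in> {f. \<forall>i. f i \<le> b i}"
    show "f i \<in> {..shape_size b}" using f le_psize[OF assms, of i] by (auto intro: order_trans)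
    show "i \<notin> {..<L} \<Longrightarrow> f i = 0" using f L[of i] by (metis le_zero_eq lessThan_iff mem_Collect_eq not_le)
  qed
  then show ?thesis by (rule finite_subset) (intro finite_set_of_finite_funs, auto)
qed

lemma finite_hstrips_below: "fin_supp \<kappa> \<Longrightarrow> finite {\<nu>. hstrip \<nu> \<kappa>}"
  by (rule finite_subset[OF _ finite_bounded_shapes[of \<kappa>]]) (auto simp: hstrip_def)

lemma hstrip_fin_supp_above:
  assumes "fin_supp \<kappa>" "hstrip \<kappa> \<mu>"
  shows "fin_supp \<mu>"
proof -
  obtain L where "\<And>i. L \<le> i \<Longrightarrow> \<kappa> i = 0" using assms(1) by (auto simp: fin_supp_def)
  then have "\<forall>i\<ge>Suc L. \<mu> i = 0"
    using assms(2) unfolding hstrip_def by (metis Suc_le_D Suc_le_mono le_zero_eq)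
  then show ?thesis by (auto simp: fin_supp_def)
qed

lemma hstrip_fin_supp_below: "fin_supp \<kappa> \<Longrightarrow> hstrip \<nu> \<kappa> \<Longrightarrow> fin_supp \<nu>"
  by (rule fin_supp_le) (auto simp: hstrip_def)

lemma finite_hstrips_above:
  assumes "fin_supp \<kappa>"
  shows "finite {\<mu>. hstrip \<kappa> \<mu> \<and> shape_size \<mu> = s}"
proof -
  \<comment> \<open>Interlacing bounds every row but the first by the preceding row of
    \<open>\<kappa>\<close>; the first row is bounded by the total size.\<close>
  define b where "b i = (if i = 0 then s else \<kappa> (i - 1))" for i
  have "fin_supp b"
  proof -
    obtain L where "\<And>i. L \<le> i \<Longrightarrow> \<kappa> i = 0" using assms by (auto simp: fin_supp_def)
    then have "\<forall>i\<ge>Suc L. b i = 0" by (auto simp: b_def)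
    then show ?thesis by (auto simp: fin_supp_def)
  qed
  moreover have "\<mu> i \<le> b i" if "hstrip \<kappa> \<mu>" "shape_size \<mu> = s" for \<mu> i
    using that le_psize[OF hstrip_fin_supp_above[OF assms that(1)], of 0] by (cases i) (auto simp: b_def hstrip_def)
  ultimately show ?thesis
    by (intro finite_subset[OF _ finite_bounded_shapes[of b]]) auto
qed

text \<open>
  \<open>sch N x \<kappa>\<close> is the Schur polynomial of the shape \<open>\<kappa>\<close> in \<open>x\<^sub>0, \<dots>, x\<^bsub>N-1\<^esub>\<close>, given by the branching rule.
\<close>

fun sch :: "nat \<Rightarrow> (nat \<Rightarrow> complex) \<Rightarrow> (nat \<Rightarrow> nat) \<Rightarrow> complex" where
  "sch 0 x \<kappa> = of_bool (\<kappa> = (\<lambda>_. 0))"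
| "sch (Suc N) x \<kappa> = (\<Sum>\<nu> | hstrip \<nu> \<kappa>. sch N x \<nu> * x N ^ (shape_size \<kappa> - shape_size \<nu>))"

text \<open>The complete homogeneous symmetric polynomial, split by the power of the last
  variable.\<close>

fun hom_sym :: "nat \<Rightarrow> (nat \<Rightarrow> complex) \<Rightarrow> nat \<Rightarrow> complex" where
  "hom_sym 0 x k = of_bool (k = 0)"
| "hom_sym (Suc N) x k = (\<Sum>j\<le>k. hom_sym N x j * x N ^ (k - j))"

lemma shape_size_hstrip: "fin_supp \<kappa> \<Longrightarrow> hstrip \<nu> \<kappa> \<Longrightarrow> shape_size \<nu> \<le> shape_size \<kappa>"
  by (rule shape_size_mono) (auto simp: hstrip_def)

text \<open>
  The local rule: the shapes \<open>\<nu>\<close> below both \<open>\<kappa>\<close> and \<open>\<rho>\<close> correspond to the shapes \<open>\<mu>\<close> above both, by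
  reflecting \<open>\<nu> i\<close> in the interval of its admissible values.
\<close>

definition local_up :: "(nat \<Rightarrow> nat) \<Rightarrow> (nat \<Rightarrow> nat) \<Rightarrow> nat \<Rightarrow> (nat \<Rightarrow> nat) \<Rightarrow> nat \<Rightarrow> nat" where
  "local_up \<kappa> \<rho> k \<nu> i = (case i of 0 \<Rightarrow> max (\<kappa> 0) (\<rho> 0) + (shape_size \<nu> + k - shape_size \<rho>)
     | Suc j \<Rightarrow> max (\<kappa> i) (\<rho> i) + min (\<kappa> j) (\<rho> j) - \<nu> j)"

definition local_down :: "(nat \<Rightarrow> nat) \<Rightarrow> (nat \<Rightarrow> nat) \<Rightarrow> (nat \<Rightarrow> nat) \<Rightarrow> nat \<Rightarrow> nat" where
  "local_down \<kappa> \<rho> \<mu> i = max (\<kappa> (Suc i)) (\<rho> (Suc i)) + min (\<kappa> i) (\<rho> i) - \<mu> (Suc i)"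

text \<open>Row \<open>Suc i\<close> of \<open>\<mu>\<close> is the reflection of
  \<open>\<nu> i\<close>. Row 0 has no upper bound and absorbs the prescribed size; the sizes add up
  because maximum and minimum of two numbers have the same sum as the numbers.\<close>

lemma local_up_props:
  assumes f: "fin_supp \<kappa>" and h: "hstrip \<nu> \<kappa>" "hstrip \<nu> \<rho>" and k: "shape_size \<rho> \<le> shape_size \<nu> + k"
  shows "hstrip \<kappa> (local_up \<kappa> \<rho> k \<nu>)" "hstrip \<rho> (local_up \<kappa> \<rho> k \<nu>)"
    "shape_size (local_up \<kappa> \<rho> k \<nu>) = shape_size \<kappa> + k" "local_down \<kappa> \<rho> (local_up \<kappa> \<rho> k \<nu>) = \<nu>"
proof -
  let ?\<mu> = "local_up \<kappa> \<rho> k \<nu>"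
  have b: "max (\<kappa> (Suc i)) (\<rho> (Suc i)) \<le> \<nu> i" "\<nu> i \<le> min (\<kappa> i) (\<rho> i)" for i
    using h by (auto simp: hstrip_def)
  have S: "?\<mu> (Suc i) + \<nu> i = max (\<kappa> (Suc i)) (\<rho> (Suc i)) + min (\<kappa> i) (\<rho> i)" for i
    using b(2)[of i] unfolding local_up_def nat.case by linarith
  show "hstrip \<kappa> ?\<mu>" "hstrip \<rho> ?\<mu>"
  proof -
    have "max (\<kappa> i) (\<rho> i) \<le> ?\<mu> i" for i
      using b[of "i - 1"] by (cases i) (auto simp: local_up_def)
    moreover have "?\<mu> (Suc i) \<le> min (\<kappa> i) (\<rho> i)" for i using S[of i] b(1)[of i] by linarith
    ultimately show "hstrip \<kappa> ?\<mu>" "hstrip \<rho> ?\<mu>" by (auto simp: hstrip_def)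
  qed
  note f\<nu> = hstrip_fin_supp_below[OF f h(1)]
  note f\<rho> = hstrip_fin_supp_above[OF f\<nu> h(2)]
  obtain L where L: "\<And>i. L \<le> i \<Longrightarrow> \<kappa> i = 0" "\<And>i. L \<le> i \<Longrightarrow> \<rho> i = 0"
    using fin_supp_obtain[OF f f\<rho>] by blast
  have L\<nu>: "\<nu> i = 0" if "L \<le> i" for i using b(2)[of i] L that by simp
  have L\<mu>: "?\<mu> i = 0" if "Suc L \<le> i" for i
    using S[of "i - 1"] L[of i] L[of "i - 1"] that by (cases i) auto
  have mm: "max a b + min a b = a + b" for a b :: nat by simp
  have A: "(\<Sum>i<L. ?\<mu> (Suc i)) + (\<Sum>i<L. \<nu> i) =
      (\<Sum>i<L. max (\<kappa> (Suc i)) (\<rho> (Suc i))) + (\<Sum>i<L. min (\<kappa> i) (\<rho> i))"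
    by (simp only: sum.distrib[symmetric] S)
  have B: "(\<Sum>i<Suc L. max (\<kappa> i) (\<rho> i)) =
      max (\<kappa> 0) (\<rho> 0) + (\<Sum>i<L. max (\<kappa> (Suc i)) (\<rho> (Suc i)))"
    by (rule sum.lessThan_Suc_shift)
  have B': "(\<Sum>i<Suc L. max (\<kappa> i) (\<rho> i)) = (\<Sum>i<L. max (\<kappa> i) (\<rho> i))"
    by (simp add: L)
  have C: "(\<Sum>i<L. max (\<kappa> i) (\<rho> i)) + (\<Sum>i<L. min (\<kappa> i) (\<rho> i)) = (\<Sum>i<L. \<kappa> i) + (\<Sum>i<L. \<rho> i)"
    by (simp only: sum.distrib[symmetric] mm)
  have D: "shape_size ?\<mu> = ?\<mu> 0 + (\<Sum>i<L. ?\<mu> (Suc i))"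
  proof -
    have "shape_size ?\<mu> = (\<Sum>i<Suc L. ?\<mu> i)" by (rule shape_size_eq) (rule L\<mu>)
    then show ?thesis by (simp only: sum.lessThan_Suc_shift)
  qed
  have E': "shape_size \<nu> = (\<Sum>i<L. \<nu> i)" "shape_size \<kappa> = (\<Sum>i<L. \<kappa> i)" "shape_size \<rho> = (\<Sum>i<L. \<rho> i)"
    by (rule shape_size_eq, (simp only: L\<nu> L))+
  have "?\<mu> 0 = max (\<kappa> 0) (\<rho> 0) + (shape_size \<nu> + k - shape_size \<rho>)" by (simp add: local_up_def)
  then show "shape_size ?\<mu> = shape_size \<kappa> + k" using A B B' C D E' k by linarith
  show "local_down \<kappa> \<rho> ?\<mu> = \<nu>"
  proof
    fix i show "local_down \<kappa> \<rho> ?\<mu> i = \<nu> i" using S[of i] unfolding local_down_def by linarith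
  qed
qed

lemma local_down_props:
  assumes f: "fin_supp \<kappa>" and h: "hstrip \<kappa> \<mu>" "hstrip \<rho> \<mu>" and k: "shape_size \<mu> = shape_size \<kappa> + k"
  shows "hstrip (local_down \<kappa> \<rho> \<mu>) \<kappa>" "hstrip (local_down \<kappa> \<rho> \<mu>) \<rho>"
    "shape_size \<rho> \<le> shape_size (local_down \<kappa> \<rho> \<mu>) + k" "local_up \<kappa> \<rho> k (local_down \<kappa> \<rho> \<mu>) = \<mu>"
proof -
  let ?\<nu> = "local_down \<kappa> \<rho> \<mu>"
  have b: "max (\<kappa> i) (\<rho> i) \<le> \<mu> i" "\<mu> (Suc i) \<le> min (\<kappa> i) (\<rho> i)" for i
    using h by (auto simp: hstrip_def)
  have S: "\<mu> (Suc i) + ?\<nu> i = max (\<kappa> (Suc i)) (\<rho> (Suc i)) + min (\<kappa> i) (\<rho> i)" for i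
    using b(2)[of i] unfolding local_down_def by linarith
  have "max (\<kappa> (Suc i)) (\<rho> (Suc i)) \<le> ?\<nu> i" "?\<nu> i \<le> min (\<kappa> i) (\<rho> i)" for i
    using S[of i] b(1)[of "Suc i"] b(2)[of i] by linarith+
  then show h': "hstrip ?\<nu> \<kappa>" "hstrip ?\<nu> \<rho>" by (auto simp: hstrip_def)
  note f\<mu> = hstrip_fin_supp_above[OF f h(1)]
  note f\<rho> = hstrip_fin_supp_below[OF f\<mu> h(2)]
  obtain L where L: "\<And>i. L \<le> i \<Longrightarrow> \<kappa> i = 0" "\<And>i. L \<le> i \<Longrightarrow> \<rho> i = 0"
    using fin_supp_obtain[OF f f\<rho>] by blast
  have L\<nu>: "?\<nu> i = 0" if "L \<le> i" for i using h'(1) L that by (metis hstrip_def le_zero_eq)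
  have L\<mu>: "\<mu> i = 0" if "Suc L \<le> i" for i
    using S[of "i - 1"] L[of i] L[of "i - 1"] that by (cases i) auto
  have mm: "max a b + min a b = a + b" for a b :: nat by simp
  have A: "(\<Sum>i<L. \<mu> (Suc i)) + (\<Sum>i<L. ?\<nu> i) =
      (\<Sum>i<L. max (\<kappa> (Suc i)) (\<rho> (Suc i))) + (\<Sum>i<L. min (\<kappa> i) (\<rho> i))"
    by (simp only: sum.distrib[symmetric] S)
  have B: "(\<Sum>i<Suc L. max (\<kappa> i) (\<rho> i)) =
      max (\<kappa> 0) (\<rho> 0) + (\<Sum>i<L. max (\<kappa> (Suc i)) (\<rho> (Suc i)))"
    by (rule sum.lessThan_Suc_shift)
  have B': "(\<Sum>i<Suc L. max (\<kappa> i) (\<rho> i)) = (\<Sum>i<L. max (\<kappa> i) (\<rho> i))"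
    by (simp add: L)
  have C: "(\<Sum>i<L. max (\<kappa> i) (\<rho> i)) + (\<Sum>i<L. min (\<kappa> i) (\<rho> i)) = (\<Sum>i<L. \<kappa> i) + (\<Sum>i<L. \<rho> i)"
    by (simp only: sum.distrib[symmetric] mm)
  have D: "shape_size \<mu> = \<mu> 0 + (\<Sum>i<L. \<mu> (Suc i))"
  proof -
    have "shape_size \<mu> = (\<Sum>i<Suc L. \<mu> i)" by (rule shape_size_eq) (rule L\<mu>)
    then show ?thesis by (simp only: sum.lessThan_Suc_shift)
  qed
  have E': "shape_size ?\<nu> = (\<Sum>i<L. ?\<nu> i)" "shape_size \<kappa> = (\<Sum>i<L. \<kappa> i)" "shape_size \<rho> = (\<Sum>i<L. \<rho> i)"
    by (rule shape_size_eq, (simp only: L\<nu> L))+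
  have E: "shape_size ?\<nu> + k + max (\<kappa> 0) (\<rho> 0) = \<mu> 0 + shape_size \<rho>" using A B B' C D E' k by linarith
  show "shape_size \<rho> \<le> shape_size ?\<nu> + k" using E b(1)[of 0] by linarith
  show "local_up \<kappa> \<rho> k ?\<nu> = \<mu>"
  proof
    fix i show "local_up \<kappa> \<rho> k ?\<nu> i = \<mu> i"
    proof (cases i)
      case 0 then show ?thesis using E b(1)[of 0] unfolding local_up_def 0 nat.case by linarith
    next
      case (Suc j) then show ?thesis using S[of j] by (simp add: local_up_def)
    qed
  qed
qed

text \<open>Induction on the number of variables. Splitting off the last variable on the left and
  using the hypothesis gives pairs with \<open>\<nu>\<close> below both \<open>\<kappa>\<close> and
  \<open>\<rho>\<close>; splitting it off on the right gives pairs with \<open>\<mu>\<close> above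
  both. The local rule matches these for each \<open>\<rho>\<close>, and the exponent
  \<open>shape_size \<kappa> + k - shape_size \<rho>\<close> of the last variable depends on
  \<open>\<rho>\<close> alone.\<close>

lemma pieri:
  "fin_supp \<kappa> \<Longrightarrow> sch N x \<kappa> * hom_sym N x k = (\<Sum>\<mu> | hstrip \<kappa> \<mu> \<and> shape_size \<mu> = shape_size \<kappa> + k. sch N x \<mu>)"
proof (induction N arbitrary: \<kappa> k)
  case 0
  have p0: "shape_size (\<lambda>_. 0) = 0" by (simp add: shape_size_def)
  have fin: "finite {\<mu>. hstrip \<kappa> \<mu> \<and> shape_size \<mu> = shape_size \<kappa> + k}" by (rule finite_hstrips_above[OF 0])
  have "(\<Sum>\<mu> | hstrip \<kappa> \<mu> \<and> shape_size \<mu> = shape_size \<kappa> + k. sch 0 x \<mu>) =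
      (\<Sum>\<mu> | hstrip \<kappa> \<mu> \<and> shape_size \<mu> = shape_size \<kappa> + k. if \<mu> = (\<lambda>_. 0) then 1 else 0)"
    by (rule sum.cong) auto
  also have "\<dots> = of_bool (hstrip \<kappa> (\<lambda>_. 0) \<and> shape_size \<kappa> + k = 0)"
    using fin p0 by (simp add: of_bool_def)
  also have "hstrip \<kappa> (\<lambda>_. 0) \<and> shape_size \<kappa> + k = 0 \<longleftrightarrow> \<kappa> = (\<lambda>_. 0) \<and> k = 0"
    using p0 by (auto simp: hstrip_def)
  finally show ?case by simp
next
  case (Suc N)
  note f = Suc.prems
  let ?e = "shape_size \<kappa> + k"
  let ?A = "Sigma {\<nu>. hstrip \<nu> \<kappa>} (\<lambda>\<nu>. {\<rho>. hstrip \<nu> \<rho> \<and> shape_size \<rho> \<le> shape_size \<nu> + k})"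
  let ?B = "Sigma {\<mu>. hstrip \<kappa> \<mu> \<and> shape_size \<mu> = ?e} (\<lambda>\<mu>. {\<rho>. hstrip \<rho> \<mu>})"
  have fr: "{\<rho>. hstrip \<nu> \<rho> \<and> shape_size \<rho> \<le> shape_size \<nu> + k} = (\<Union>j\<le>k. {\<rho>. hstrip \<nu> \<rho> \<and> shape_size \<rho> = shape_size \<nu> + j})"
    if "hstrip \<nu> \<kappa>" for \<nu>
  proof -
    have "\<exists>j\<le>k. shape_size \<rho> = shape_size \<nu> + j" if "hstrip \<nu> \<rho>" "shape_size \<rho> \<le> shape_size \<nu> + k" for \<rho>
    proof -
      have "fin_supp \<rho>" using hstrip_fin_supp_above[OF hstrip_fin_supp_below[OF f \<open>hstrip \<nu> \<kappa>\<close>] that(1)] .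
      then have "shape_size \<nu> \<le> shape_size \<rho>" using shape_size_hstrip that(1) by blast
      then show ?thesis using that(2) by (intro exI[of _ "shape_size \<rho> - shape_size \<nu>"]) auto
    qed
    then show ?thesis by auto
  qed
  have "sch (Suc N) x \<kappa> * hom_sym (Suc N) x k =
      (\<Sum>\<nu> | hstrip \<nu> \<kappa>. \<Sum>j\<le>k. sch N x \<nu> * hom_sym N x j * x N ^ (?e - (shape_size \<nu> + j)))"
    unfolding sch.simps hom_sym.simps sum_product
  proof (intro sum.cong refl)
    fix \<nu> j assume "\<nu> \<in> {\<nu>. hstrip \<nu> \<kappa>}" "j \<in> {..k}"
    then have "?e - (shape_size \<nu> + j) = (shape_size \<kappa> - shape_size \<nu>) + (k - j)" using shape_size_hstrip[OF f, of \<nu>] by simp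
    then show "sch N x \<nu> * x N ^ (shape_size \<kappa> - shape_size \<nu>) * (hom_sym N x j * x N ^ (k - j)) =
        sch N x \<nu> * hom_sym N x j * x N ^ (?e - (shape_size \<nu> + j))" by (simp add: power_add)
  qed
  also have "\<dots> = (\<Sum>\<nu> | hstrip \<nu> \<kappa>. \<Sum>j\<le>k. \<Sum>\<rho> | hstrip \<nu> \<rho> \<and> shape_size \<rho> = shape_size \<nu> + j. sch N x \<rho> * x N ^ (?e - shape_size \<rho>))"
  proof (intro sum.cong refl)
    fix \<nu> j assume "\<nu> \<in> {\<nu>. hstrip \<nu> \<kappa>}" "j \<in> {..k}"
    then have "fin_supp \<nu>" using hstrip_fin_supp_below[OF f] by simp
    from Suc.IH[OF this, of j]
    have "sch N x \<nu> * hom_sym N x j * x N ^ (?e - (shape_size \<nu> + j)) =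
        (\<Sum>\<rho> | hstrip \<nu> \<rho> \<and> shape_size \<rho> = shape_size \<nu> + j. sch N x \<rho> * x N ^ (?e - (shape_size \<nu> + j)))"
      by (simp add: sum_distrib_right)
    then show "sch N x \<nu> * hom_sym N x j * x N ^ (?e - (shape_size \<nu> + j)) =
        (\<Sum>\<rho> | hstrip \<nu> \<rho> \<and> shape_size \<rho> = shape_size \<nu> + j. sch N x \<rho> * x N ^ (?e - shape_size \<rho>))" by simp
  qed
  also have "\<dots> = (\<Sum>\<nu> | hstrip \<nu> \<kappa>. \<Sum>\<rho> | hstrip \<nu> \<rho> \<and> shape_size \<rho> \<le> shape_size \<nu> + k. sch N x \<rho> * x N ^ (?e - shape_size \<rho>))"
  proof (rule sum.cong[OF refl])
    fix \<nu> assume "\<nu> \<in> {\<nu>. hstrip \<nu> \<kappa>}"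
    then have h: "hstrip \<nu> \<kappa>" by simp
    show "(\<Sum>j\<le>k. \<Sum>\<rho> | hstrip \<nu> \<rho> \<and> shape_size \<rho> = shape_size \<nu> + j. sch N x \<rho> * x N ^ (?e - shape_size \<rho>)) =
        (\<Sum>\<rho> | hstrip \<nu> \<rho> \<and> shape_size \<rho> \<le> shape_size \<nu> + k. sch N x \<rho> * x N ^ (?e - shape_size \<rho>))"
      unfolding fr[OF h]
      by (rule sum.UNION_disjoint[symmetric]) (use finite_hstrips_above[OF hstrip_fin_supp_below[OF f h]] in auto)
  qed
  also have "\<dots> = (\<Sum>p\<in>?A. sch N x (snd p) * x N ^ (?e - shape_size (snd p)))"
    using finite_hstrips_below[OF f] finite_hstrips_above hstrip_fin_supp_below[OF f]
    by (subst sum.Sigma) (auto simp: fr case_prod_unfold)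
  also have "\<dots> = (\<Sum>p\<in>?B. sch N x (snd p) * x N ^ (?e - shape_size (snd p)))"
    by (rule sum.reindex_bij_witness[of _ "\<lambda>(\<mu>, \<rho>). (local_down \<kappa> \<rho> \<mu>, \<rho>)" "\<lambda>(\<nu>, \<rho>). (local_up \<kappa> \<rho> k \<nu>, \<rho>)"])
       (auto simp: local_up_props[OF f] local_down_props[OF f])
  also have "\<dots> = (\<Sum>\<mu> | hstrip \<kappa> \<mu> \<and> shape_size \<mu> = ?e. \<Sum>\<rho> | hstrip \<rho> \<mu>. sch N x \<rho> * x N ^ (?e - shape_size \<rho>))"
    using finite_hstrips_above[OF f] finite_hstrips_below hstrip_fin_supp_above[OF f]
    by (subst sum.Sigma) (auto simp: case_prod_unfold)
  also have "\<dots> = (\<Sum>\<mu> | hstrip \<kappa> \<mu> \<and> shape_size \<mu> = ?e. sch (Suc N) x \<mu>)"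
    by (rule sum.cong) auto
  finally show ?case .
qed

lemma sch_0: "sch N x (\<lambda>_. 0) = 1"
proof (induction N)
  case (Suc N)
  have "{\<nu>. hstrip \<nu> (\<lambda>_. 0)} = {\<lambda>_. 0}" by (auto simp: hstrip_def)
  then show ?case using Suc by simp
qed simp

lemma sorted_filter_replicate:
  "sorted w \<Longrightarrow> set w \<subseteq> {..<Suc N} \<Longrightarrow>
    filter (\<lambda>a. a < N) w @ replicate (length w - length (filter (\<lambda>a. a < N) w)) N = w"
proof (induction w)
  case (Cons a w)
  show ?case
  proof (cases "a < N")
    case True
    then show ?thesis using Cons by simp
  next
    case False
    then have "a = N" "\<forall>x\<in>set w. x = N" using Cons.prems by fastforce+
    then have "filter (\<lambda>a. a < N) w = []" "w = replicate (length w) N"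
      by (auto simp: filter_empty_conv intro: replicate_eqI)
    then show ?thesis using \<open>a = N\<close> by simp
  qed
qed simp

lemma hom_sym_eq_sum_sorted:
  "hom_sym N x k = (\<Sum>w | w \<in> words {..<N} k \<and> sorted w. wt x w)"
proof (induction N arbitrary: k)
  case 0
  have "{w. w \<in> words {..<0::nat} k \<and> sorted w} = (if k = 0 then {[]} else {})"
    by (auto simp: words_def)
  then show ?case by simp
next
  case (Suc N)
  let ?S = "\<lambda>N k. {w. w \<in> words {..<N} k \<and> sorted w}"
  have "(\<Sum>w\<in>?S (Suc N) k. wt x w) = (\<Sum>p\<in>Sigma {..k} (\<lambda>j. ?S N j). wt x (snd p) * x N ^ (k - fst p))"
  proof (rule sum.reindex_bij_witness[of _ "\<lambda>(j, u). u @ replicate (k - j) N"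
        "\<lambda>w. (length (filter (\<lambda>a. a < N) w), filter (\<lambda>a. a < N) w)"])
    fix w assume w: "w \<in> ?S (Suc N) k"
    have e: "filter (\<lambda>a. a < N) w @ replicate (length w - length (filter (\<lambda>a. a < N) w)) N = w"
      by (rule sorted_filter_replicate) (use w in \<open>auto simp: words_def\<close>)
    show "(case (length (filter (\<lambda>a. a < N) w), filter (\<lambda>a. a < N) w) of (j, u) \<Rightarrow> u @ replicate (k - j) N) = w"
      using e w by (simp add: words_def)
    show "(length (filter (\<lambda>a. a < N) w), filter (\<lambda>a. a < N) w) \<in> Sigma {..k} (\<lambda>j. ?S N j)"
      using w by (auto simp: words_def sorted_wrt_filter)
    have "wt x w = wt x (filter (\<lambda>a. a < N) w) * x N ^ (length w - length (filter (\<lambda>a. a < N) w))"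
      by (subst e[symmetric]) simp
    then show "wt x (snd (length (filter (\<lambda>a. a < N) w), filter (\<lambda>a. a < N) w)) *
        x N ^ (k - fst (length (filter (\<lambda>a. a < N) w), filter (\<lambda>a. a < N) w)) = wt x w"
      using w by (simp add: words_def)
  next
    fix p assume "p \<in> Sigma {..k} (\<lambda>j. ?S N j)"
    then obtain j u where p: "p = (j, u)" "j \<le> k" "set u \<subseteq> {..<N}" "length u = j" "sorted u"
      by (auto simp: words_def)
    have "filter (\<lambda>a. a < N) u = u" using p by (auto simp: filter_id_conv)
    then show "(\<lambda>w. (length (filter (\<lambda>a. a < N) w), filter (\<lambda>a. a < N) w)) (case p of (j, u) \<Rightarrow> u @ replicate (k - j) N) = p"
      using p by simp
    show "(case p of (j, u) \<Rightarrow> u @ replicate (k - j) N) \<in> ?S (Suc N) k"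
      using p by (auto simp: words_def sorted_append less_Suc_eq intro: less_imp_le)
  qed
  also have "\<dots> = (\<Sum>j\<le>k. (\<Sum>w\<in>?S N j. wt x w) * x N ^ (k - j))"
    unfolding sum_distrib_right by (subst sum.Sigma) (auto simp: case_prod_unfold)
  finally show ?case by (simp add: Suc.IH)
qed

section \<open>Semistandard tableaux and the branching rule\<close>

definition part :: "nat list \<Rightarrow> nat \<Rightarrow> nat" where
  "part \<mu> i = (if i < length \<mu> then \<mu> ! i else 0)"

lemma fin_supp_part [simp]: "fin_supp (part \<mu>)"
  unfolding fin_supp_def part_def by (intro exI[of _ "length \<mu>"]) simp

text \<open>Semistandard fillings as functions of the row index, in accordance with the shapes;
  demanding \<open>c < \<kappa> r\<close> in the column condition makes the shape weakly
  decreasing.\<close>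

definition ftabs :: "nat \<Rightarrow> (nat \<Rightarrow> nat) \<Rightarrow> (nat \<Rightarrow> nat list) set" where
  "ftabs N \<kappa> = {F. (\<forall>r. length (F r) = \<kappa> r \<and> sorted (F r) \<and> set (F r) \<subseteq> {..<N}) \<and>
     (\<forall>r c. c < \<kappa> (Suc r) \<longrightarrow> c < \<kappa> r \<and> F r ! c < F (Suc r) ! c)}"

definition ftab_wt :: "(nat \<Rightarrow> complex) \<Rightarrow> (nat \<Rightarrow> nat list) \<Rightarrow> complex" where
  "ftab_wt x F = (\<Prod>r | F r \<noteq> []. wt x (F r))"

lemma ftab_wt_eq:
  assumes "\<And>r. L \<le> r \<Longrightarrow> F r = []"
  shows "ftab_wt x F = (\<Prod>r<L. wt x (F r))"
proof -
  have "r < L" if "F r \<noteq> []" for r using assms[of r] that by (cases "r < L") auto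
  then show ?thesis unfolding ftab_wt_def by (intro prod.mono_neutral_left) auto
qed

definition strip_below :: "nat \<Rightarrow> (nat \<Rightarrow> nat list) \<Rightarrow> nat \<Rightarrow> nat list" where
  "strip_below N F r = filter (\<lambda>a. a < N) (F r)"

definition strip_add :: "nat \<Rightarrow> (nat \<Rightarrow> nat) \<Rightarrow> (nat \<Rightarrow> nat list) \<Rightarrow> nat \<Rightarrow> nat list" where
  "strip_add N \<kappa> F r = F r @ replicate (\<kappa> r - length (F r)) N"

lemma strip_add_strip_below:
  assumes "F \<in> ftabs (Suc N) \<kappa>"
  shows "strip_add N \<kappa> (strip_below N F) = F"
proof
  fix r
  have "length (F r) = \<kappa> r" "sorted (F r)" "set (F r) \<subseteq> {..<Suc N}" using assms by (auto simp: ftabs_def)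
  then show "strip_add N \<kappa> (strip_below N F) r = F r"
    using sorted_filter_replicate[of "F r" N] by (simp add: strip_add_def strip_below_def)
qed

text \<open>No cell can lie below the largest entry \<open>N\<close> in its column, so the cells
  filled with \<open>N\<close> form a horizontal strip.\<close>

lemma strip_below_in_ftabs:
  assumes F: "F \<in> ftabs (Suc N) \<kappa>"
  shows "hstrip (\<lambda>r. length (strip_below N F r)) \<kappa>" "strip_below N F \<in> ftabs N (\<lambda>r. length (strip_below N F r))"
proof -
  let ?F = "strip_below N F"
  have len: "length (F r) = \<kappa> r" and srt: "sorted (F r)" and bnd: "set (F r) \<subseteq> {..<Suc N}" for r
    using F by (auto simp: ftabs_def)
  have col: "c < \<kappa> r" "F r ! c < F (Suc r) ! c" if "c < \<kappa> (Suc r)" for r c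
    using F that by (auto simp: ftabs_def)
  have dec: "F r = ?F r @ replicate (\<kappa> r - length (?F r)) N" for r
    using strip_add_strip_below[OF F] by (metis strip_add_def)
  have le: "length (?F r) \<le> \<kappa> r" for r using len[of r] by (simp add: strip_below_def flip: len)
  have lt: "c < length (?F r)" if "c < \<kappa> (Suc r)" for r c
  proof (rule ccontr)
    assume n: "\<not> c < length (?F r)"
    have "F r ! c = (?F r @ replicate (\<kappa> r - length (?F r)) N) ! c" using dec[of r] by simp
    also have "\<dots> = N" using n col(1)[OF that] by (simp add: nth_append)
    finally have "F r ! c = N" .
    moreover have "F (Suc r) ! c \<in> set (F (Suc r))" using that len[of "Suc r"] by (intro nth_mem) simp
    then have "F (Suc r) ! c < Suc N" using bnd[of "Suc r"] by blast
    ultimately show False using col(2)[OF that] by simp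
  qed
  have "\<kappa> (Suc r) \<le> length (?F r)" for r
  proof (cases "\<kappa> (Suc r)")
    case (Suc c) then show ?thesis using lt[of c r] by simp
  qed simp
  then show h: "hstrip (\<lambda>r. length (?F r)) \<kappa>" using le by (simp add: hstrip_def)
  have nth: "?F r ! c = F r ! c" if "c < length (?F r)" for r c
  proof -
    have "F r ! c = (?F r @ replicate (\<kappa> r - length (?F r)) N) ! c" using dec[of r] by simp
    then show ?thesis using that by (simp add: nth_append)
  qed
  have "c < length (?F r) \<and> ?F r ! c < ?F (Suc r) ! c" if "c < length (?F (Suc r))" for r c
  proof -
    have "c < \<kappa> (Suc r)" using that le[of "Suc r"] by simp
    then show ?thesis using lt[of c r] nth[of c r] nth[OF that] col(2)[of c r] by simp
  qed
  moreover have "sorted (?F r)" "set (?F r) \<subseteq> {..<N}" for r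
    using srt[of r] by (auto simp: strip_below_def sorted_wrt_filter)
  ultimately show "?F \<in> ftabs N (\<lambda>r. length (?F r))" by (simp add: ftabs_def)
qed

lemma strip_add_in_ftabs:
  assumes h: "hstrip \<nu> \<kappa>" and F: "F \<in> ftabs N \<nu>"
  shows "strip_add N \<kappa> F \<in> ftabs (Suc N) \<kappa>" "strip_below N (strip_add N \<kappa> F) = F"
proof -
  let ?F = "strip_add N \<kappa> F"
  have len: "length (F r) = \<nu> r" and srt: "sorted (F r)" and bnd: "set (F r) \<subseteq> {..<N}" for r
    using F by (auto simp: ftabs_def)
  have col: "F r ! c < F (Suc r) ! c" if "c < \<nu> (Suc r)" for r c
    using F that by (auto simp: ftabs_def)
  have h': "\<nu> r \<le> \<kappa> r" "\<kappa> (Suc r) \<le> \<nu> r" for r using h by (auto simp: hstrip_def)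
  have "filter (\<lambda>a. a < N) (F r) = F r" for r using bnd[of r] by (auto simp: filter_id_conv)
  then show "strip_below N ?F = F" by (intro ext) (simp add: strip_below_def strip_add_def)
  have "length (?F r) = \<kappa> r" "sorted (?F r)" "set (?F r) \<subseteq> {..<Suc N}" for r
    using len[of r] srt[of r] bnd[of r] h'(1)[of r]
    by (auto simp: strip_add_def sorted_append less_Suc_eq intro: less_imp_le)
  moreover have "c < \<kappa> r \<and> ?F r ! c < ?F (Suc r) ! c" if "c < \<kappa> (Suc r)" for r c
  proof -
    have c: "c < \<nu> r" "c < \<kappa> r" using that h'[of r] by auto
    have "F r ! c \<in> set (F r)" using c len[of r] by (intro nth_mem) simp
    then have "F r ! c < N" using bnd[of r] by blast
    then show ?thesis
      using c that len[of r] len[of "Suc r"] col[of c r] by (auto simp: strip_add_def nth_append)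
  qed
  ultimately show "?F \<in> ftabs (Suc N) \<kappa>" by (simp add: ftabs_def)
qed

text \<open>Removing the cells with the largest entry is a bijection onto fillings of the shapes
  below, which is the recursion of \<open>sch\<close>. Finiteness is proved along with the formula
  because splitting the sum relies on it.\<close>

lemma finite_ftabs_and_sum:
  "fin_supp \<kappa> \<Longrightarrow> finite (ftabs N \<kappa>) \<and> (\<Sum>F\<in>ftabs N \<kappa>. ftab_wt x F) = sch N x \<kappa>"
proof (induction N arbitrary: \<kappa>)
  case 0
  have *: "\<kappa> = (\<lambda>_. 0) \<and> F = (\<lambda>_. [])" if "F \<in> ftabs 0 \<kappa>" for F \<kappa>
  proof -
    have "set (F r) \<subseteq> {..<0}" "length (F r) = \<kappa> r" for r using that unfolding ftabs_def by blast+
    then have "F r = []" "length (F r) = \<kappa> r" for r by auto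
    then show ?thesis by (metis ext list.size(3))
  qed
  have "finite (ftabs 0 \<kappa>)"
    by (rule finite_subset[of _ "{\<lambda>_. []}"]) (auto dest: *)
  moreover have "(\<Sum>F\<in>ftabs 0 \<kappa>. ftab_wt x F) = sch 0 x \<kappa>"
  proof (cases "\<kappa> = (\<lambda>_. 0)")
    case True
    have "(\<lambda>_. []) \<in> ftabs 0 (\<lambda>_. 0)" by (simp add: ftabs_def)
    then have "ftabs 0 \<kappa> = {\<lambda>_. []}" unfolding True using * by blast
    then show ?thesis using True by (simp add: ftab_wt_def)
  next
    case False
    have "ftabs 0 \<kappa> = {}"
    proof (rule equals0I)
      fix F assume "F \<in> ftabs 0 \<kappa>"
      from *[OF this] False show False by (elim conjE notE)
    qed
    then show ?thesis using False by simp
  qed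
  ultimately show ?case ..
next
  case (Suc N)
  note IH = conjunct1[OF Suc.IH] conjunct2[OF Suc.IH]
  let ?i = "\<lambda>(\<nu>, F). strip_add N \<kappa> F" and ?j = "\<lambda>F. (\<lambda>r. length (strip_below N F r), strip_below N F)"
  let ?S = "Sigma {\<nu>. hstrip \<nu> \<kappa>} (ftabs N)"
  have fS: "finite ?S"
    using finite_hstrips_below[OF Suc.prems] IH(1) hstrip_fin_supp_below[OF Suc.prems] by auto
  have ij: "?i (?j F) = F" "?j F \<in> ?S" if "F \<in> ftabs (Suc N) \<kappa>" for F
    using strip_add_strip_below[OF that] strip_below_in_ftabs[OF that] by auto
  have ji: "?j (?i p) = p" "?i p \<in> ftabs (Suc N) \<kappa>" if p: "p \<in> ?S" for p
  proof -
    obtain \<nu> F where *: "p = (\<nu>, F)" "hstrip \<nu> \<kappa>" "F \<in> ftabs N \<nu>" using p by auto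
    then have "(\<lambda>r. length (F r)) = \<nu>" by (auto simp: ftabs_def)
    then show "?j (?i p) = p" "?i p \<in> ftabs (Suc N) \<kappa>"
      using strip_add_in_ftabs[OF *(2,3)] *(1) by auto
  qed
  have "ftabs (Suc N) \<kappa> \<subseteq> ?i ` ?S" using ij by (metis (no_types, lifting) image_eqI subsetI)
  then have fin: "finite (ftabs (Suc N) \<kappa>)" using fS finite_surj by blast
  have wt: "ftab_wt x F = ftab_wt x (strip_below N F) * x N ^ (shape_size \<kappa> - shape_size (\<lambda>r. length (strip_below N F r)))"
    if F: "F \<in> ftabs (Suc N) \<kappa>" for F
  proof -
    let ?F = "strip_below N F"
    obtain L where L: "\<And>r. L \<le> r \<Longrightarrow> \<kappa> r = 0" using Suc.prems by (auto simp: fin_supp_def)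
    have len: "length (F r) = \<kappa> r" for r using F by (simp add: ftabs_def)
    have le: "length (?F r) \<le> \<kappa> r" for r unfolding strip_below_def len[symmetric] by (rule length_filter_le)
    have FL: "F r = []" "?F r = []" if "L \<le> r" for r
      using L[OF that] len[of r] le[of r] by auto
    have "wt x (F r) = wt x (?F r) * x N ^ (\<kappa> r - length (?F r))" for r
      by (subst strip_add_strip_below[OF F, symmetric]) (simp add: strip_add_def)
    then have "ftab_wt x F = (\<Prod>r<L. wt x (?F r)) * x N ^ (\<Sum>r<L. \<kappa> r - length (?F r))"
      by (simp add: ftab_wt_eq[of L F] FL prod.distrib power_sum)
    also have "(\<Sum>r<L. \<kappa> r - length (?F r)) = (\<Sum>r<L. \<kappa> r) - (\<Sum>r<L. length (?F r))"
      by (rule sum_subtractf_nat) (rule le)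
    also have "\<dots> = shape_size \<kappa> - shape_size (\<lambda>r. length (?F r))"
      using L FL by (simp add: shape_size_eq[of L])
    also have "(\<Prod>r<L. wt x (?F r)) = ftab_wt x ?F" using FL by (simp add: ftab_wt_eq[of L ?F])
    finally show ?thesis .
  qed
  have "(\<Sum>F\<in>ftabs (Suc N) \<kappa>. ftab_wt x F) = (\<Sum>p\<in>?S. ftab_wt x (snd p) * x N ^ (shape_size \<kappa> - shape_size (fst p)))"
    by (rule sum.reindex_bij_witness[of _ ?i ?j]) (use ij ji wt in auto)
  also have "\<dots> = (\<Sum>\<nu> | hstrip \<nu> \<kappa>. \<Sum>F\<in>ftabs N \<nu>. ftab_wt x F * x N ^ (shape_size \<kappa> - shape_size \<nu>))"
    using finite_hstrips_below[OF Suc.prems] IH(1) hstrip_fin_supp_below[OF Suc.prems]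
    by (subst sum.Sigma) (auto simp: case_prod_unfold)
  also have "\<dots> = sch (Suc N) x \<kappa>"
    using IH(2) hstrip_fin_supp_below[OF Suc.prems] by (simp flip: sum_distrib_right)
  finally have "(\<Sum>F\<in>ftabs (Suc N) \<kappa>. ftab_wt x F) = sch (Suc N) x \<kappa>" .
  with fin show ?case ..
qed

lemmas sum_ftabs = conjunct1[OF finite_ftabs_and_sum] conjunct2[OF finite_ftabs_and_sum]

definition row_fun :: "'a list list \<Rightarrow> nat \<Rightarrow> 'a list" where
  "row_fun T r = (if r < length T then T ! r else [])"

lemma partitions_nth_mono: "\<mu> \<in> partitions n \<Longrightarrow> i \<le> j \<Longrightarrow> j < length \<mu> \<Longrightarrow> \<mu> ! j \<le> \<mu> ! i"
  using sorted_wrt_nth_less[of "(\<ge>)" \<mu> i j] by (cases "i = j") (auto simp: partitions_def)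

lemma sum_SSYT:
  assumes \<mu>: "\<mu> \<in> partitions n"
  shows "finite {T \<in> SSYT \<mu>. set (concat T) \<subseteq> {..<N}}"
    "(\<Sum>T | T \<in> SSYT \<mu> \<and> set (concat T) \<subseteq> {..<N}. wt x (concat T)) = sch N x (part \<mu>)"
proof -
  let ?A = "{T \<in> SSYT \<mu>. set (concat T) \<subseteq> {..<N}}" and ?i = "\<lambda>F. map F [0..<length \<mu>]"
  have len: "length T = length \<mu>" "\<And>r. r < length \<mu> \<Longrightarrow> length (T ! r) = \<mu> ! r" if "T \<in> SSYT \<mu>" for T
  proof -
    have "map length T = \<mu>" using that by (simp add: SSYT_def)
    then show "length T = length \<mu>" "\<And>r. r < length \<mu> \<Longrightarrow> length (T ! r) = \<mu> ! r" by auto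
  qed
  have j: "row_fun T \<in> ftabs N (part \<mu>)" if T: "T \<in> ?A" for T
  proof -
    have T': "T \<in> SSYT \<mu>" "columns_strict T" and srt: "\<And>R. R \<in> set T \<Longrightarrow> sorted R"
      and bnd: "\<And>R. R \<in> set T \<Longrightarrow> set R \<subseteq> {..<N}" using T by (auto simp: SSYT_def)
    have "length (row_fun T r) = part \<mu> r" "sorted (row_fun T r)" "set (row_fun T r) \<subseteq> {..<N}" for r
      using len[OF T'(1)] srt[of "T ! r"] bnd[of "T ! r"] by (auto simp: row_fun_def part_def)
    moreover have "c < part \<mu> r \<and> row_fun T r ! c < row_fun T (Suc r) ! c" if c: "c < part \<mu> (Suc r)" for r c
    proof -
      have r: "Suc r < length \<mu>" "c < \<mu> ! Suc r" using c by (auto simp: part_def split: if_splits)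
      then have "c < \<mu> ! r" using partitions_nth_mono[OF \<mu>, of r "Suc r"] by simp
      then show ?thesis using r len[OF T'(1)] T'(2) by (auto simp: row_fun_def part_def columns_strict_def)
    qed
    ultimately show ?thesis by (simp add: ftabs_def)
  qed
  have ij: "?i (row_fun T) = T" if "T \<in> ?A" for T
    using len(1)[of T] that by (intro nth_equalityI) (auto simp: row_fun_def)
  have i: "?i F \<in> ?A" and ji: "row_fun (?i F) = F" if F: "F \<in> ftabs N (part \<mu>)" for F
  proof -
    have F': "length (F r) = part \<mu> r" "sorted (F r)" "set (F r) \<subseteq> {..<N}" for r using F by (auto simp: ftabs_def)
    have col: "F r ! c < F (Suc r) ! c" if "c < part \<mu> (Suc r)" for r c using F that by (auto simp: ftabs_def)
    show "row_fun (?i F) = F"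
    proof
      fix r show "row_fun (?i F) r = F r" using F'(1)[of r] by (auto simp: row_fun_def part_def)
    qed
    have "map length (?i F) = \<mu>" using F'(1) by (intro nth_equalityI) (auto simp: part_def)
    moreover have "columns_strict (?i F)" using col F'(1) by (auto simp: columns_strict_def)
    ultimately show "?i F \<in> ?A" using F'(2,3) by (auto simp: SSYT_def)
  qed
  have "?A \<subseteq> ?i ` ftabs N (part \<mu>)" using ij j by (metis (no_types, lifting) image_eqI subsetI)
  then show "finite ?A" using sum_ftabs(1)[OF fin_supp_part] finite_surj by blast
  have wt: "wt x (concat T) = ftab_wt x (row_fun T)" for T
  proof -
    have "wt x (concat T) = (\<Prod>R\<leftarrow>T. wt x R)" by (induction T) auto
    also have "\<dots> = (\<Prod>r<length T. wt x (T ! r))"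
      by (simp add: prod.list_conv_set_nth atLeast0LessThan)
    also have "\<dots> = ftab_wt x (row_fun T)"
      by (subst ftab_wt_eq[of "length T"]) (auto simp: row_fun_def)
    finally show ?thesis .
  qed
  have "(\<Sum>T\<in>?A. wt x (concat T)) = (\<Sum>F\<in>ftabs N (part \<mu>). ftab_wt x F)"
    by (rule sum.reindex_bij_witness[of _ ?i row_fun]) (use ij ji i j wt in auto)
  then show "(\<Sum>T\<in>?A. wt x (concat T)) = sch N x (part \<mu>)" using sum_ftabs(2)[OF fin_supp_part] by simp
qed

section \<open>Standard tableaux as lattice words\<close>

text \<open>One notion for the descents of words, whose blocks are weakly increasing, and the
  ascents of lattice words, whose blocks are weakly decreasing.\<close>

definition dset :: "('a \<Rightarrow> 'a \<Rightarrow> bool) \<Rightarrow> 'a list \<Rightarrow> nat set" where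
  "dset R w = {i. 0 < i \<and> i < length w \<and> R (w ! (i - 1)) (w ! i)}"

abbreviation asc :: "nat list \<Rightarrow> nat set" where
  "asc \<equiv> dset (<)"

lemma wdes_eq_dset: "wdes w = dset (\<lambda>a b. b < a) w"
  by (simp add: wdes_def dset_def)

text \<open>The junction position \<open>length u\<close> is allowed by \<open>D\<close> unless
  \<open>u\<close> is empty, whereas the positions inside \<open>t\<close> avoid \<open>D\<close>,
  so \<open>t\<close> must have no related neighbours; transitivity extends this to all
  pairs.\<close>

lemma dset_append_subset_iff:
  assumes tr: "transp (\<lambda>a b. \<not> R a b)" and n: "length u = 0 \<or> length u \<in> D"
    and D: "\<And>d. d \<in> D \<Longrightarrow> d \<le> length u \<or> length u + length t \<le> d"
  shows "dset R (u @ t) \<subseteq> D \<longleftrightarrow> dset R u \<subseteq> D \<and> sorted_wrt (\<lambda>a b. \<not> R a b) t"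
proof -
  have st: "sorted_wrt (\<lambda>a b. \<not> R a b) t \<longleftrightarrow> (\<forall>i. Suc i < length t \<longrightarrow> \<not> R (t ! i) (t ! Suc i))"
    by (rule sorted_wrt_iff_nth_Suc_transp[OF tr])
  have d1: "i \<in> dset R (u @ t) \<longleftrightarrow> i \<in> dset R u" if "i < length u" for i
    using that by (auto simp: dset_def nth_append)
  have d2: "length u + Suc i \<in> dset R (u @ t) \<longleftrightarrow> Suc i < length t \<and> R (t ! i) (t ! Suc i)" for i
    by (auto simp: dset_def nth_append)
  show ?thesis
  proof
    assume s: "dset R (u @ t) \<subseteq> D"
    have "dset R u \<subseteq> D"
    proof
      fix i assume i: "i \<in> dset R u"
      then have "i < length u" by (simp add: dset_def)
      then show "i \<in> D" using i s d1 by blast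
    qed
    moreover have "\<not> R (t ! i) (t ! Suc i)" if "Suc i < length t" for i
    proof
      assume "R (t ! i) (t ! Suc i)"
      then have "length u + Suc i \<in> D" using s d2[of i] that by blast
      then show False using D[of "length u + Suc i"] that by simp
    qed
    ultimately show "dset R u \<subseteq> D \<and> sorted_wrt (\<lambda>a b. \<not> R a b) t" using st by blast
  next
    assume a: "dset R u \<subseteq> D \<and> sorted_wrt (\<lambda>a b. \<not> R a b) t"
    show "dset R (u @ t) \<subseteq> D"
    proof
      fix i assume i: "i \<in> dset R (u @ t)"
      consider "i < length u" | "i = length u" | j where "i = length u + Suc j"
        by (metis less_imp_Suc_add linorder_neqE_nat add_Suc_right)
      then show "i \<in> D"
      proof cases
        case 1 then show ?thesis using i a d1[of i] by blast
      next
        case 2 then show ?thesis using i n by (auto simp: dset_def)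
      next
        case 3 then show ?thesis using i d2[of j] a st by blast
      qed
    qed
  qed
qed

lemma words_length: "w \<in> words A n \<Longrightarrow> length w = n"
  by (simp add: words_def)

definition shape :: "nat list \<Rightarrow> nat \<Rightarrow> nat" where
  "shape w r = count_list w r"

text \<open>Yamanouchi words: with letter number \<open>i\<close> read as the row of the entry
  \<open>i\<close> of a tableau, the condition says that every initial part of the filling has a
  partition shape.\<close>

definition lattice_word :: "nat list \<Rightarrow> bool" where
  "lattice_word w \<longleftrightarrow> (\<forall>j\<le>length w. \<forall>r. count_list (take j w) (Suc r) \<le> count_list (take j w) r)"

lemma count_list_eq_0: "count_list w r = 0 \<longleftrightarrow> r \<notin> set w"
  by (rule count_list_0_iff)

lemma fin_supp_shape [simp]: "fin_supp (shape w)"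
proof -
  have "\<forall>r\<ge>Suc (Max (insert 0 (set w))). shape w r = 0"
  proof (intro allI impI)
    fix r assume r: "Suc (Max (insert 0 (set w))) \<le> r"
    have "r \<notin> set w"
    proof
      assume "r \<in> set w"
      then have "r \<le> Max (insert 0 (set w))" by (intro Max_ge) auto
      then show False using r by simp
    qed
    then show "shape w r = 0" by (simp add: shape_def count_list_eq_0)
  qed
  then show ?thesis by (auto simp: fin_supp_def)
qed

lemma shape_size_shape [simp]: "shape_size (shape w) = length w"
proof -
  have "{r. shape w r \<noteq> 0} = set w" by (auto simp: shape_def count_list_eq_0)
  then show ?thesis
    unfolding shape_size_def shape_def using sum_count_set[of w "set w"] by simp
qed

lemma lattice_word_take: "lattice_word w \<Longrightarrow> lattice_word (take n w)"
  by (auto simp: lattice_word_def)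

lemma lattice_word_append_left: "lattice_word (u @ t) \<Longrightarrow> lattice_word u"
  using lattice_word_take[of "u @ t" "length u"] by simp

text \<open>A block without ascents adds cells from lower to higher rows, which is how a standard
  tableau fills a horizontal strip from left to right.\<close>

lemma lattice_word_append_iff:
  assumes "sorted_wrt (\<lambda>a b. \<not> a < b) t"
  shows "lattice_word (u @ t) \<longleftrightarrow> lattice_word u \<and> hstrip (shape u) (shape (u @ t))"
proof
  assume l: "lattice_word (u @ t)"
  have "shape (u @ t) (Suc r) \<le> shape u r" for r
  proof -
    \<comment> \<open>The critical prefix: after \<open>j\<close> letters of \<open>t\<close> all
      letters \<open>Suc r\<close> have been read but no letter \<open>r\<close> yet.\<close>
    define j where "j = length (takeWhile (\<lambda>a. r < a) t)"
    have "takeWhile (\<lambda>a. r < a) t = take j t" unfolding j_def by (rule takeWhile_eq_take)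
    then have t1: "\<forall>a\<in>set (take j t). r < a" by (metis set_takeWhileD)
    have t2: "a \<le> r" if "a \<in> set (drop j t)" for a
    proof -
      have d: "drop j t = dropWhile (\<lambda>a. r < a) t" unfolding j_def by (rule dropWhile_eq_drop[symmetric])
      have "dropWhile (\<lambda>a. r < a) t \<noteq> []" using that unfolding d by force
      then obtain b s where bs: "dropWhile (\<lambda>a. r < a) t = b # s" by (metis neq_Nil_conv)
      then have "\<not> r < b" by (simp add: dropWhile_eq_Cons_conv)
      moreover have "sorted_wrt (\<lambda>a b. \<not> a < b) (drop j t)" using assms by (rule sorted_wrt_drop)
      ultimately show ?thesis using that unfolding d bs by auto
    qed
    have "count_list (take j t) r = 0" using t1 by (auto simp: count_list_eq_0)
    moreover have "count_list (drop j t) (Suc r) = 0" using t2 by (fastforce simp: count_list_eq_0)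
    moreover have "count_list (take (length u + j) (u @ t)) (Suc r) \<le> count_list (take (length u + j) (u @ t)) r"
    proof -
      have "j \<le> length t" by (simp add: j_def length_takeWhile_le)
      then have "length u + j \<le> length (u @ t)" by simp
      then show ?thesis using l unfolding lattice_word_def by blast
    qed
    moreover have "count_list t (Suc r) = count_list (take j t) (Suc r) + count_list (drop j t) (Suc r)"
      by (metis append_take_drop_id count_list_append)
    ultimately show ?thesis by (simp add: shape_def)
  qed
  then show "lattice_word u \<and> hstrip (shape u) (shape (u @ t))"
    using lattice_word_append_left[OF l] by (simp add: hstrip_def) (simp add: shape_def)
next
  assume a: "lattice_word u \<and> hstrip (shape u) (shape (u @ t))"
  show "lattice_word (u @ t)"
    unfolding lattice_word_def
  proof (intro allI impI)
    fix j r assume j: "j \<le> length (u @ t)"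
    show "count_list (take j (u @ t)) (Suc r) \<le> count_list (take j (u @ t)) r"
    proof (cases "j \<le> length u")
      case True
      then show ?thesis using a by (simp add: lattice_word_def)
    next
      case False
      define i where "i = j - length u"
      have tk: "take j (u @ t) = u @ take i t" using False by (simp add: i_def)
      have "count_list t (Suc r) = count_list (take i t) (Suc r) + count_list (drop i t) (Suc r)"
        by (metis append_take_drop_id count_list_append)
      moreover have "shape (u @ t) (Suc r) \<le> shape u r" using a by (simp add: hstrip_def)
      ultimately show ?thesis unfolding tk shape_def count_list_append by linarith
    qed
  qed
qed

definition lattice_words :: "nat \<Rightarrow> nat list set" where
  "lattice_words n = {w. length w = n \<and> lattice_word w}"

lemma lattice_words_length: "w \<in> lattice_words n \<Longrightarrow> length w = n"
  by (simp add: lattice_words_def)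

lemma lattice_word_shape_mono:
  assumes "lattice_word w" "i \<le> j"
  shows "shape w j \<le> shape w i"
proof -
  have "shape w (Suc r) \<le> shape w r" for r
    using assms(1) unfolding lattice_word_def shape_def by (metis order_refl take_all)
  then show ?thesis using assms(2) by (rule lift_Suc_antimono_le)
qed

lemma finite_lattice_words [simp]: "finite (lattice_words n)"
proof -
  \<comment> \<open>A letter \<open>r\<close> occurs only together with all smaller letters, so the
    word has at least \<open>Suc r\<close> letters.\<close>
  have "r < length w" if w: "lattice_word w" and r: "r \<in> set w" for w r
  proof -
    have "s \<in> set w" if "s \<le> r" for s
      using lattice_word_shape_mono[OF w that] r count_list_eq_0[of w] by (metis le_zero_eq shape_def)
    then have "{..r} \<subseteq> set w" by auto
    then have "card {..r} \<le> card (set w)" by (intro card_mono) auto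
    then show ?thesis using card_length[of w] by simp
  qed
  then have "lattice_words n \<subseteq> words {..<n} n" by (auto simp: lattice_words_def words_def)
  then show ?thesis by (rule finite_subset) simp
qed

text \<open>A weakly decreasing \<open>t\<close> is determined by its letters, hence by the shape of
  \<open>u @ t\<close>. Conversely the row indices of the cells of a horizontal strip, in decreasing
  order, form such a \<open>t\<close>.\<close>

lemma sum_lattice_extensions:
  fixes g :: "(nat \<Rightarrow> nat) \<Rightarrow> complex"
  assumes u: "lattice_word u"
  shows "(\<Sum>t | length t = k \<and> sorted_wrt (\<lambda>a b. \<not> a < b) t \<and> lattice_word (u @ t). g (shape (u @ t))) =
    (\<Sum>\<mu> | hstrip (shape u) \<mu> \<and> shape_size \<mu> = length u + k. g \<mu>)"
proof (rule sum.reindex_cong[of "\<lambda>t. shape (u @ t)", symmetric])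
  let ?T = "{t. length t = k \<and> sorted_wrt (\<lambda>a b. \<not> a < b) t \<and> lattice_word (u @ t)}"
  have cnt: "count (mset t) r = count_list t r" for t :: "nat list" and r by (simp add: count_mset)
  have srt: "sorted (rev t)" if "sorted_wrt (\<lambda>a b. \<not> a < b) t" for t :: "nat list"
    using that by (simp add: sorted_wrt_rev) (auto simp: not_less intro: sorted_wrt_mono_rel)
  show "inj_on (\<lambda>t. shape (u @ t)) ?T"
  proof (rule inj_onI)
    fix s t assume s: "s \<in> ?T" and t: "t \<in> ?T" and e: "shape (u @ s) = shape (u @ t)"
    have "count_list s r = count_list t r" for r using fun_cong[OF e, of r] by (simp add: shape_def)
    then have "mset (rev s) = mset (rev t)" by (simp add: multiset_eq_iff cnt)
    then have "rev s = rev t" using srt s t by (metis (no_types, lifting) mem_Collect_eq properties_for_sort)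
    then show "s = t" by simp
  qed
  show "{\<mu>. hstrip (shape u) \<mu> \<and> shape_size \<mu> = length u + k} = (\<lambda>t. shape (u @ t)) ` ?T"
  proof (intro equalityI subsetI)
    fix \<mu> assume "\<mu> \<in> {\<mu>. hstrip (shape u) \<mu> \<and> shape_size \<mu> = length u + k}"
    then have h: "hstrip (shape u) \<mu>" and sz: "shape_size \<mu> = length u + k" by auto
    obtain L where L: "\<And>r. L \<le> r \<Longrightarrow> \<mu> r = 0"
      using hstrip_fin_supp_above[OF fin_supp_shape h] by (auto simp: fin_supp_def)
    define M where "M = (\<Sum>r<L. replicate_mset (\<mu> r - shape u r) r)"
    have le: "shape u r \<le> \<mu> r" for r using h by (simp add: hstrip_def)
    have cM: "count M r = \<mu> r - shape u r" for r
      using L[of r] by (cases "r < L") (auto simp: M_def count_sum)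
    define t where "t = rev (sorted_list_of_multiset M)"
    have mt: "mset t = M" by (simp add: t_def)
    have "sorted (sorted_list_of_multiset M)" by simp
    then have st: "sorted_wrt (\<lambda>a b. \<not> a < b) t"
      by (simp add: t_def sorted_wrt_rev) (auto simp: not_less intro: sorted_wrt_mono_rel)
    have shp: "shape (u @ t) = \<mu>"
    proof
      fix r show "shape (u @ t) r = \<mu> r"
        using cM[of r] le[of r] cnt[of t r] by (simp add: shape_def mt)
    qed
    then have "length (u @ t) = length u + k" using sz shape_size_shape[of "u @ t"] by simp
    then have "t \<in> ?T" using st h u shp lattice_word_append_iff[OF st, of u] by simp
    then show "\<mu> \<in> (\<lambda>t. shape (u @ t)) ` ?T" using shp by blast
  next
    fix \<mu> assume "\<mu> \<in> (\<lambda>t. shape (u @ t)) ` ?T"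
    then obtain t where t: "t \<in> ?T" "\<mu> = shape (u @ t)" by auto
    then show "\<mu> \<in> {\<mu>. hstrip (shape u) \<mu> \<and> shape_size \<mu> = length u + k}"
      using lattice_word_append_iff[of t u] by simp
  qed
qed simp

lemma sum_split_append:
  assumes fW: "finite W" and fU: "finite U" and fT: "\<And>u. u \<in> U \<Longrightarrow> finite (T u)"
    and W: "\<And>u t. length u = m \<Longrightarrow> u @ t \<in> W \<longleftrightarrow> u \<in> U \<and> t \<in> T u"
    and m: "\<And>w. w \<in> W \<Longrightarrow> m \<le> length w" "\<And>u. u \<in> U \<Longrightarrow> length u = m"
  shows "(\<Sum>w\<in>W. f w) = (\<Sum>u\<in>U. \<Sum>t\<in>T u. f (u @ t))"
proof -
  have "(\<Sum>w\<in>W. f w) = (\<Sum>p\<in>Sigma U T. f (fst p @ snd p))"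
  proof (rule sum.reindex_bij_witness[of _ "\<lambda>(u, t). u @ t" "\<lambda>w. (take m w, drop m w)"])
    fix w assume w: "w \<in> W"
    have "take m w @ drop m w \<in> W" "length (take m w) = m" using w m(1)[OF w] by auto
    then have "take m w \<in> U \<and> drop m w \<in> T (take m w)" using W by blast
    then show "(take m w, drop m w) \<in> Sigma U T" by simp
  next
    fix p assume p: "p \<in> Sigma U T"
    show "(case p of (u, t) \<Rightarrow> u @ t) \<in> W" using p W m(2) by auto
    show "(\<lambda>w. (take m w, drop m w)) (case p of (u, t) \<Rightarrow> u @ t) = p" using p m(2) by auto
  qed auto
  then show ?thesis using fU fT by (subst sum.Sigma) (auto simp: case_prod_unfold)
qed

text \<open>
  Cutting words and lattice words at the last element of \<open>D\<close> reduces the last block to Pieri's rule.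
\<close>

lemma sum_words_wdes_subset:
  "(\<Sum>w | w \<in> words {..<N} n \<and> wdes w \<subseteq> D. wt x w) =
    (\<Sum>v | v \<in> lattice_words n \<and> asc v \<subseteq> D. sch N x (shape v))"
proof (induction n rule: less_induct)
  case (less n)
  show ?case
  proof (cases "n = 0")
    case True
    have "{w. w \<in> words {..<N} 0 \<and> wdes w \<subseteq> D} = {[]}" by (auto simp: wdes_def)
    moreover have "{v. v \<in> lattice_words 0 \<and> asc v \<subseteq> D} = {[]}"
      by (auto simp: lattice_words_def lattice_word_def dset_def)
    moreover have "shape [] = (\<lambda>_. 0)" by (auto simp: shape_def)
    ultimately show ?thesis using True by (simp add: sch_0)
  next
    case False
    \<comment> \<open>The last cut before \<open>n\<close>: no element of \<open>D\<close> lies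
      strictly between \<open>m\<close> and \<open>n\<close>. The inserted 0 serves the case without
      a cut, when the whole word is one block.\<close>
    define m where "m = Max (insert 0 (D \<inter> {..<n}))"
    define k where "k = n - m"
    have fin: "finite (insert 0 (D \<inter> {..<n}))" by simp
    have "m \<in> insert 0 (D \<inter> {..<n})" unfolding m_def by (rule Max_in) auto
    then have m: "m < n" "m = 0 \<or> m \<in> D" using False by auto
    have n: "n = m + k" using m by (simp add: k_def)
    have D: "d \<le> m \<or> m + k \<le> d" if "d \<in> D" for d
    proof (cases "d < n")
      case True
      then have "d \<le> m" unfolding m_def using that by (intro Max_ge[OF fin]) auto
      then show ?thesis ..
    qed (simp add: n)
    have 1: "wdes (u @ t) \<subseteq> D \<longleftrightarrow> wdes u \<subseteq> D \<and> sorted t" if "length u = m" "length t = k" for u t :: "nat list"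
      unfolding wdes_eq_dset
      using dset_append_subset_iff[of "\<lambda>a b. b < a" u D t] that m D by (simp add: transp_on_def not_less)
    have 2: "asc (u @ t) \<subseteq> D \<longleftrightarrow> asc u \<subseteq> D \<and> sorted_wrt (\<lambda>a b. \<not> a < b) t" if "length u = m" "length t = k" for u t
      using dset_append_subset_iff[of "(<)" u D t] that m D by (simp add: transp_on_def)
    let ?U = "{w. w \<in> words {..<N} m \<and> wdes w \<subseteq> D}" and ?V = "{v. v \<in> lattice_words m \<and> asc v \<subseteq> D}"
    let ?E = "\<lambda>u. {t. length t = k \<and> sorted_wrt (\<lambda>a b. \<not> a < b) t \<and> lattice_word (u @ t)}"
    have "(\<Sum>w | w \<in> words {..<N} n \<and> wdes w \<subseteq> D. wt x w) =
        (\<Sum>u\<in>?U. \<Sum>t | t \<in> words {..<N} k \<and> sorted t. wt x (u @ t))"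
    proof (rule sum_split_append[where m = m])
      fix u t :: "nat list" assume u: "length u = m"
      show "u @ t \<in> {w. w \<in> words {..<N} n \<and> wdes w \<subseteq> D} \<longleftrightarrow>
          u \<in> ?U \<and> t \<in> {t. t \<in> words {..<N} k \<and> sorted t}"
        using u 1[of u t] by (auto simp: words_def n)
    qed (auto simp: words_length n)
    also have "\<dots> = (\<Sum>u\<in>?U. wt x u) * hom_sym N x k"
      by (simp add: sum_product hom_sym_eq_sum_sorted)
    also have "(\<Sum>u\<in>?U. wt x u) = (\<Sum>v\<in>?V. sch N x (shape v))" by (rule less.IH[OF m(1)])
    also have "\<dots> * hom_sym N x k = (\<Sum>u\<in>?V. \<Sum>t\<in>?E u. sch N x (shape (u @ t)))"
      unfolding sum_distrib_right
    proof (rule sum.cong)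
      fix u assume "u \<in> ?V"
      then have u: "lattice_word u" "length u = m" by (auto simp: lattice_words_def)
      show "sch N x (shape u) * hom_sym N x k = (\<Sum>t\<in>?E u. sch N x (shape (u @ t)))"
        unfolding sum_lattice_extensions[OF u(1), of "sch N x" k]
        using pieri[OF fin_supp_shape[of u], of N x k] by simp
    qed simp
    also have "\<dots> = (\<Sum>v | v \<in> lattice_words n \<and> asc v \<subseteq> D. sch N x (shape v))"
    proof (rule sum_split_append[where m = m, symmetric])
      fix u t :: "nat list" assume u: "length u = m"
      show "u @ t \<in> {v. v \<in> lattice_words n \<and> asc v \<subseteq> D} \<longleftrightarrow> u \<in> ?V \<and> t \<in> ?E u"
        using u 2[of u t] lattice_word_append_left[of u t] by (auto simp: lattice_words_def n)
    next
      fix u assume "u \<in> ?V"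
      then have "length u = m" by (simp add: lattice_words_def)
      then have "(\<lambda>t. u @ t) ` ?E u \<subseteq> lattice_words n" by (auto simp: lattice_words_def n)
      then have "finite ((\<lambda>t. u @ t) ` ?E u)" by (rule finite_subset) simp
      then show "finite (?E u)" by (rule finite_imageD) (simp add: inj_on_def)
    qed (auto simp: lattice_words_length n)
    finally show ?thesis .
  qed
qed

text \<open>Inversion over the subset lattice: by induction on \<open>D\<close> the sums with the
  set equal to \<open>D\<close> agree, and any condition \<open>P\<close> is a disjoint union of
  such cases.\<close>

lemma sums_agree_from_subsets:
  fixes a :: "'a \<Rightarrow> complex" and b :: "'b \<Rightarrow> complex" and f :: "'a \<Rightarrow> nat set" and g :: "'b \<Rightarrow> nat set"
  assumes fin: "finite A" "finite B" "finite U" and f: "f ` A \<subseteq> Pow U" and g: "g ` B \<subseteq> Pow U"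
    and eq: "\<And>D. D \<subseteq> U \<Longrightarrow> (\<Sum>w | w \<in> A \<and> f w \<subseteq> D. a w) = (\<Sum>v | v \<in> B \<and> g v \<subseteq> D. b v)"
  shows "(\<Sum>w | w \<in> A \<and> P (f w). a w) = (\<Sum>v | v \<in> B \<and> P (g v). b v)"
proof -
  have grp: "(\<Sum>w | w \<in> X \<and> h w \<in> \<D>. c w) = (\<Sum>E\<in>\<D>. \<Sum>w | w \<in> X \<and> h w = E. c w)"
    if "finite X" "finite \<D>" for X :: "'c set" and h :: "'c \<Rightarrow> nat set" and \<D> and c :: "'c \<Rightarrow> complex"
  proof -
    have "(\<Sum>E\<in>\<D>. \<Sum>w | w \<in> {w \<in> X. h w \<in> \<D>} \<and> h w = E. c w) = (\<Sum>w | w \<in> X \<and> h w \<in> \<D>. c w)"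
      by (rule sum.group) (use that in auto)
    moreover have "{w. w \<in> {w \<in> X. h w \<in> \<D>} \<and> h w = E} = {w. w \<in> X \<and> h w = E}" if "E \<in> \<D>" for E
      using that by auto
    ultimately show ?thesis by simp
  qed
  have pt: "(\<Sum>w | w \<in> A \<and> f w = D. a w) = (\<Sum>v | v \<in> B \<and> g v = D. b v)" if "D \<subseteq> U" for D
  proof -
    have "finite D" using that fin(3) by (rule finite_subset)
    then show ?thesis using that
    proof (induction D rule: finite_psubset_induct)
      case (psubset D)
      have fD: "finite (Pow D)" using psubset.hyps by simp
      have sp: "(\<Sum>E\<in>Pow D. h E) = h D + (\<Sum>E\<in>Pow D - {D}. h E)" for h :: "nat set \<Rightarrow> complex"
        by (rule sum.remove[OF fD]) simp
      have "(\<Sum>E\<in>Pow D - {D}. \<Sum>w | w \<in> A \<and> f w = E. a w) = (\<Sum>E\<in>Pow D - {D}. \<Sum>v | v \<in> B \<and> g v = E. b v)"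
        by (rule sum.cong[OF refl]) (use psubset in auto)
      moreover have "(\<Sum>E\<in>Pow D. \<Sum>w | w \<in> A \<and> f w = E. a w) = (\<Sum>E\<in>Pow D. \<Sum>v | v \<in> B \<and> g v = E. b v)"
        using eq[OF psubset.prems] grp[OF fin(1) fD, of a f] grp[OF fin(2) fD, of b g] by simp
      ultimately show ?case unfolding sp by simp
    qed
  qed
  let ?D = "{D. D \<subseteq> U \<and> P D}"
  have fD: "finite ?D" using fin(3) by simp
  have "(\<Sum>w | w \<in> A \<and> P (f w). a w) = (\<Sum>w | w \<in> A \<and> f w \<in> ?D. a w)"
    by (rule sum.cong) (use f in auto)
  also have "\<dots> = (\<Sum>v | v \<in> B \<and> g v \<in> ?D. b v)"
    unfolding grp[OF fin(1) fD] grp[OF fin(2) fD] by (rule sum.cong) (use pt in auto)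
  also have "\<dots> = (\<Sum>v | v \<in> B \<and> P (g v). b v)"
    by (rule sum.cong) (use g in auto)
  finally show ?thesis .
qed

lemma sum_words_wdes:
  "(\<Sum>w | w \<in> words {..<N} n \<and> P (wdes w). wt x w) =
    (\<Sum>v | v \<in> lattice_words n \<and> P (asc v). sch N x (shape v))"
proof (rule sums_agree_from_subsets)
  show "finite (words {..<N} n)" "finite (lattice_words n)" "finite {..<n}" by simp_all
  show "wdes ` words {..<N} n \<subseteq> Pow {..<n}" by (auto simp: wdes_def words_length)
  show "asc ` lattice_words n \<subseteq> Pow {..<n}" by (auto simp: dset_def lattice_words_length)
qed (rule sum_words_wdes_subset)

section \<open>The bijection between lattice words and standard tableaux\<close>

definition positions :: "nat list \<Rightarrow> nat \<Rightarrow> nat list" where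
  "positions w r = filter (\<lambda>i. w ! i = r) [0..<length w]"

lemma sorted_positions: "sorted_wrt (<) (positions w r)"
  unfolding positions_def by (rule sorted_wrt_filter) (rule sorted_wrt_upt)

lemma set_positions: "set (positions w r) = {i. i < length w \<and> w ! i = r}"
  by (auto simp: positions_def)

text \<open>In an increasing list the elements below \<open>j\<close> form a prefix.\<close>

lemma nth_less_iff_length_filter:
  "sorted_wrt (<) P \<Longrightarrow> c < length P \<Longrightarrow> P ! c < (j :: nat) \<longleftrightarrow> c < length (filter (\<lambda>i. i < j) P)"
proof (induction P arbitrary: c)
  case (Cons a P)
  show ?case
  proof (cases "a < j")
    case True
    then show ?thesis using Cons by (cases c) auto
  next
    case False
    then have "filter (\<lambda>i. i < j) (a # P) = []" using Cons.prems by (auto simp: filter_empty_conv)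
    moreover have "\<not> (a # P) ! c < j" using False Cons.prems nth_mem[of c "a # P"] by fastforce
    ultimately show ?thesis by simp
  qed
qed simp

lemma count_list_take:
  assumes "j \<le> length w"
  shows "count_list (take j w) r = length (filter (\<lambda>i. i < j) (positions w r))"
proof -
  have "filter (\<lambda>i. i < j) [0..<length w] = [0..<j]"
  proof -
    have "[0..<length w] = [0..<j] @ [j..<length w]" using assms upt_add_eq_append[of 0 j "length w - j"] by simp
    then show ?thesis by (simp add: filter_empty_conv)
  qed
  then have "filter (\<lambda>i. i < j) (positions w r) = filter (\<lambda>i. w ! i = r) [0..<j]"
    unfolding positions_def by (simp add: filter_filter conj_commute flip: filter_filter[of "\<lambda>i. w ! i = r" "\<lambda>i. i < j"])
  moreover have "take j w = map ((!) w) [0..<j]" by (rule nth_equalityI) (use assms in auto)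
  moreover have "count_list xs r = length (filter (\<lambda>x. x = r) xs)" for xs
    by (induction xs) auto
  ultimately show ?thesis by (simp add: filter_map o_def)
qed

lemma length_positions: "length (positions w r) = shape w r"
proof -
  have "filter (\<lambda>i. i < length w) (positions w r) = positions w r"
    by (auto simp: filter_id_conv set_positions)
  then show ?thesis using count_list_take[of "length w" w r] by (simp add: shape_def)
qed

text \<open>The positions of \<open>r\<close>, raised by one, will be row \<open>r\<close> of the
  tableau, so the right-hand side is column strictness. The critical prefix is the one ending at the
  occurrence of \<open>Suc r\<close> with index \<open>c\<close>: it must already contain
  \<open>Suc c\<close> letters \<open>r\<close>.\<close>

lemma lattice_word_iff_positions:
  "lattice_word w \<longleftrightarrow> (\<forall>r c. c < shape w (Suc r) \<longrightarrow> c < shape w r \<and> positions w r ! c < positions w (Suc r) ! c)"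
proof
  assume l: "lattice_word w"
  show "\<forall>r c. c < shape w (Suc r) \<longrightarrow> c < shape w r \<and> positions w r ! c < positions w (Suc r) ! c"
  proof (intro allI impI)
    fix r c assume c: "c < shape w (Suc r)"
    let ?p = "positions w (Suc r) ! c"
    have "shape w (Suc r) \<le> shape w r" by (rule lattice_word_shape_mono[OF l]) simp
    then have cr: "c < shape w r" using c by simp
    have "?p \<in> set (positions w (Suc r))" using c by (simp add: length_positions)
    then have p: "?p < length w" "w ! ?p = Suc r" by (auto simp: set_positions)
    have "?p < Suc ?p" by simp
    then have "c < length (filter (\<lambda>i. i < Suc ?p) (positions w (Suc r)))"
      using nth_less_iff_length_filter[OF sorted_positions, of c w "Suc r" "Suc ?p"] c by (simp add: length_positions)
    also have "\<dots> = count_list (take (Suc ?p) w) (Suc r)" using p by (subst count_list_take) auto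
    also have "\<dots> \<le> count_list (take (Suc ?p) w) r" using l p by (simp add: lattice_word_def)
    also have "\<dots> = length (filter (\<lambda>i. i < Suc ?p) (positions w r))" using p by (subst count_list_take) auto
    finally have "positions w r ! c < Suc ?p"
      using nth_less_iff_length_filter[OF sorted_positions, of c w r "Suc ?p"] cr by (simp add: length_positions)
    moreover have "positions w r ! c \<in> set (positions w r)" using cr by (simp add: length_positions)
    then have "w ! (positions w r ! c) = r" by (auto simp: set_positions)
    then have "positions w r ! c \<noteq> ?p" using p by auto
    ultimately show "c < shape w r \<and> positions w r ! c < ?p" using cr by simp
  qed
next
  assume a: "\<forall>r c. c < shape w (Suc r) \<longrightarrow> c < shape w r \<and> positions w r ! c < positions w (Suc r) ! c"
  show "lattice_word w"
    unfolding lattice_word_def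
  proof (intro allI impI)
    fix j r assume j: "j \<le> length w"
    show "count_list (take j w) (Suc r) \<le> count_list (take j w) r"
    proof (cases "count_list (take j w) (Suc r)")
      case (Suc c)
      then have c: "c < length (filter (\<lambda>i. i < j) (positions w (Suc r)))" using count_list_take[OF j, of "Suc r"] by simp
      also have "\<dots> \<le> shape w (Suc r)" unfolding length_positions[symmetric] by (rule length_filter_le)
      finally have cs: "c < shape w (Suc r)" .
      have "positions w (Suc r) ! c < j"
        using nth_less_iff_length_filter[OF sorted_positions, of c w "Suc r" j] c cs by (simp add: length_positions)
      then have "positions w r ! c < j" "c < shape w r" using a cs by (auto intro: less_trans)
      then have "c < length (filter (\<lambda>i. i < j) (positions w r))"
        using nth_less_iff_length_filter[OF sorted_positions, of c w r j] by (simp add: length_positions)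
      then show ?thesis using Suc count_list_take[OF j, of r] by simp
    qed simp
  qed
qed

definition word_tab :: "nat list \<Rightarrow> nat list \<Rightarrow> nat list list" where
  "word_tab \<mu> w = map (\<lambda>r. map Suc (positions w r)) [0..<length \<mu>]"

definition tab_word :: "nat \<Rightarrow> nat list list \<Rightarrow> nat list" where
  "tab_word n T = map (\<lambda>i. THE r. r < length T \<and> Suc i \<in> set (T ! r)) [0..<n]"

text \<open>The entry \<open>Suc i\<close> is put into row \<open>w ! i\<close>, and lower rows have
  larger indices, so the descents of the tableau are the ascents of the word.\<close>

lemma word_tab_in_SYT:
  assumes \<mu>: "\<mu> \<in> partitions n" and w: "w \<in> lattice_words n" "shape w = part \<mu>"
  shows "word_tab \<mu> w \<in> SYT \<mu>" "Des (word_tab \<mu> w) = asc w" "tab_word n (word_tab \<mu> w) = w"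
proof -
  let ?T = "word_tab \<mu> w"
  have len: "length w = n" and l: "lattice_word w" using w by (auto simp: lattice_words_def)
  have nth: "?T ! r = map Suc (positions w r)" if "r < length \<mu>" for r
    using that by (simp add: word_tab_def)
  have lT: "length ?T = length \<mu>" by (simp add: word_tab_def)
  have lp: "length (positions w r) = part \<mu> r" for r by (simp add: length_positions w(2))
  have wl: "w ! i < length \<mu>" if "i < n" for i
  proof -
    have "w ! i \<in> set w" using that len by simp
    then have "shape w (w ! i) \<noteq> 0" by (simp add: shape_def count_list_eq_0)
    then show ?thesis using w(2) by (simp add: part_def split: if_splits)
  qed
  have mem: "i \<in> set (?T ! r) \<longleftrightarrow> 0 < i \<and> i \<le> n \<and> w ! (i - 1) = r" if "r < length \<mu>" for i r
    using nth[OF that] len by (cases i) (auto simp: set_positions image_iff)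
  have ml: "map length ?T = \<mu>"
    by (rule nth_equalityI) (auto simp: word_tab_def lp part_def)
  have sr: "sorted_wrt (<) R" if "R \<in> set ?T" for R
    using that sorted_positions by (auto simp: word_tab_def sorted_wrt_map)
  have sc: "set (concat ?T) = {1..n}"
  proof -
    have "set (concat ?T) = (\<Union>r<length \<mu>. set (map Suc (positions w r)))"
      by (simp add: word_tab_def atLeast0LessThan)
    also have "\<dots> = (\<Union>r<length \<mu>. set (?T ! r))"
      by (rule SUP_cong) (simp_all add: nth)
    also have "\<dots> = {1..n}"
    proof (intro equalityI subsetI)
      fix i assume "i \<in> {1..n}"
      then have "0 < i" "i \<le> n" "w ! (i - 1) < length \<mu>" using wl[of "i - 1"] by auto
      then show "i \<in> (\<Union>r<length \<mu>. set (?T ! r))" using mem[of "w ! (i - 1)" i] by blast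
    qed (auto simp: mem)
    finally show ?thesis .
  qed
  have "length (concat ?T) = n"
    using ml \<mu> by (simp add: length_concat partitions_def)
  then have dc: "distinct (concat ?T)" using sc by (intro card_distinct) simp
  have "columns_strict ?T"
    unfolding columns_strict_def
  proof (intro allI impI)
    fix r c assume rc: "Suc r < length ?T \<and> c < length (?T ! r) \<and> c < length (?T ! Suc r)"
    then have c: "c < shape w (Suc r)" using nth[of "Suc r"] lT by (simp add: length_positions)
    then have "c < shape w r" "positions w r ! c < positions w (Suc r) ! c"
      using l lattice_word_iff_positions by auto
    then show "?T ! r ! c < ?T ! Suc r ! c" using rc lT c by (simp add: nth length_positions)
  qed
  moreover have "sum_list \<mu> = n" using \<mu> by (simp add: partitions_def)
  ultimately show T: "?T \<in> SYT \<mu>" using ml sr dc sc by (simp add: SYT_def)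
  show "Des ?T = asc w"
  proof (intro equalityI subsetI)
    fix i assume "i \<in> Des ?T"
    then obtain r r' where rr: "r < r'" "r' < length \<mu>" "i \<in> set (?T ! r)" "Suc i \<in> set (?T ! r')"
      by (auto simp: Des_def lT)
    then show "i \<in> asc w" using mem[of r i] mem[of r' "Suc i"] len by (auto simp: dset_def)
  next
    fix i assume "i \<in> asc w"
    then have i: "0 < i" "i < n" "w ! (i - 1) < w ! i" using len by (auto simp: dset_def)
    then have "i \<in> set (?T ! (w ! (i - 1)))" "Suc i \<in> set (?T ! (w ! i))"
      using mem[of "w ! (i - 1)" i] mem[of "w ! i" "Suc i"] wl[of i] by auto
    then show "i \<in> Des ?T" using i wl[of i] by (auto simp: Des_def lT)
  qed
  show "tab_word n ?T = w"
  proof (rule nth_equalityI)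
    fix i assume "i < length (tab_word n ?T)"
    then have i: "i < n" by (simp add: tab_word_def)
    have "(THE r. r < length ?T \<and> Suc i \<in> set (?T ! r)) = w ! i"
      using wl[OF i] i mem by (intro the_equality) (auto simp: lT)
    then show "tab_word n ?T ! i = w ! i" using i by (simp add: tab_word_def)
  qed (simp add: tab_word_def len)
qed

lemma tab_word_in_lattice_words:
  assumes \<mu>: "\<mu> \<in> partitions n" and T: "T \<in> SYT \<mu>"
  shows "tab_word n T \<in> lattice_words n" "shape (tab_word n T) = part \<mu>" "word_tab \<mu> (tab_word n T) = T"
proof -
  let ?w = "tab_word n T"
  have ml: "map length T = \<mu>" and sr: "\<And>R. R \<in> set T \<Longrightarrow> sorted_wrt (<) R" and cs: "columns_strict T"
    and dc: "distinct (concat T)" and sc: "set (concat T) = {1..n}"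
    using T \<mu> by (auto simp: SYT_def partitions_def)
  have lT: "length T = length \<mu>" and lr: "length (T ! r) = \<mu> ! r" if "r < length \<mu>" for r
    using ml that by (auto simp flip: ml)
  have lT: "length T = length \<mu>" using ml by auto
  have ne: "[] \<notin> set T"
  proof
    assume "[] \<in> set T"
    then have "0 \<in> set (map length T)" by force
    then show False using ml \<mu> by (auto simp: partitions_def)
  qed
  then have "removeAll [] T = T" by (simp add: removeAll_id)
  then have dT: "distinct T" and dj: "\<And>R S. R \<in> set T \<Longrightarrow> S \<in> set T \<Longrightarrow> R \<noteq> S \<Longrightarrow> set R \<inter> set S = {}"
    using dc by (auto simp: distinct_concat_iff)
  have uniq: "r = s" if "r < length \<mu>" "s < length \<mu>" "i \<in> set (T ! r)" "i \<in> set (T ! s)" for r s i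
  proof -
    have "T ! r = T ! s" using dj[of "T ! r" "T ! s"] that lT by auto
    then show ?thesis using dT that lT nth_eq_iff_index_eq by metis
  qed
  have ex: "\<exists>r<length \<mu>. i \<in> set (T ! r)" if "0 < i" "i \<le> n" for i
  proof -
    have "i \<in> set (concat T)" using sc that by simp
    then obtain R where R: "R \<in> set T" "i \<in> set R" by auto
    then obtain r where "r < length T" "T ! r = R" by (auto simp: in_set_conv_nth)
    then show ?thesis using R lT by auto
  qed
  have wi: "?w ! i < length \<mu>" "Suc i \<in> set (T ! (?w ! i))" if i: "i < n" for i
  proof -
    have "\<exists>!r. r < length T \<and> Suc i \<in> set (T ! r)" using ex[of "Suc i"] uniq[of _ _ "Suc i"] i lT by (metis Suc_leI zero_less_Suc)
    from theI'[OF this] show "?w ! i < length \<mu>" "Suc i \<in> set (T ! (?w ! i))"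
      using i lT by (auto simp: tab_word_def)
  qed
  have len: "length ?w = n" by (simp add: tab_word_def)
  have row: "map Suc (positions ?w r) = T ! r" if r: "r < length \<mu>" for r
  proof (rule strict_sorted_equal)
    show "sorted_wrt (<) (map Suc (positions ?w r))" using sorted_positions by (simp add: sorted_wrt_map)
    show "sorted_wrt (<) (T ! r)" using sr r lT by simp
    show "set (map Suc (positions ?w r)) = set (T ! r)"
    proof (intro equalityI subsetI)
      fix i assume i: "i \<in> set (T ! r)"
      then have "i \<in> set (concat T)" using r lT by auto
      then have "i \<in> {1..n}" unfolding sc .
      then have i': "0 < i" "i \<le> n" "i - 1 < n" "Suc (i - 1) = i" by auto
      then have "?w ! (i - 1) = r" using wi[of "i - 1"] uniq[of "?w ! (i - 1)" r i] i r by simp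
      then have "i - 1 \<in> set (positions ?w r)" using i' len by (simp add: set_positions)
      then show "i \<in> set (map Suc (positions ?w r))" using i'(4) by (metis image_eqI list.set_map)
    next
      fix i assume "i \<in> set (map Suc (positions ?w r))"
      then obtain j where "i = Suc j" "j < n" "?w ! j = r" using len by (auto simp: set_positions)
      then show "i \<in> set (T ! r)" using wi(2)[of j] by simp
    qed
  qed
  have shp: "shape ?w r = part \<mu> r" for r
  proof (cases "r < length \<mu>")
    case True
    then have "length (positions ?w r) = \<mu> ! r" using row[OF True] lr[OF True] by (metis length_map)
    then show ?thesis using True by (simp add: part_def length_positions)
  next
    case False
    then have "r \<notin> set ?w" using wi(1) len by (auto simp: in_set_conv_nth)
    then show ?thesis using False by (simp add: part_def shape_def count_list_eq_0)
  qed
  then show "shape ?w = part \<mu>" by blast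
  show "word_tab \<mu> ?w = T"
    by (rule nth_equalityI) (auto simp: word_tab_def lT row)
  have "lattice_word ?w"
    unfolding lattice_word_iff_positions shp
  proof (intro allI impI)
    fix r c assume c: "c < part \<mu> (Suc r)"
    then have r: "Suc r < length \<mu>" "c < \<mu> ! Suc r" by (auto simp: part_def split: if_splits)
    have "c < \<mu> ! r" using partitions_nth_mono[OF \<mu>, of r "Suc r"] r by simp
    then have "T ! r ! c < T ! Suc r ! c" using cs r lT lr unfolding columns_strict_def by simp
    moreover have "T ! r ! c = Suc (positions ?w r ! c)" "T ! Suc r ! c = Suc (positions ?w (Suc r) ! c)"
      using row[of r] row[of "Suc r"] r \<open>c < \<mu> ! r\<close> shp[of r] shp[of "Suc r"]
      by (auto simp: length_positions part_def simp flip: row)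
    ultimately show "c < part \<mu> r \<and> positions ?w r ! c < positions ?w (Suc r) ! c"
      using r \<open>c < \<mu> ! r\<close> by (simp add: part_def)
  qed
  then show "?w \<in> lattice_words n" by (simp add: lattice_words_def len)
qed

lemma card_SYT_eq_card_lattice_words:
  assumes \<mu>: "\<mu> \<in> partitions n"
  shows "card {T \<in> SYT \<mu>. P (Des T)} = card {w \<in> lattice_words n. shape w = part \<mu> \<and> P (asc w)}"
proof (rule bij_betw_same_card[symmetric])
  show "bij_betw (word_tab \<mu>) {w \<in> lattice_words n. shape w = part \<mu> \<and> P (asc w)} {T \<in> SYT \<mu>. P (Des T)}"
  proof (rule bij_betw_byWitness[where f' = "tab_word n"])
    show "tab_word n ` {T \<in> SYT \<mu>. P (Des T)} \<subseteq> {w \<in> lattice_words n. shape w = part \<mu> \<and> P (asc w)}"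
    proof
      fix w assume "w \<in> tab_word n ` {T \<in> SYT \<mu>. P (Des T)}"
      then obtain T where T: "w = tab_word n T" "T \<in> SYT \<mu>" "P (Des T)" by auto
      note t = tab_word_in_lattice_words[OF \<mu> T(2)]
      have "Des T = asc w" using word_tab_in_SYT(2)[OF \<mu> t(1,2)] t(3) T(1) by simp
      then show "w \<in> {w \<in> lattice_words n. shape w = part \<mu> \<and> P (asc w)}" using t T by simp
    qed
  qed (use word_tab_in_SYT[OF \<mu>] tab_word_in_lattice_words[OF \<mu>] in auto)
qed

lemma part_inj:
  assumes "\<mu> \<in> partitions m" "\<mu>' \<in> partitions n" "part \<mu> = part \<mu>'"
  shows "\<mu> = \<mu>'"
proof -
  have nz: "i < length \<nu> \<longleftrightarrow> part \<nu> i \<noteq> 0" if "\<nu> \<in> partitions k" for \<nu> k i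
    using that by (auto simp: part_def partitions_def)
  have "i < length \<mu> \<longleftrightarrow> i < length \<mu>'" for i using nz assms by metis
  then have l: "length \<mu> = length \<mu>'" by (metis linorder_neqE_nat less_irrefl)
  show ?thesis
  proof (rule nth_equalityI[OF l])
    fix i assume "i < length \<mu>"
    then show "\<mu> ! i = \<mu>' ! i" using fun_cong[OF assms(3), of i] l by (simp add: part_def)
  qed
qed

lemma ex_partition_of_shape:
  assumes w: "w \<in> lattice_words n"
  shows "\<exists>\<mu>\<in>partitions n. shape w = part \<mu>"
proof -
  have l: "lattice_word w" and len: "length w = n" using w by (auto simp: lattice_words_def)
  obtain L where L: "\<forall>i\<ge>L. shape w i = 0" using fin_supp_shape[of w] by (auto simp: fin_supp_def)
  \<comment> \<open>The number of nonempty rows; since \<open>shape w\<close> is weakly decreasing,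
    all rows from the first empty one on are empty.\<close>
  define k where "k = (LEAST i. shape w i = 0)"
  have k0: "shape w k = 0" unfolding k_def by (rule LeastI[of "\<lambda>i. shape w i = 0" L]) (use L in blast)
  have lt: "shape w i \<noteq> 0" if "i < k" for i using not_less_Least[of i "\<lambda>i. shape w i = 0"] that unfolding k_def by blast
  have ge: "shape w i = 0" if "k \<le> i" for i using lattice_word_shape_mono[OF l that] k0 by simp
  define \<mu> where "\<mu> = map (shape w) [0..<k]"
  have "part \<mu> = shape w" using ge by (intro ext) (simp add: part_def \<mu>_def)
  moreover have "\<mu> \<in> partitions n"
  proof -
    have "sorted_wrt (\<ge>) \<mu>"
      unfolding sorted_wrt_iff_nth_less using lattice_word_shape_mono[OF l] by (simp add: \<mu>_def)
    moreover have "\<forall>p\<in>set \<mu>. 0 < p" using lt by (auto simp: \<mu>_def)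
    moreover have "sum_list \<mu> = shape_size (shape w)"
      unfolding \<mu>_def by (subst shape_size_eq[of k]) (auto simp: ge interv_sum_list_conv_sum_set_nat atLeast0LessThan)
    ultimately show ?thesis using len by (simp add: partitions_def)
  qed
  ultimately show ?thesis by metis
qed

lemma finite_partitions [simp]: "finite (partitions n)"
proof (rule finite_subset)
  show "partitions n \<subseteq> {xs. set xs \<subseteq> {..n} \<and> length xs \<le> n}"
  proof
    fix \<mu> assume "\<mu> \<in> partitions n"
    then have p: "\<forall>p\<in>set \<mu>. 0 < p" "sum_list \<mu> = n" by (auto simp: partitions_def)
    have "length \<mu> \<le> sum_list \<mu>" using p(1) by (induction \<mu>) auto
    moreover have "set \<mu> \<subseteq> {..n}" using p(2) member_le_sum_list[of _ \<mu>] by auto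
    ultimately show "\<mu> \<in> {xs. set xs \<subseteq> {..n} \<and> length xs \<le> n}" using p by simp
  qed
  show "finite {xs. set xs \<subseteq> {..n} \<and> length xs \<le> n}" by (rule finite_lists_length_le) simp
qed

lemma sum_lattice_words_eq_sum_SYT:
  "(\<Sum>v | v \<in> lattice_words n \<and> P (asc v). g (shape v) :: complex) =
    (\<Sum>\<mu>\<in>partitions n. of_nat (card {T \<in> SYT \<mu>. P (Des T)}) * g (part \<mu>))"
proof -
  let ?V = "\<lambda>\<mu>. {v. v \<in> lattice_words n \<and> shape v = part \<mu> \<and> P (asc v)}"
  have "{v. v \<in> lattice_words n \<and> P (asc v)} = (\<Union>\<mu>\<in>partitions n. ?V \<mu>)"
    using ex_partition_of_shape by blast
  then have "(\<Sum>v | v \<in> lattice_words n \<and> P (asc v). g (shape v)) = (\<Sum>\<mu>\<in>partitions n. \<Sum>v\<in>?V \<mu>. g (shape v))"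
    using part_inj by (simp only:) (rule sum.UNION_disjoint, auto)
  also have "\<dots> = (\<Sum>\<mu>\<in>partitions n. of_nat (card {T \<in> SYT \<mu>. P (Des T)}) * g (part \<mu>))"
    by (rule sum.cong) (auto simp: card_SYT_eq_card_lattice_words)
  finally show ?thesis .
qed

lemma sum_words_wdes_eq_sum_SYT:
  "(\<Sum>w | w \<in> words {..<N} n \<and> P (wdes w). wt x w) =
    (\<Sum>\<mu>\<in>partitions n. of_nat (card {T \<in> SYT \<mu>. P (Des T)}) * sch N x (part \<mu>))"
  unfolding sum_words_wdes by (rule sum_lattice_words_eq_sum_SYT)

section \<open>Symmetric functions as characters\<close>

definition segment :: "nat list \<Rightarrow> nat \<Rightarrow> 'a list \<Rightarrow> 'a list" where
  "segment lam i w = take (lam ! i) (drop (offset lam i) w)"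

lemma offset_simps: "offset (m # lam) 0 = 0" "offset (m # lam) (Suc i) = m + offset lam i"
  by (simp_all add: offset_def)

lemma sum_words_segments:
  "(\<Sum>w | w \<in> words A (sum_list lam) \<and> (\<forall>i<length lam. C (lam ! i) (segment lam i w)). wt x w) =
    (\<Prod>m\<leftarrow>lam. \<Sum>w | w \<in> words A m \<and> C m w. wt x w)" if A: "finite A"
proof (induction lam)
  case Nil
  then show ?case by simp
next
  case (Cons m lam)
  have if_sum: "(\<Sum>w | w \<in> words A k \<and> Q w. wt x w) = (\<Sum>w\<in>words A k. if Q w then wt x w else 0)" for k Q
    by (rule sum.inter_filter[OF finite_words[OF A]])
  have if_conn: "(if P \<and> Q then wt x (u @ v) else 0) =
      (if P then wt x u else 0) * (if Q then wt x v else 0)" for P Q u v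
    by simp
  have seg: "(\<forall>i<length (m # lam). C ((m # lam) ! i) (segment (m # lam) i (u @ v))) \<longleftrightarrow>
      C m u \<and> (\<forall>i<length lam. C (lam ! i) (segment lam i v))" if "u \<in> words A m" for u v
    using words_length[OF that] by (simp add: All_less_Suc2 segment_def offset_simps)
  have "(\<Sum>w | w \<in> words A (sum_list (m # lam)) \<and>
      (\<forall>i<length (m # lam). C ((m # lam) ! i) (segment (m # lam) i w)). wt x w) =
      (\<Sum>u\<in>words A m. \<Sum>v\<in>words A (sum_list lam).
        (if C m u then wt x u else 0) * (if \<forall>i<length lam. C (lam ! i) (segment lam i v) then wt x v else 0))"
    unfolding if_sum sum_list.Cons sum_words_append
    by (intro sum.cong refl) (simp only: seg if_conn)
  also have "\<dots> = (\<Sum>w | w \<in> words A m \<and> C m w. wt x w) *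
      (\<Sum>w | w \<in> words A (sum_list lam) \<and> (\<forall>i<length lam. C (lam ! i) (segment lam i w)). wt x w)"
    unfolding if_sum sum_product ..
  finally show ?case unfolding Cons.IH by simp
qed

text \<open>\<open>block_Des\<close> as an operation on the descent set alone, so that the condition
  in \<open>SYT_maj\<close> takes the form \<open>P (Des T)\<close> and transfers to words.\<close>

definition block_part :: "nat list \<Rightarrow> nat \<Rightarrow> nat set \<Rightarrow> nat set" where
  "block_part lam i S = {d - offset lam i |d. d \<in> S \<and> d \<in> block lam i \<and> d + 1 \<in> block lam i}"

lemma offset_le: "i < length lam \<Longrightarrow> offset lam i + lam ! i \<le> sum_list lam"
proof (induction lam arbitrary: i)
  case (Cons m lam)
  then show ?case by (cases i) (auto simp: offset_simps)
qed simp

lemma block_part_wdes: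
  assumes "i < length lam" "length w = sum_list lam"
  shows "block_part lam i (wdes w) = wdes (segment lam i w)"
proof -
  let ?o = "offset lam i" and ?s = "segment lam i w"
  have le: "?o + lam ! i \<le> length w" using offset_le[OF assms(1)] assms(2) by simp
  then have len: "length ?s = lam ! i" by (simp add: segment_def)
  have nth: "?s ! j = w ! (?o + j)" if "j < lam ! i" for j using that le by (simp add: segment_def)
  show ?thesis
  proof (intro equalityI subsetI)
    fix j assume "j \<in> block_part lam i (wdes w)"
    then obtain d where d: "j = d - ?o" "d \<in> wdes w" "?o + 1 \<le> d" "d + 1 \<le> ?o + lam ! i"
      by (auto simp: block_part_def block_def)
    define j' where "j' = j - 1"
    have j: "d = ?o + j" "j = Suc j'" "j < lam ! i" using d by (auto simp: j'_def)
    then have "w ! (?o + j) < w ! (?o + j')" using d(2) by (simp add: wdes_def)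
    then show "j \<in> wdes ?s" using nth[of j] nth[of j'] j len by (simp add: wdes_def)
  next
    fix j assume j: "j \<in> wdes ?s"
    then obtain j' where j': "j = Suc j'" "j < lam ! i" using len by (cases j) (auto simp: wdes_def)
    then have "w ! (?o + j) < w ! (?o + j')" using j nth[of j] nth[of j'] by (simp add: wdes_def)
    then have "?o + j \<in> wdes w" using j' le by (simp add: wdes_def)
    moreover have "j = (?o + j) - ?o" by simp
    moreover have "?o + j \<in> block lam i" "?o + j + 1 \<in> block lam i" using j' by (auto simp: block_def)
    ultimately show "j \<in> block_part lam i (wdes w)" unfolding block_part_def by blast
  qed
qed

lemma sum_SYT_maj:
  assumes lam: "sum_list lam = n"
  shows "(\<Sum>\<mu>\<in>partitions n. of_nat (card (SYT_maj lam \<mu>)) * sch N x (part \<mu>)) =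
    (\<Prod>m\<leftarrow>lam. \<Sum>w | w \<in> words {..<N} m \<and> [maj w = 1] (mod m). wt x w)"
proof -
  define P where "P S \<longleftrightarrow> (\<forall>i<length lam. [\<Sum>(block_part lam i S) = 1] (mod lam ! i))" for S
  have "SYT_maj lam \<mu> = {T \<in> SYT \<mu>. P (Des T)}" for \<mu>
    by (simp add: SYT_maj_def P_def block_maj_def block_Des_def block_part_def)
  then have "(\<Sum>\<mu>\<in>partitions n. of_nat (card (SYT_maj lam \<mu>)) * sch N x (part \<mu>)) =
      (\<Sum>w | w \<in> words {..<N} n \<and> P (wdes w). wt x w)"
    by (simp add: sum_words_wdes_eq_sum_SYT)
  also have "{w. w \<in> words {..<N} n \<and> P (wdes w)} =
      {w. w \<in> words {..<N} (sum_list lam) \<and> (\<forall>i<length lam. [maj (segment lam i w) = 1] (mod lam ! i))}"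
    using lam by (auto simp: P_def block_part_wdes words_length maj_def)
  finally show ?thesis
    using sum_words_segments[where A = "{..<N}" and lam = lam and C = "\<lambda>m w. [maj w = 1] (mod m)" and x = x]
    by simp
qed

definition monom_val :: "(nat \<Rightarrow> complex) \<Rightarrow> nat multiset \<Rightarrow> complex" where
  "monom_val x M = (\<Prod>i\<in>#M. x i)"

definition msets :: "nat \<Rightarrow> nat \<Rightarrow> nat multiset set" where
  "msets N d = {M. set_mset M \<subseteq> {..<N} \<and> size M \<le> d}"

lemma finite_msets [simp]: "finite (msets N d)"
proof (rule finite_subset)
  show "msets N d \<subseteq> mset ` {ws. set ws \<subseteq> {..<N} \<and> length ws \<le> d}"
  proof
    fix M assume M: "M \<in> msets N d"
    obtain ws where "mset ws = M" using ex_mset by blast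
    then show "M \<in> mset ` {ws. set ws \<subseteq> {..<N} \<and> length ws \<le> d}"
      using M by (auto simp: msets_def image_iff intro!: exI[of _ ws])
  qed
qed (simp add: finite_lists_length_le)

lemma digits_inj:
  assumes "K > 0"
  shows "(\<And>i. i < N \<Longrightarrow> a i < K) \<Longrightarrow> (\<And>i. i < N \<Longrightarrow> b i < K) \<Longrightarrow>
    (\<Sum>i<N. a i * K ^ i) = (\<Sum>i<N. b i * K ^ i) \<Longrightarrow> i < N \<Longrightarrow> a i = (b i :: nat)"
proof (induction N arbitrary: a b i)
  case (Suc N)
  have e: "(\<Sum>i<Suc N. c i * K ^ i) = c 0 + K * (\<Sum>i<N. c (Suc i) * K ^ i)" for c :: "nat \<Rightarrow> nat"
    by (simp add: sum.lessThan_Suc_shift sum_distrib_left mult_ac del: sum.lessThan_Suc)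
  have eq: "a 0 + K * (\<Sum>i<N. a (Suc i) * K ^ i) = b 0 + K * (\<Sum>i<N. b (Suc i) * K ^ i)"
    using Suc.prems(3) by (simp only: e)
  have "a 0 = b 0" using arg_cong[OF eq, of "\<lambda>z. z mod K"] Suc.prems(1)[of 0] Suc.prems(2)[of 0] by simp
  then have "(\<Sum>i<N. a (Suc i) * K ^ i) = (\<Sum>i<N. b (Suc i) * K ^ i)" using eq assms by simp
  then have "a (Suc i) = b (Suc i)" if "i < N" for i
    using Suc.IH[of "\<lambda>i. a (Suc i)" "\<lambda>i. b (Suc i)" i] Suc.prems(1,2) that by simp
  then show ?case using \<open>a 0 = b 0\<close> Suc.prems(4) by (cases i) auto
qed simp

text \<open>Substituting \<open>x\<^sub>i = t ^ (K ^ i)\<close> for large \<open>K\<close> separates the monomials.\<close>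

lemma monom_coeffs_eq_0:
  assumes "\<And>x. (\<And>i. x i \<noteq> 0) \<Longrightarrow> (\<Sum>M\<in>msets N d. c M * monom_val x M) = 0" "M \<in> msets N d"
  shows "c M = 0"
proof -
  \<comment> \<open>Multiplicities are at most \<open>d\<close>, so they are digits in base
    \<open>K\<close> and the exponent \<open>e M\<close> determines \<open>M\<close>.\<close>
  define K where "K = Suc d"
  define e where "e M = (\<Sum>i\<in>#M. K ^ i)" for M
  have "set_mset M \<subseteq> {..<N} \<Longrightarrow> e M = (\<Sum>i<N. count M i * K ^ i)" for M
  proof (induction M)
    case (add a M)
    have "(\<Sum>i<N. count (add_mset a M) i * K ^ i) =
        (\<Sum>i<N. (if i = a then K ^ i else 0) + count M i * K ^ i)"
      by (rule sum.cong) auto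
    also have "\<dots> = K ^ a + e M" using add by (simp add: sum.distrib)
    finally show ?case by (simp add: e_def)
  qed (simp add: e_def)
  then have e_eq: "e M = (\<Sum>i<N. count M i * K ^ i)" if "M \<in> msets N d" for M
    using that by (simp add: msets_def)
  have cnt: "count M i < K" if "M \<in> msets N d" for M i
    using that count_le_size[of M i] by (simp add: msets_def K_def)
  have inj: "M = M'" if M: "M \<in> msets N d" "M' \<in> msets N d" "e M = e M'" for M M'
  proof (rule multiset_eqI)
    fix i
    show "count M i = count M' i"
    proof (cases "i < N")
      case True
      show ?thesis
        by (rule digits_inj[of K N "count M" "count M'" i])
           (use cnt M e_eq True in \<open>auto simp: K_def\<close>)
    next
      case False
      then have "i \<notin># M" "i \<notin># M'" using M by (auto simp: msets_def)
      then show ?thesis by (simp add: not_in_iff)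
    qed
  qed
  define p where "p = (\<Sum>M\<in>msets N d. monom (c M) (e M))"
  have "poly p t = 0" if "t \<noteq> 0" for t
  proof -
    have mv: "monom_val (\<lambda>i. t ^ (K ^ i)) M = t ^ e M" for M
      unfolding monom_val_def e_def by (induction M) (auto simp: power_add)
    have "poly p t = (\<Sum>M\<in>msets N d. c M * monom_val (\<lambda>i. t ^ (K ^ i)) M)"
      by (simp add: p_def poly_sum poly_monom mv)
    then show ?thesis using assms(1)[of "\<lambda>i. t ^ (K ^ i)"] that by simp
  qed
  \<comment> \<open>The hypothesis covers nonzero values only, because just those occur as
    eigenvalues of invertible matrices; infinitely many roots of \<open>p\<close> remain.\<close>
  then have sub: "UNIV - {0} \<subseteq> {t. poly p t = 0}" by auto
  have "infinite (UNIV - {0 :: complex})" by (simp add: infinite_UNIV_char_0)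
  then have "p = 0" using poly_roots_finite[of p] sub finite_subset by blast
  then have "0 = poly.coeff p (e M)" by simp
  also have "\<dots> = (\<Sum>M'\<in>msets N d. if M' = M then c M' else 0)"
    unfolding p_def coeff_sum by (rule sum.cong) (use inj assms(2) in auto)
  also have "\<dots> = c M" using assms(2) by simp
  finally show ?thesis by simp
qed

lemma eval_sym_eq:
  assumes "\<And>M. f M \<noteq> 0 \<Longrightarrow> size M \<le> d"
  shows "eval_sym f xs = (\<Sum>M\<in>msets (length xs) d. f M * monom_val ((!) xs) M)"
  unfolding eval_sym_def monom_val_def
  by (rule sum.mono_neutral_left[OF finite_msets]) (use assms in \<open>auto simp: msets_def\<close>)

section \<open>The candidate character and its symmetry\<close>

definition higher_lie_char :: "nat list \<Rightarrow> nat \<Rightarrow> power_series" where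
  "higher_lie_char lam n M = (\<Sum>\<mu>\<in>partitions n. of_nat (card (SYT_maj lam \<mu>)) * schur \<mu> M)"

lemma schur_nonzero_size: "\<mu> \<in> partitions n \<Longrightarrow> schur \<mu> M \<noteq> 0 \<Longrightarrow> size M = n"
proof -
  assume \<mu>: "\<mu> \<in> partitions n" and "schur \<mu> M \<noteq> 0"
  then have "{T \<in> SSYT \<mu>. mset (concat T) = M} \<noteq> {}" unfolding schur_def by force
  then obtain T where "T \<in> SSYT \<mu>" "mset (concat T) = M" by blast
  then have "size M = sum_list (map length T)" "map length T = \<mu>"
    using size_mset[of "concat T"] by (auto simp: SSYT_def length_concat simp del: size_mset)
  then show "size M = n" using \<mu> by (simp add: partitions_def)
qed

lemma higher_lie_char_size: "higher_lie_char lam n M \<noteq> 0 \<Longrightarrow> size M = n"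
  unfolding higher_lie_char_def
  using schur_nonzero_size by (metis (no_types, lifting) mult_eq_0_iff sum.not_neutral_contains_not_neutral)

lemma sum_schur_monom_val:
  assumes \<mu>: "\<mu> \<in> partitions n"
  shows "(\<Sum>M\<in>msets N n. schur \<mu> M * monom_val x M) = sch N x (part \<mu>)"
proof -
  let ?A = "{T \<in> SSYT \<mu>. set (concat T) \<subseteq> {..<N}}"
  have "length (concat T) = n" if "T \<in> SSYT \<mu>" for T
  proof -
    have "map length T = \<mu>" using that by (simp add: SSYT_def)
    then show ?thesis using \<mu> by (simp add: length_concat partitions_def)
  qed
  then have sub: "(\<lambda>T. mset (concat T)) ` ?A \<subseteq> msets N n"
    by (auto simp: msets_def simp del: mset_concat set_concat simp flip: set_mset_mset)
  have "sch N x (part \<mu>) = (\<Sum>T\<in>?A. wt x (concat T))" by (rule sum_SSYT(2)[OF \<mu>, symmetric])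
  also have "\<dots> = (\<Sum>M\<in>msets N n. \<Sum>T | T \<in> ?A \<and> mset (concat T) = M. wt x (concat T))"
    by (rule sum.group[symmetric, OF sum_SSYT(1)[OF \<mu>] finite_msets sub])
  also have "\<dots> = (\<Sum>M\<in>msets N n. schur \<mu> M * monom_val x M)"
  proof (rule sum.cong)
    fix M assume M: "M \<in> msets N n"
    have e: "{T. T \<in> ?A \<and> mset (concat T) = M} = {T \<in> SSYT \<mu>. mset (concat T) = M}"
    proof -
      have "set (concat T) \<subseteq> {..<N}" if "mset (concat T) = M" for T
        using M that set_mset_mset[of "concat T"] by (simp add: msets_def del: set_mset_mset mset_concat set_concat)
      then show ?thesis by blast
    qed
    have "wt x w = monom_val x (mset w)" for w
      by (simp add: monom_val_def flip: prod_mset_prod_list)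
    then have "(\<Sum>T | T \<in> ?A \<and> mset (concat T) = M. wt x (concat T)) =
        (\<Sum>T | T \<in> ?A \<and> mset (concat T) = M. monom_val x M)" by (intro sum.cong) (auto simp del: mset_concat)
    then show "(\<Sum>T | T \<in> ?A \<and> mset (concat T) = M. wt x (concat T)) = schur \<mu> M * monom_val x M"
      unfolding e by (simp add: schur_def)
  qed simp
  finally show ?thesis by simp
qed

lemma sum_higher_lie_char:
  assumes "sum_list lam = n"
  shows "(\<Sum>M\<in>msets N n. higher_lie_char lam n M * monom_val x M) =
    (\<Prod>m\<leftarrow>lam. \<Sum>w | w \<in> words {..<N} m \<and> [maj w = 1] (mod m). wt x w)"
proof -
  have "(\<Sum>M\<in>msets N n. higher_lie_char lam n M * monom_val x M) =
      (\<Sum>\<mu>\<in>partitions n. of_nat (card (SYT_maj lam \<mu>)) * (\<Sum>M\<in>msets N n. schur \<mu> M * monom_val x M))"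
    unfolding higher_lie_char_def sum_distrib_left sum_distrib_right
    by (subst sum.swap) (simp add: mult.assoc)
  also have "\<dots> = (\<Sum>\<mu>\<in>partitions n. of_nat (card (SYT_maj lam \<mu>)) * sch N x (part \<mu>))"
    by (intro sum.cong refl) (simp add: sum_schur_monom_val)
  finally show ?thesis using sum_SYT_maj[OF assms] by simp
qed

text \<open>The major index is not preserved by relabelling letters, but the sum equals a
  combination of weights of words fixed by rotations, and a bijection of the alphabet permutes
  those.\<close>

lemma sum_words_maj_permute:
  assumes \<rho>: "bij_betw \<rho> A A" and A: "finite (A :: nat set)" and m: "0 < m"
  shows "(\<Sum>w | w \<in> words A m \<and> [maj w = 1] (mod m). wt (x \<circ> \<rho>) w) =
    (\<Sum>w | w \<in> words A m \<and> [maj w = 1] (mod m). wt x w)"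
proof -
  let ?q = "cis (2 * pi / real m)"
  let ?F = "\<lambda>j. {w. w \<in> words A m \<and> rotate j w = w}"
  have q: "primitive_root m ?q" by (rule primitive_root_cis[OF m])
  have key: "of_nat m * (\<Sum>w | w \<in> words A m \<and> [maj w = 1] (mod m). wt y w) =
      (\<Sum>j<m. inverse (?q ^ j) * (\<Sum>w\<in>?F j. wt y w))" for y
  proof -
    have "(\<Sum>w | w \<in> words A m \<and> [maj w = 1] (mod m). wt y w) =
        (\<Sum>w | w \<in> words A m \<and> [rmaj w = 1] (mod m). wt y w)"
      by (rule sum.reindex_bij_witness[of _ rev rev])
         (auto simp: words_def maj_rev rmaj_rev simp flip: rev_map)
    then show ?thesis using sum_words_rmaj_cong_1[OF q A, of y] by simp
  qed
  have "(\<Sum>w\<in>?F j. wt (x \<circ> \<rho>) w) = (\<Sum>w\<in>?F j. wt x w)" for j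
  proof -
    have inj: "inj_on \<rho> A" and img: "\<rho> ` A = A" using \<rho> by (auto simp: bij_betw_def)
    have injm: "map \<rho> u = map \<rho> v \<longleftrightarrow> u = v" if "set u \<subseteq> A" "set v \<subseteq> A" for u v
      using inj_on_map_eq_map[of \<rho> u v] inj that by (meson Un_least inj_on_subset)
    have "inj_on (map \<rho>) (?F j)" using injm by (auto simp: inj_on_def words_def)
    moreover have "map \<rho> ` ?F j \<subseteq> ?F j" using img by (force simp: words_def rotate_map)
    moreover have "finite (?F j)" using A by simp
    ultimately have "bij_betw (map \<rho>) (?F j) (?F j)" by (simp add: bij_betw_def endo_inj_surj)
    from sum.reindex_bij_betw[OF this, of "wt x"] show ?thesis by (simp add: o_def)
  qed
  then have "of_nat m * (\<Sum>w | w \<in> words A m \<and> [maj w = 1] (mod m). wt (x \<circ> \<rho>) w) =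
      of_nat m * (\<Sum>w | w \<in> words A m \<and> [maj w = 1] (mod m). wt x w)"
    unfolding key by simp
  then show ?thesis using m by simp
qed

text \<open>Symmetry is demanded for all bijections of the natural numbers, while only finitely many
  variables are handled at a time. On a finite set such a bijection agrees with a permutation of an
  initial segment.\<close>

lemma bij_extend_finite:
  assumes "bij \<pi>" "finite (A :: nat set)"
  shows "\<exists>N \<rho>. A \<subseteq> {..<N} \<and> bij_betw \<rho> {..<N} {..<N} \<and> (\<forall>a\<in>A. \<rho> a = \<pi> a)"
proof -
  define N where "N = Suc (Max (insert 0 (A \<union> \<pi> ` A)))"
  have lt: "a < N" if "a \<in> A \<union> \<pi> ` A" for a
    unfolding N_def less_Suc_eq_le using assms(2) that by (intro Max_ge) auto
  have sub: "A \<subseteq> {..<N}" "\<pi> ` A \<subseteq> {..<N}" using lt by auto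
  have inj: "inj_on \<pi> A" using assms(1) by (meson bij_is_inj inj_on_subset subset_UNIV)
  have "card ({..<N} - A) = card ({..<N} - \<pi> ` A)"
    using sub assms(2) by (simp add: card_Diff_subset card_image[OF inj])
  then obtain h where h: "bij_betw h ({..<N} - A) ({..<N} - \<pi> ` A)"
    using finite_same_card_bij[of "{..<N} - A" "{..<N} - \<pi> ` A"] by auto
  define \<rho> where "\<rho> a = (if a \<in> A then \<pi> a else h a)" for a
  have "bij_betw \<rho> A (\<pi> ` A)" using inj by (auto simp: bij_betw_def \<rho>_def inj_on_def)
  moreover have "bij_betw \<rho> ({..<N} - A) ({..<N} - \<pi> ` A)"
    using h by (subst bij_betw_cong[of _ _ h]) (auto simp: \<rho>_def)
  ultimately have "bij_betw \<rho> (A \<union> ({..<N} - A)) (\<pi> ` A \<union> ({..<N} - \<pi> ` A))"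
    by (rule bij_betw_combine) auto
  then have "bij_betw \<rho> {..<N} {..<N}" using sub by (simp add: Un_absorb1)
  then show ?thesis using sub by (auto simp: \<rho>_def intro!: exI[of _ N] exI[of _ \<rho>])
qed

lemma symmetric_higher_lie_char:
  assumes lam: "lam \<in> partitions n"
  shows "symmetric_function (higher_lie_char lam n)"
  unfolding symmetric_function_def
proof (intro conjI allI impI)
  let ?f = "higher_lie_char lam n"
  show "\<exists>d. \<forall>M. ?f M \<noteq> 0 \<longrightarrow> size M \<le> d"
    using higher_lie_char_size by (intro exI[of _ n]) fastforce
  fix \<pi> :: "nat \<Rightarrow> nat" and M assume "bij \<pi>"
  then obtain N \<rho> where N: "set_mset M \<subseteq> {..<N}" and \<rho>: "bij_betw \<rho> {..<N} {..<N}"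
    and \<rho>\<pi>: "\<forall>a\<in>set_mset M. \<rho> a = \<pi> a"
    using bij_extend_finite[of \<pi> "set_mset M"] by auto
  have im: "image_mset \<pi> M = image_mset \<rho> M" using \<rho>\<pi> by (intro image_mset_cong) auto
  have lamn: "sum_list lam = n" and pos: "\<forall>p\<in>set lam. 0 < p" using lam by (auto simp: partitions_def)
  let ?S = "msets N n"
  have mv: "monom_val x (image_mset \<rho> M) = monom_val (x \<circ> \<rho>) M" for x M
    by (simp add: monom_val_def image_mset.compositionality o_def)
  have bij: "bij_betw (image_mset \<rho>) ?S ?S"
  proof -
    obtain \<tau> where \<tau>: "\<And>a. a < N \<Longrightarrow> \<tau> (\<rho> a) = a" "\<And>a. a < N \<Longrightarrow> \<rho> (\<tau> a) = a" "\<And>a. a < N \<Longrightarrow> \<tau> a < N"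
      using bij_betw_inv_into_left[OF \<rho>] bij_betw_inv_into_right[OF \<rho>] bij_betw_apply[OF bij_betw_inv_into[OF \<rho>]]
      by (metis lessThan_iff)
    have \<rho>N: "\<rho> a < N" if "a < N" for a using bij_betw_apply[OF \<rho>] that by auto
    have id: "image_mset g M = M" if "M \<in> ?S" "\<And>a. a < N \<Longrightarrow> g a = a" for g M
    proof -
      have "image_mset g M = image_mset (\<lambda>a. a) M" using that by (intro image_mset_cong) (auto simp: msets_def)
      then show ?thesis by simp
    qed
    show ?thesis
    proof (rule bij_betw_byWitness[where f' = "image_mset \<tau>"])
      show "\<forall>M\<in>?S. image_mset \<tau> (image_mset \<rho> M) = M"
        using id[of _ "\<tau> \<circ> \<rho>"] \<tau> by (simp add: image_mset.compositionality)
      show "\<forall>M\<in>?S. image_mset \<rho> (image_mset \<tau> M) = M"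
        using id[of _ "\<rho> \<circ> \<tau>"] \<tau> by (simp add: image_mset.compositionality)
    qed (use \<rho>N \<tau>(3) in \<open>fastforce simp: msets_def subset_iff\<close>)+
  qed
  show "?f (image_mset \<pi> M) = ?f M"
  proof (cases "size M = n")
    case False
    then show ?thesis by (metis higher_lie_char_size size_image_mset)
  next
    case True
    have inv: "(\<Sum>M\<in>?S. ?f M * monom_val (x \<circ> \<rho>) M) = (\<Sum>M\<in>?S. ?f M * monom_val x M)" for x
      unfolding sum_higher_lie_char[OF lamn]
      by (rule arg_cong[where f = prod_list], rule map_cong)
         (use pos sum_words_maj_permute[OF \<rho>] in auto)
    have "(\<Sum>M\<in>?S. (?f (image_mset \<rho> M) - ?f M) * monom_val (x \<circ> \<rho>) M) = 0" for x
    proof -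
      have "(\<Sum>M\<in>?S. ?f (image_mset \<rho> M) * monom_val (x \<circ> \<rho>) M) = (\<Sum>M\<in>?S. ?f M * monom_val x M)"
        using sum.reindex_bij_betw[OF bij, of "\<lambda>M. ?f M * monom_val x M"] by (simp add: mv)
      then show ?thesis by (simp add: left_diff_distrib sum_subtractf inv)
    qed
    note z = this
    have "(\<Sum>M\<in>?S. (?f (image_mset \<rho> M) - ?f M) * monom_val x M) = 0" for x
    proof -
      \<comment> \<open>Substituting \<open>x \<circ> ?\<tau>\<close> for \<open>x\<close> in
        \<open>z\<close> removes the permutation from the argument, giving the form that
        \<open>monom_coeffs_eq_0\<close> expects.\<close>
      let ?\<tau> = "inv_into {..<N} \<rho>"
      have "monom_val (x \<circ> ?\<tau> \<circ> \<rho>) M = monom_val x M" if "M \<in> ?S" for M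
      proof -
        have "image_mset (x \<circ> ?\<tau> \<circ> \<rho>) M = image_mset x M"
          using that bij_betw_inv_into_left[OF \<rho>] by (intro image_mset_cong) (auto simp: msets_def)
        then show ?thesis unfolding monom_val_def by (rule arg_cong)
      qed
      then show ?thesis using z[of "x \<circ> ?\<tau>"] by simp
    qed
    then have "?f (image_mset \<rho> M) - ?f M = 0"
      by (intro monom_coeffs_eq_0[where N = N and d = n and c = "\<lambda>M. ?f (image_mset \<rho> M) - ?f M"]) (use N True in \<open>auto simp: msets_def\<close>)
    then show ?thesis by (simp add: im)
  qed
qed

section \<open>Existence and uniqueness of the character\<close>

lemma length_eigenvalues:
  fixes g :: "complex mat"
  assumes g: "g \<in> carrier_mat N N" and cp: "char_poly g = (\<Prod>x\<leftarrow>xs. [:- x, 1:])"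
  shows "length xs = N"
proof -
  obtain B P Q where s: "schur_decomposition g xs = (B, P, Q)" by (cases "schur_decomposition g xs") auto
  from schur_decomposition[OF g cp s] have "similar_mat_wit g B P Q" "diag_mat B = xs" by auto
  then show ?thesis using g by (auto simp: similar_mat_wit_def Let_def diag_mat_def)
qed

lemma is_character_higher_lie_char:
  assumes lam: "lam \<in> partitions n" "distinct lam"
  shows "is_character (higher_lie lam) higher_lie_action (higher_lie_char lam n)"
  unfolding is_character_def
proof (intro conjI allI impI)
  show "symmetric_function (higher_lie_char lam n)" by (rule symmetric_higher_lie_char[OF lam(1)])
  fix N and g :: "complex mat" and xs assume "g \<in> carrier_mat N N \<and> invertible_mat g \<and> char_poly g = (\<Prod>x\<leftarrow>xs. [:- x, 1:])"
  then have g: "g \<in> carrier_mat N N" and cp: "char_poly g = (\<Prod>x\<leftarrow>xs. [:- x, 1:])" by auto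
  have "sum_list lam = n" using lam by (simp add: partitions_def)
  moreover have "higher_lie_char lam n M \<noteq> 0 \<Longrightarrow> size M \<le> n" for M using higher_lie_char_size by fastforce
  ultimately show "trace_on (higher_lie lam N) (higher_lie_action g) = eval_sym (higher_lie_char lam n) xs"
    using length_eigenvalues[OF g cp] trace_higher_lie[OF lam g cp]
    by (simp add: eval_sym_eq[of _ n] sum_higher_lie_char)
qed

lemma ex_invertible_mat_eigenvalues:
  assumes "\<And>i. x i \<noteq> (0 :: complex)"
  shows "\<exists>g. g \<in> carrier_mat N N \<and> invertible_mat g \<and> char_poly g = (\<Prod>a\<leftarrow>map x [0..<N]. [:- a, 1:])"
proof -
  define D where "D y = mat N N (\<lambda>(i, j). if i = j then y i else (0 :: complex))" for y
  have mult: "D y * D z = 1\<^sub>m N" if "\<And>i. y i * z i = 1" for y z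
  proof (rule eq_matI)
    fix i j assume "i < dim_row (1\<^sub>m N :: complex mat)" "j < dim_col (1\<^sub>m N :: complex mat)"
    then have ij: "i < N" "j < N" by auto
    have "(D y * D z) $$ (i, j) = (\<Sum>k\<in>{0..<N}. (if i = k then y i else 0) * (if k = j then z k else 0))"
      using ij by (simp add: D_def scalar_prod_def)
    also have "\<dots> = (\<Sum>k\<in>{0..<N}. if k = i then (if i = j then y i * z i else 0) else 0)"
      by (rule sum.cong) auto
    also have "\<dots> = (1\<^sub>m N :: complex mat) $$ (i, j)" using ij that by simp
    finally show "(D y * D z) $$ (i, j) = (1\<^sub>m N :: complex mat) $$ (i, j)" .
  qed (simp_all add: D_def)
  have car: "D y \<in> carrier_mat N N" for y by (simp add: D_def)
  have "D x * D (\<lambda>i. inverse (x i)) = 1\<^sub>m N" "D (\<lambda>i. inverse (x i)) * D x = 1\<^sub>m N"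
    using assms by (auto intro!: mult)
  then have "invertible_mat (D x)"
    unfolding invertible_mat_def inverts_mat_def using car[of x] car[of "\<lambda>i. inverse (x i)"]
    by (auto intro!: exI[of _ "D (\<lambda>i. inverse (x i))"])
  moreover have "upper_triangular (D x)" by (auto simp: upper_triangular_def D_def)
  then have "char_poly (D x) = (\<Prod>a\<leftarrow>diag_mat (D x). [:- a, 1:])"
    by (rule char_poly_upper_triangular[OF car])
  moreover have "diag_mat (D x) = map x [0..<N]" by (auto simp: diag_mat_def D_def)
  ultimately show ?thesis using car[of x] by auto
qed

text \<open>Diagonal matrices realise every tuple of nonzero eigenvalues, and these values determine
  all coefficients of bounded degree in \<open>N\<close> variables; \<open>N\<close> and
  \<open>d\<close> are chosen large enough to reach the monomial \<open>M\<close>.\<close>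

lemma is_character_unique:
  assumes f: "is_character W \<rho> f" and g: "is_character W \<rho> g"
  shows "f = g"
proof
  fix M :: "nat multiset"
  obtain d1 d2 where d: "\<And>M. f M \<noteq> 0 \<Longrightarrow> size M \<le> d1" "\<And>M. g M \<noteq> 0 \<Longrightarrow> size M \<le> d2"
    using f g by (auto simp: is_character_def symmetric_function_def)
  define d where "d = max (max d1 d2) (size M)"
  have df: "f M' \<noteq> 0 \<Longrightarrow> size M' \<le> d" and dg: "g M' \<noteq> 0 \<Longrightarrow> size M' \<le> d" for M'
    using d[of M'] by (auto simp: d_def)
  define N where "N = Suc (Max (insert 0 (set_mset M)))"
  have "i < N" if "i \<in># M" for i unfolding N_def less_Suc_eq_le using that by (intro Max_ge) auto
  then have M: "M \<in> msets N d" by (auto simp: msets_def d_def)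
  have "(\<Sum>M\<in>msets N d. (f M - g M) * monom_val x M) = 0" if x: "\<And>i. x i \<noteq> 0" for x
  proof -
    obtain h where "h \<in> carrier_mat N N \<and> invertible_mat h \<and> char_poly h = (\<Prod>a\<leftarrow>map x [0..<N]. [:- a, 1:])"
      using ex_invertible_mat_eigenvalues[of x N] x by blast
    then have "trace_on (W N) (\<rho> h) = eval_sym f (map x [0..<N])" "trace_on (W N) (\<rho> h) = eval_sym g (map x [0..<N])"
      using f g unfolding is_character_def by blast+
    then have "eval_sym f (map x [0..<N]) = eval_sym g (map x [0..<N])" by simp
    moreover have "monom_val ((!) (map x [0..<N])) M' = monom_val x M'" if "M' \<in> msets N d" for M'
    proof -
      have "image_mset ((!) (map x [0..<N])) M' = image_mset x M'"
        using that by (intro image_mset_cong) (auto simp: msets_def)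
      then show ?thesis by (simp add: monom_val_def)
    qed
    ultimately show ?thesis
      by (simp add: eval_sym_eq[of f d, OF df] eval_sym_eq[of g d, OF dg] left_diff_distrib sum_subtractf)
  qed
  from monom_coeffs_eq_0[OF this M] show "f M = g M" by simp
qed

theorem theorem3p6:
  fixes lam :: "nat list" and n :: nat
  assumes "lam \<in> partitions n" and "distinct lam"
  shows "ch_higher_lie lam = (\<lambda>M. \<Sum>\<mu>\<in>partitions n. of_nat (card (SYT_maj lam \<mu>)) * schur \<mu> M)"
proof -
  have "ch_higher_lie lam = higher_lie_char lam n"
    unfolding ch_higher_lie_def
    by (rule the_equality, rule is_character_higher_lie_char[OF assms],
      erule is_character_unique, rule is_character_higher_lie_char[OF assms])
  then show ?thesis by (simp add: higher_lie_char_def[abs_def])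
qed

end
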